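(* For all real numbers $\tau$ and $x>0$, $$\sum_{0<\gamma<x}\gamma^{-i\tau}=\frac{x^{1-i\tau}}{2\pi(1-i\tau)}\left(\log \frac{x}{2\pi}-\frac{1}{1-i\tau}\right)+O\big(|\tau|(\log x)^2\big),$$ where the implied constant is absolute.
   Context: $\rho=\beta+i\gamma$ runs over the nontrivial (non-real) zeros of the Riemann zeta-function $\zeta(s)$, counted with multiplicity; the sum is over those zeros with ordinate $0<\gamma<x$. For $\gamma>0$, $\gamma^{-i\tau}=e^{-i\tau\log\gamma}$.
   Formalization: As stated the bound fails (τ=0, x=1: empty sum, nonzero main term, zero error). Proved instead, with one absolute constant: the stated error O(|τ|(log x)^2) whenever |τ log x| ≥ 1, and the error O(|τ|(log x)^2 + log(x+2)) for all real τ and x>0. *)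

theory Defs
  imports "HOL-Complex_Analysis.Complex_Analysis"
begin

(* The Riemann zeta-function as the analytic continuation of its Dirichlet series to the plane
   without 1. By the identity theorem there is at most one such continuation; existence is
   classical. The value at the pole 1 is fixed only to make the description unique. *)
definition zeta :: "complex \<Rightarrow> complex" where
  "zeta = (THE f. f holomorphic_on - {1} \<and>
                  (\<forall>s. Re s > 1 \<longrightarrow> f s = (\<Sum>n. 1 / of_nat (Suc n) powr s)) \<and>
                  f 1 = 0)"

definition nontrivial_zeros :: "complex set" where
  "nontrivial_zeros = {\<rho>. zeta \<rho> = 0 \<and> Im \<rho> \<noteq> 0}"

(* zorder is the multiplicity of the zero. The base of powr is a positive real here, so powr uses
   the real logarithm. The index set is finite, because nonreal zeros lie in the critical strip. *)
definition zero_ordinate_sum :: "real \<Rightarrow> real \<Rightarrow> complex" where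
  "zero_ordinate_sum \<tau> x =
     (\<Sum>\<rho> | \<rho> \<in> nontrivial_zeros \<and> 0 < Im \<rho> \<and> Im \<rho> < x.
        of_int (zorder zeta \<rho>) * complex_of_real (Im \<rho>) powr (- (\<i> * of_real \<tau>)))"

definition zero_ordinate_main :: "real \<Rightarrow> real \<Rightarrow> complex" where
  "zero_ordinate_main \<tau> x =
     complex_of_real x powr (1 - \<i> * of_real \<tau>) / (2 * of_real pi * (1 - \<i> * of_real \<tau>)) *
     (of_real (ln (x / (2 * pi))) - 1 / (1 - \<i> * of_real \<tau>))"

(* Pitfall: the bound C * \<bar>\<tau>\<bar> * (ln x)^2 cannot hold for literally all \<tau> and all x > 0. It vanishes
   for \<tau> = 0 and for x = 1; at \<tau> = 0, x = 1 the sum is a number of zeros, while the main term is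
   negative. Partial summation against the Riemann-von Mangoldt formula has a boundary term
   of order ln x, which is dominated by \<bar>\<tau>\<bar> * (ln x)^2 when \<bar>\<tau> * ln x\<bar> \<ge> 1. *)

end

theory Submission
  imports Defs
begin

text \<open>
  With \<open>N(t)\<close> the number of zeros of ordinate below \<open>t\<close>, partial summation reduces the claim to the
  Riemann--von Mangoldt formula \<open>N(t) = t / (2 \<pi>) (ln (t / (2 \<pi>)) - 1) + O(ln t)\<close>: the error term contributes
  \<open>O(ln x)\<close> at the boundary and \<open>\<bar>\<tau>\<bar>\<close> times the integral of \<open>ln t / t\<close>.
  The formula follows from the argument principle on the rectangle \<open>[-1, 2] \<times> [1, T]\<close>. The functional
  equation reflects the left half of the contour onto the right half at the cost of the argument of the
  Gamma factor, which is the main term because \<open>\<Gamma>' / \<Gamma>\<close> is the logarithm up to \<open>O(1 / t)\<close>. On the upper edge the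
  argument changes by \<open>O(ln T)\<close> since \<open>\<zeta>\<close> has polynomial growth.

  For \<open>x\<close> near \<open>1\<close> the first bound tends to \<open>0\<close> when \<open>\<bar>\<tau> * ln x\<bar> = 1\<close>, so it also requires
  that no zero has ordinate in \<open>(0, 1]\<close>; this is read off the trapezoid approximation of \<open>\<zeta>\<close>.
\<close>

text \<open>\<open>zeta\<close> is a definite description, so nothing can be said about it before a
  continuation has been built. The trapezoid series supplies one for Re s > -1, which reaches just
  past the line Re s = 0. In the strip gained there the functional equation is proved from the
  series itself; it both defines the function further left and relates the two halves of the
  contour. The explicit trapezoid error serves twice: for the growth on discs around 2 + iT and for
  zero-freeness up to height 1. The lower edge of the rectangle can therefore stay at height 1,
  above the pole, without losing a zero. Its vertical edges are zero-free because the Dirichlet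
  series and reflection confine the zeros to -1 < Re s < 2. Heights T that are themselves ordinates
  are reached from the left, the count being strict. In the first bound the boundary term is
  absorbed because |\<tau> ln x| \<ge> 1 gives |ln x| \<le> |\<tau>| (ln x)^2; near x = 1 the main
  term is small thanks to the factor 1 / |1 - i\<tau>|.\<close>

section \<open>Change of argument along a segment\<close>

text \<open>The map v / (2A - v) sends the half-plane Re v < A into the unit disc and fixes 0.
  Schwarz's lemma for its composition with \<open>h\<close> gives R |h z| \<le> |z| (2A + |h z|),
  which is solved for |h z|.\<close>

lemma Borel_Caratheodory:
  assumes h: "h holomorphic_on ball 0 R" and R: "R > 0" and h0: "h 0 = 0" 
    and A: "A > 0" "\<And>z. norm z < R \<Longrightarrow> Re (h z) < A" and z: "norm z < R"
  shows "norm (h z) \<le> 2 * A * norm z / (R - norm z)"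
proof -
  define k where "k = (\<lambda>w. h (of_real R * w) / (2 * of_real A - h (of_real R * w)))"
  have lt: "norm (of_real R * w) < R" if "norm w < 1" for w :: complex
    using that R by (simp add: norm_mult)
  have nz: "2 * of_real A - h (of_real R * w) \<noteq> 0" if "norm w < 1" for w
  proof
    assume "2 * of_real A - h (of_real R * w) = 0"
    hence "Re (h (of_real R * w)) = 2 * A" by (auto simp: complex_eq_iff)
    with A(2)[OF lt[OF that]] A(1) show False by simp
  qed
  have kh: "k holomorphic_on ball 0 1"
    unfolding k_def
  proof (intro holomorphic_intros)
    have "(h \<circ> (\<lambda>w. of_real R * w)) holomorphic_on ball 0 1"
      by (rule holomorphic_on_compose_gen[OF _ h]) (use R in \<open>auto intro!: holomorphic_intros simp: norm_mult\<close>)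
    thus "(\<lambda>w. h (of_real R * w)) holomorphic_on ball 0 1" by (simp add: o_def)
    thus "(\<lambda>w. h (of_real R * w)) holomorphic_on ball 0 1" .
  qed (use nz in auto)
  have knorm: "norm (k w) < 1" if "norm w < 1" for w
  proof -
    define v where "v = h (of_real R * w)"
    have v: "Re v < A" using A(2)[OF lt[OF that]] by (simp add: v_def)
    \<comment> \<open>A point to the left of the line Re v = A is closer to 0 than to the mirror
      image 2A of 0.\<close>
    have "norm v ^ 2 < norm (2 * of_real A - v) ^ 2"
    proof -
      have "norm (2 * of_real A - v) ^ 2 - norm v ^ 2 = 4 * A * (A - Re v)"
        unfolding cmod_power2 by (simp add: power2_eq_square algebra_simps)
      also have "\<dots> > 0" using A(1) v by simp
      finally show ?thesis by simp
    qed
    hence "norm v < norm (2 * of_real A - v)" by (rule power_less_imp_less_base) simp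
    thus ?thesis unfolding k_def v_def[symmetric] norm_divide
      by (smt (verit) divide_less_eq_1_pos norm_ge_zero)
  qed
  define w where "w = z / of_real R"
  have w: "norm w < 1" "of_real R * w = z" using z R by (auto simp: w_def norm_divide)
  have "norm (k w) \<le> norm w"
    by (rule Schwarz_Lemma(1)[OF kh _ knorm w(1)]) (auto simp: k_def h0)
  hence "norm (h z) \<le> norm w * norm (2 * of_real A - h z)"
    using nz[OF w(1)] by (simp add: k_def w norm_divide divide_simps)
  also have "\<dots> \<le> norm w * (2 * A + norm (h z))"
    using norm_triangle_ineq4[of "2 * of_real A" "h z"] A(1) by (intro mult_left_mono) auto
  also have "norm w = norm z / R" using R by (simp add: w_def norm_divide)
  finally have "norm (h z) * R \<le> norm z * (2 * A + norm (h z))"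
    using R by (simp add: divide_simps)
  hence "norm (h z) * (R - norm z) \<le> 2 * A * norm z" by (simp add: algebra_simps)
  thus ?thesis using z by (simp add: pos_le_divide_eq)
qed

text \<open>A segment that misses \<rho> lies in an open half-plane bounded by a line through
  \<rho>. After a rotation by \<open>c\<close> the principal logarithm is a primitive along it, and
  each end contributes an argument of at most \<pi>.\<close>

lemma Im_integral_inverse_segment:
  assumes "\<rho> \<notin> closed_segment a b"
  shows "\<bar>Im (contour_integral (linepath a b) (\<lambda>z. 1 / (z - \<rho>)))\<bar> \<le> 2 * pi"
proof -
  obtain c where c: "c \<noteq> 0" "\<And>z. z \<in> closed_segment a b \<Longrightarrow> Re (c * (z - \<rho>)) > 0"
  proof -
    \<comment> \<open>The point of the segment nearest to \<rho> supplies the direction of the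
      half-plane: by convexity the segment stays on its far side.\<close>
    obtain v where v: "v \<in> closed_segment a b" "\<And>y. y \<in> closed_segment a b \<Longrightarrow> dist \<rho> v \<le> dist \<rho> y"
      using distance_attains_inf[of "closed_segment a b" \<rho>] by auto
    have "inner (v - \<rho>) (z - \<rho>) > 0" if z: "z \<in> closed_segment a b" for z
    proof -
      have "inner (\<rho> - v) (z - v) \<le> 0"
        using any_closest_point_dot[of "closed_segment a b" v z \<rho>] v z by auto
      moreover have "inner (v - \<rho>) (v - \<rho>) > 0" using v assms by auto
      moreover have "inner (v - \<rho>) (z - \<rho>) = inner (v - \<rho>) (v - \<rho>) - inner (\<rho> - v) (z - v)"
        by (simp add: inner_simps algebra_simps)
      ultimately show ?thesis by linarith
    qed
    moreover have "inner x y = Re (cnj x * y)" for x y :: complex by (simp add: inner_complex_def)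
    moreover have "v \<noteq> \<rho>" using v assms by auto
    ultimately show ?thesis by (intro that[of "cnj (v - \<rho>)"]) auto
  qed
  have D: "((\<lambda>z. Ln (c * (z - \<rho>))) has_field_derivative 1 / (z - \<rho>)) (at z within closed_segment a b)"
    if z: "z \<in> closed_segment a b" for z
  proof -
    have "c * (z - \<rho>) \<notin> \<real>\<^sub>\<le>\<^sub>0" using c(2)[OF z] by (auto simp: complex_nonpos_Reals_iff)
    moreover have "z \<noteq> \<rho>" using z assms by auto
    ultimately show ?thesis using c(1) by (auto intro!: derivative_eq_intros simp: divide_simps)
  qed
  have "((\<lambda>z. 1 / (z - \<rho>)) has_contour_integral (Ln (c * (pathfinish (linepath a b) - \<rho>)) - Ln (c * (pathstart (linepath a b) - \<rho>)))) (linepath a b)"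
    by (rule contour_integral_primitive[OF D]) auto
  hence e: "contour_integral (linepath a b) (\<lambda>z. 1 / (z - \<rho>)) = Ln (c * (b - \<rho>)) - Ln (c * (a - \<rho>))"
    by (simp add: contour_integral_unique)
  have "c * (b - \<rho>) \<noteq> 0" "c * (a - \<rho>) \<noteq> 0" using c(2)[of a] c(2)[of b] by force+
  hence "\<bar>Im (Ln (c * (b - \<rho>)))\<bar> \<le> pi" "\<bar>Im (Ln (c * (a - \<rho>)))\<bar> \<le> pi"
    using mpi_less_Im_Ln Im_Ln_le_pi by (metis abs_le_iff less_eq_real_def minus_le_iff)+
  thus ?thesis unfolding e by simp
qed

text \<open>Without zeros there is a branch \<open>g\<close> of the logarithm, and the growth bound
  says that Re (g - g 0) \<le> m. Borel-Caratheodory controls \<open>g\<close> at both ends of the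
  segment; it asks for a strict and positive bound, hence m + 1.\<close>

lemma Im_log_deriv_integral_zero_free:
  fixes r R :: real
  assumes r: "0 < r" "r < R"
    and ab: "a \<in> cball 0 r" "b \<in> cball 0 r"
    and f: "f holomorphic_on ball 0 R" and nz: "\<And>z. norm z < R \<Longrightarrow> f z \<noteq> 0"
    and bd: "\<And>z. norm z < R \<Longrightarrow> norm (f z) \<le> exp m * norm (f 0)"
    and m: "m \<ge> 0"
  shows "\<bar>Im (contour_integral (linepath a b) (\<lambda>z. deriv f z / f z))\<bar> \<le> 4 * (m + 1) * r / (R - r)"
proof -
  obtain g where g: "g holomorphic_on ball 0 R" "\<And>z. z \<in> ball 0 R \<Longrightarrow> exp (g z) = f z"
    using holomorphic_logarithm_exists[of "ball 0 R" f 0] f nz r by auto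
  have g0: "exp (g 0) = f 0" using g(2)[of 0] r by simp
  have D: "(g has_field_derivative deriv f z / f z) (at z)" if z: "z \<in> ball 0 R" for z
  proof -
    have "(g has_field_derivative deriv g z) (at z)"
      using g(1) z holomorphic_derivI by blast
    moreover have "((\<lambda>z. exp (g z)) has_field_derivative exp (g z) * deriv g z) (at z)"
      by (rule derivative_eq_intros refl calculation)+
    hence "(f has_field_derivative exp (g z) * deriv g z) (at z)"
      by (rule has_field_derivative_transform_within_open[of _ _ _ "ball 0 R"]) (use g z in auto)
    hence "deriv f z = f z * deriv g z" using g(2)[OF z] by (simp add: DERIV_imp_deriv)
    ultimately show ?thesis using nz z by simp
  qed
  have seg: "closed_segment a b \<subseteq> cball 0 r"
    using ab by (intro closed_segment_subset) auto
  have "((\<lambda>z. deriv f z / f z) has_contour_integral (g (pathfinish (linepath a b)) - g (pathstart (linepath a b)))) (linepath a b)"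
    by (rule contour_integral_primitive[of "ball 0 R"])
       (use seg r in \<open>auto intro!: has_field_derivative_at_within[OF D]\<close>)
  hence e: "contour_integral (linepath a b) (\<lambda>z. deriv f z / f z) = (g b - g 0) - (g a - g 0)"
    by (simp add: contour_integral_unique)
  have B: "norm (g z - g 0) \<le> 2 * (m + 1) * r / (R - r)" if z: "z \<in> cball 0 r" for z
  proof -
    have "norm (g z - g 0) \<le> 2 * (m + 1) * norm z / (R - norm z)"
    proof (rule Borel_Caratheodory[where h = "\<lambda>z. g z - g 0"])
      fix w :: complex assume w: "norm w < R"
      have "exp (Re (g w)) \<le> exp (m + Re (g 0))"
        using bd[OF w] g(2)[of w] g0 w by (simp add: exp_add flip: norm_exp_eq_Re)
      thus "Re (g w - g 0) < m + 1" by simp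
    qed (use g r z m in \<open>auto intro!: holomorphic_intros\<close>)
    also have "\<dots> \<le> 2 * (m + 1) * r / (R - r)"
      using z r m by (intro frac_le mult_left_mono mult_nonneg_nonneg) auto
    finally show ?thesis .
  qed
  have "\<bar>Im ((g b - g 0) - (g a - g 0))\<bar> \<le> norm ((g b - g 0) - (g a - g 0))" by (rule abs_Im_le_cmod)
  also have "\<dots> \<le> norm (g b - g 0) + norm (g a - g 0)" by (rule norm_triangle_ineq4)
  also have "\<dots> \<le> 2 * (2 * (m + 1) * r / (R - r))" using B[OF ab(1)] B[OF ab(2)] by linarith
  finally show ?thesis unfolding e by (simp add: field_simps)
qed

text \<open>A zero in the inner disc is removed by multiplication with a Blaschke factor. This keeps the
  modulus on the boundary circle but enlarges the value at the centre by at least \<open>R / r1\<close>, so that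
  at most \<open>m / ln (R / r1)\<close> zeros are removed before a branch of the logarithm exists.\<close>

lemma Im_log_deriv_integral_aux:
  fixes r r1 R :: real
  assumes r: "0 < r" "r < r1" "r1 < R"
    and seg: "closed_segment a b \<subseteq> cball 0 r"
    and U: "open U" "cball 0 R \<subseteq> U" 
    and f: "f holomorphic_on U" 
    and f0: "f 0 \<noteq> 0"
    and bd: "\<And>z. norm z = R \<Longrightarrow> norm (f z) \<le> exp m * norm (f 0)"
    and nz: "\<And>z. z \<in> closed_segment a b \<Longrightarrow> f z \<noteq> 0"
    and m: "m \<le> real n * ln (R / r1)"
  shows "\<bar>Im (contour_integral (linepath a b) (\<lambda>z. deriv f z / f z))\<bar>
           \<le> 4 * (m + 1) * r / (r1 - r) + real n * (2 * pi + norm (b - a) * (r1 / (R * (R - r1))))"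
  using f f0 bd nz m
proof (induction n arbitrary: f m rule: less_induct)
  case (less n)
  note f = less.prems(1) and f0 = less.prems(2) and bd = less.prems(3) and nz = less.prems(4) and m = less.prems(5)
  \<comment> \<open>The cost of removing one zero: 2 \<pi> for 1 / (z - \<rho>), and the length of
    the segment times the maximum of the term coming from the mirror point.\<close>
  define K where "K = 2 * pi + norm (b - a) * (r1 / (R * (R - r1)))"
  have K: "K \<ge> 0" using r by (simp add: K_def)
  \<comment> \<open>Division by a Blaschke factor preserves only the bound on the circle, so the
    bound inside is recovered from the maximum principle each time. Taken at the centre it shows in
    \<open>mge\<close> that the exponent is nonnegative.\<close>
  have maxmod: "norm (h z) \<le> exp c * norm (h 0)"
    if h: "h holomorphic_on U" and hb: "\<And>z. norm z = R \<Longrightarrow> norm (h z) \<le> exp c * norm (h 0)" and z: "norm z \<le> R" 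
    for h :: "complex \<Rightarrow> complex" and c z
  proof (rule maximum_modulus_frontier[of h "cball 0 R"])
    show "h holomorphic_on interior (cball 0 R)" using h U by (metis ball_subset_cball holomorphic_on_subset interior_cball subset_trans)
    show "continuous_on (closure (cball 0 R)) h" 
      using h U by (auto intro: holomorphic_on_imp_continuous_on holomorphic_on_subset)
  qed (use z hb in auto)
  have mge: "c \<ge> 0"
    if h: "h holomorphic_on U" "h 0 \<noteq> 0" and hb: "\<And>z. norm z = R \<Longrightarrow> norm (h z) \<le> exp c * norm (h 0)" 
    for h :: "complex \<Rightarrow> complex" and c
  proof -
    have "norm (h 0) \<le> exp c * norm (h 0)" using maxmod[of h c 0] h hb r by simp
    hence "exp c \<ge> exp 0" using h by simp
    thus ?thesis by simp
  qed
  have ab: "a \<in> cball 0 r" "b \<in> cball 0 r" using seg by auto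
  show "\<bar>Im (contour_integral (linepath a b) (\<lambda>z. deriv f z / f z))\<bar> \<le> 4 * (m + 1) * r / (r1 - r) + real n * K"
  proof (cases "\<exists>\<rho>. norm \<rho> < r1 \<and> f \<rho> = 0")
    case False
    have "\<bar>Im (contour_integral (linepath a b) (\<lambda>z. deriv f z / f z))\<bar> \<le> 4 * (m + 1) * r / (r1 - r)"
    proof (rule Im_log_deriv_integral_zero_free[OF r(1,2) ab])
      show "f holomorphic_on ball 0 r1" using f U r by (auto intro!: holomorphic_on_subset[OF f])
      show "norm (f z) \<le> exp m * norm (f 0)" if "norm z < r1" for z
        using maxmod[of f m z, OF f bd] that r by auto
      show "m \<ge> 0" using mge[OF f f0 bd] .
    qed (use False in auto)
    moreover have "real n * K \<ge> 0" using K by simp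
    ultimately show ?thesis by linarith
  next
    case True
    then obtain \<rho> where \<rho>: "norm \<rho> < r1" "f \<rho> = 0" by blast
    have \<rho>U: "\<rho> \<in> U" using \<rho> r U by auto
    have \<rho>0: "\<rho> \<noteq> 0" using \<rho> f0 by auto
    have \<rho>seg: "\<rho> \<notin> closed_segment a b" using \<rho> nz by auto
    define g where "g = (\<lambda>z. if z = \<rho> then deriv f \<rho> else (f z - f \<rho>) / (z - \<rho>))"
    have g: "g holomorphic_on U" unfolding g_def by (rule pole_lemma_open[OF f U(1)])
    have fg: "f z = (z - \<rho>) * g z" for z using \<rho> by (simp add: g_def)
    \<comment> \<open>This is \<open>f\<close> divided by the Blaschke factor R (z - \<rho>) / (R^2
      - cnj \<rho> z), which has modulus 1 on |z| = R. Using the quotient \<open>g\<close> removes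
      the singularity at \<rho>.\<close>
    define f1 where "f1 = (\<lambda>z. g z * (of_real R ^ 2 - cnj \<rho> * z) / of_real R)"
    have f1: "f1 holomorphic_on U" unfolding f1_def using r by (intro holomorphic_intros g) auto
    have g0: "g 0 \<noteq> 0" using fg[of 0] f0 by auto
    have f10: "norm (f1 0) = norm (f 0) * (R / norm \<rho>)" 
      using r \<rho>0 by (simp add: f1_def fg[of 0] norm_mult norm_divide power2_eq_square)
    have Bnz: "of_real R ^ 2 - cnj \<rho> * z \<noteq> 0" "norm (of_real R ^ 2 - cnj \<rho> * z) \<ge> R * (R - r1)" if "norm z \<le> R" for z
    proof -
      have "norm (cnj \<rho> * z) \<le> r1 * R" unfolding norm_mult using \<rho> that r by (intro mult_mono) auto
      moreover have "norm (of_real R ^ 2 :: complex) = R * R" using r by (simp add: norm_power power2_eq_square norm_mult)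
      ultimately show "norm (of_real R ^ 2 - cnj \<rho> * z) \<ge> R * (R - r1)"
        using norm_triangle_ineq2[of "of_real R ^ 2" "cnj \<rho> * z"] by (simp add: algebra_simps)
      moreover have "R * (R - r1) > 0" using r by simp
      ultimately show "of_real R ^ 2 - cnj \<rho> * z \<noteq> 0" by fastforce
    qed
    have segR: "norm z \<le> R" if "z \<in> closed_segment a b" for z using seg that r by force
    have segU: "closed_segment a b \<subseteq> U" using segR U by auto
    have f1nz: "f1 z \<noteq> 0" if "z \<in> closed_segment a b" for z
      using nz[OF that] fg[of z] Bnz(1)[OF segR[OF that]] r by (auto simp: f1_def)
    have bd1: "norm (f1 z) \<le> exp (m - ln (R / r1)) * norm (f1 0)" if z: "norm z = R" for z
    proof -
      have "of_real R ^ 2 = cnj z * z" using z complex_norm_square[of z] by (simp add: mult.commute)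
      hence "of_real R ^ 2 - cnj \<rho> * z = cnj (z - \<rho>) * z" by (simp add: algebra_simps)
      hence "norm (f1 z) = norm (f z)"
        using z r unfolding f1_def fg[of z] by (simp add: norm_mult norm_divide del: complex_cnj_diff)
      also have "\<dots> \<le> exp m * norm (f 0)" using bd z by simp
      also have "\<dots> \<le> exp m * ((r1 / R) * norm (f1 0))"
      proof -
        have "norm \<rho> * norm (f1 0) = norm (f 0) * R" using f10 \<rho>0 by simp
        moreover have "norm \<rho> * norm (f1 0) \<le> r1 * norm (f1 0)" using \<rho> by (intro mult_right_mono) auto
        ultimately have "norm (f 0) \<le> (r1 / R) * norm (f1 0)" using r by (simp add: field_simps)
        thus ?thesis by (intro mult_left_mono) auto
      qed
      also have "\<dots> = exp (m - ln (R / r1)) * norm (f1 0)"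
        using r by (simp add: exp_diff)
      finally show ?thesis .
    qed
    have f10': "f1 0 \<noteq> 0" using f10 f0 \<rho>0 r by (metis divide_eq_0_iff less_irrefl mult_eq_0_iff norm_eq_zero order.strict_trans)
    \<comment> \<open>Each removal lowers the exponent by ln (R / r1), yet it must stay nonnegative;
      so \<open>n\<close> is positive whenever a zero is left, and the induction can
      descend.\<close>
    have "m - ln (R / r1) \<ge> 0" by (rule mge[OF f1 f10' bd1])
    moreover have lnpos: "ln (R / r1) > 0" using r by simp
    ultimately have n: "n > 0" using m by (cases n) auto
    define I1 where "I1 = contour_integral (linepath a b) (\<lambda>z. deriv f1 z / f1 z)"
    have I1: "\<bar>Im I1\<bar> \<le> 4 * (m - ln (R / r1) + 1) * r / (r1 - r) + real (n - 1) * K"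
      unfolding I1_def K_def
    proof (rule less.IH[OF _ f1 f10' bd1 f1nz])
      show "m - ln (R / r1) \<le> real (n - 1) * ln (R / r1)" using m n by (simp add: of_nat_diff algebra_simps)
    qed (use n in auto)
    define I2 where "I2 = contour_integral (linepath a b) (\<lambda>z. 1 / (z - \<rho>))"
    define I3 where "I3 = contour_integral (linepath a b) (\<lambda>z. cnj \<rho> / (of_real R ^ 2 - cnj \<rho> * z))"
    have c1: "(\<lambda>z. deriv f1 z / f1 z) contour_integrable_on linepath a b"
      by (intro contour_integrable_continuous_linepath holomorphic_on_imp_continuous_on holomorphic_intros
            holomorphic_on_subset[OF f1] holomorphic_on_subset[OF holomorphic_deriv[OF f1 U(1)]] segU f1nz)
    have c2: "(\<lambda>z. 1 / (z - \<rho>)) contour_integrable_on linepath a b"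
      by (rule contour_integrable_continuous_linepath) (use \<rho>seg in \<open>auto intro!: continuous_intros\<close>)
    have c3: "(\<lambda>z. cnj \<rho> / (of_real R ^ 2 - cnj \<rho> * z)) contour_integrable_on linepath a b"
      by (rule contour_integrable_continuous_linepath) (use Bnz segR in \<open>auto intro!: continuous_intros\<close>)
    \<comment> \<open>The logarithmic derivative splits into that of \<open>f1\<close>, the removed
      zero \<rho>, and the mirror point R^2 / cnj \<rho>, which lies outside the disc.\<close>
    have "contour_integral (linepath a b) (\<lambda>z. deriv f z / f z) =
          contour_integral (linepath a b) (\<lambda>z. deriv f1 z / f1 z + 1 / (z - \<rho>) + cnj \<rho> / (of_real R ^ 2 - cnj \<rho> * z))"
    proof (rule contour_integral_cong)
      fix z assume "z \<in> path_image (linepath a b)"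
      hence z: "z \<in> closed_segment a b" by simp
      hence zU: "z \<in> U" using segU by auto
      have zn: "z - \<rho> \<noteq> 0" using z \<rho>seg by auto
      have df: "(f has_field_derivative deriv f z) (at z)" and df1: "(f1 has_field_derivative deriv f1 z) (at z)"
        using f f1 zU U holomorphic_derivI by blast+
      have "((\<lambda>z. f1 z * ((z - \<rho>) * of_real R)) has_field_derivative (deriv f1 z * ((z - \<rho>) * of_real R) + f1 z * of_real R)) (at z)"
        by (rule derivative_eq_intros refl df1)+ auto
      moreover have "((\<lambda>z. f z * (of_real R ^ 2 - cnj \<rho> * z)) has_field_derivative (deriv f z * (of_real R ^ 2 - cnj \<rho> * z) - f z * cnj \<rho>)) (at z)"
        by (rule derivative_eq_intros refl df)+ auto
      moreover have "(\<lambda>z. f1 z * ((z - \<rho>) * of_real R)) = (\<lambda>z. f z * (of_real R ^ 2 - cnj \<rho> * z))"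
        using r by (auto simp: f1_def fg)
      ultimately have eq: "deriv f1 z * ((z - \<rho>) * of_real R) + f1 z * of_real R = deriv f z * (of_real R ^ 2 - cnj \<rho> * z) - f z * cnj \<rho>"
        using DERIV_unique by metis
      have Bz: "of_real R ^ 2 - cnj \<rho> * z \<noteq> 0" using Bnz segR z by blast
      define B where "B = of_real R ^ 2 - cnj \<rho> * z"
      have f1f: "f1 z * (z - \<rho>) * of_real R = f z * B" unfolding B_def using r by (simp add: f1_def fg[of z])
      have "deriv f z * B * f1 z * (z - \<rho>) = (deriv f1 z * (z - \<rho>) * B  + f1 z * B + f1 z * (z - \<rho>) * cnj \<rho>) * f z" 
      proof -
        have e1: "deriv f z * B = deriv f1 z * ((z - \<rho>) * of_real R) + f1 z * of_real R + f z * cnj \<rho>"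
          using eq by (simp add: B_def)
        have "deriv f z * B * f1 z * (z - \<rho>) = (deriv f z * B) * (f1 z * (z - \<rho>))" by simp
        also have "\<dots> = (deriv f1 z * ((z - \<rho>) * of_real R) + f1 z * of_real R + f z * cnj \<rho>) * (f1 z * (z - \<rho>))"
          by (simp only: e1)
        also have "\<dots> = deriv f1 z * (z - \<rho>) * (f1 z * (z - \<rho>) * of_real R) + f1 z * (f1 z * (z - \<rho>) * of_real R) + f z * cnj \<rho> * f1 z * (z - \<rho>)"
          by (simp add: algebra_simps)
        finally show ?thesis unfolding f1f by (simp add: algebra_simps)
      qed
      thus "deriv f z / f z = deriv f1 z / f1 z + 1 / (z - \<rho>) + cnj \<rho> / (of_real R ^ 2 - cnj \<rho> * z)"
        using nz[OF z] f1nz[OF z] zn Bz unfolding B_def[symmetric] by (simp add: divide_simps) (simp add: algebra_simps)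
    qed auto
    also have "\<dots> = I1 + I2 + I3" unfolding I1_def I2_def I3_def
      using c1 c2 c3 by (simp add: contour_integral_add contour_integrable_add)
    finally have eq: "contour_integral (linepath a b) (\<lambda>z. deriv f z / f z) = I1 + I2 + I3" .
    have I2: "\<bar>Im I2\<bar> \<le> 2 * pi" unfolding I2_def by (rule Im_integral_inverse_segment[OF \<rho>seg])
    have "norm I3 \<le> (r1 / (R * (R - r1))) * norm (b - a)"
      unfolding I3_def
    proof (rule contour_integral_bound_linepath[OF c3])
      fix z assume z: "z \<in> closed_segment a b"
      show "norm (cnj \<rho> / (of_real R ^ 2 - cnj \<rho> * z)) \<le> r1 / (R * (R - r1))"
        unfolding norm_divide using Bnz(2)[OF segR[OF z]] \<rho> r by (intro frac_le) auto
    qed (use r in auto)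
    hence "\<bar>Im I3\<bar> \<le> norm (b - a) * (r1 / (R * (R - r1)))" using abs_Im_le_cmod[of I3] by (simp add: mult.commute)
    hence "\<bar>Im (I1 + I2 + I3)\<bar> \<le> 4 * (m - ln (R / r1) + 1) * r / (r1 - r) + real (n - 1) * K + K"
      using I1 I2 unfolding K_def by simp
    also have "real (n - 1) * K + K = real n * K" using n by (simp add: of_nat_diff algebra_simps)
    hence "4 * (m - ln (R / r1) + 1) * r / (r1 - r) + real (n - 1) * K + K =  4 * (m - ln (R / r1) + 1) * r / (r1 - r) + real n * K" by simp
    also have "\<dots> \<le> 4 * (m + 1) * r / (r1 - r) + real n * K"
      using lnpos r by (intro add_mono divide_right_mono mult_right_mono mult_left_mono) auto
    finally show ?thesis unfolding eq .
  qed
qed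

section \<open>The zeta function to the right of -1\<close>

text \<open>The error of the trapezoid rule for \<open>x powr (-s)\<close> on \<open>{n..n + 1}\<close>. Since \<open>0 powr z = 0\<close>, the term for
  \<open>n = 0\<close> is \<open>1 / (s - 1) + 1 / 2\<close>, the part of \<open>\<zeta>\<close> that the other terms leave over.\<close>

definition zeta_term :: "nat \<Rightarrow> complex \<Rightarrow> complex" where
  "zeta_term n s = (of_nat n powr (-s) + of_nat (Suc n) powr (-s)) / 2
     + (of_nat (Suc n) powr (1 - s) - of_nat n powr (1 - s)) / (s - 1)"

definition zeta_strip :: "complex \<Rightarrow> complex" where
  "zeta_strip s = (\<Sum>n. zeta_term n s)"

lemma zeta_term_0: "zeta_term 0 s = 1 / (s - 1) + 1 / 2"
  by (simp add: zeta_term_def)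

text \<open>Two integrations by parts show that twice the trapezoid error is the integral of u (1 -
  u) s (s + 1) (n + u) powr (-s - 2) over the unit interval; \<open>\<Phi>\<close> is the resulting
  antiderivative. With u (1 - u) \<le> 1/4 its derivative is dominated by that of the real function
  \<open>\<psi>\<close>. The bound is left as a difference so that it telescopes when
  summed.\<close>

lemma norm_zeta_term_le_telescope:
  assumes n: "n > 0" and s: "Re s > -1" "s \<noteq> 1"
  shows "norm (zeta_term n s) \<le> norm s * norm (s + 1) / (8 * (Re s + 1))
           * (real n powr (- Re s - 1) - real (Suc n) powr (- Re s - 1))"
proof -
  define a where "a = real n"
  have a: "a > 0" using n by (simp add: a_def)
  define \<Phi> where "\<Phi> = (\<lambda>z::complex. z * (1 - z) * (-s) * (of_real a + z) powr (-s - 1)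
       - (1 - 2 * z) * (of_real a + z) powr (-s) - 2 * ((of_real a + z) powr (1 - s) / (1 - s)))"
  define \<Phi>' where "\<Phi>' = (\<lambda>z::complex. z * (1 - z) * (s * (s + 1)) * (of_real a + z) powr (-2 - s))"
  define b where "b = Re s + 1"
  have b: "b > 0" using s by (simp add: b_def)
  define K where "K = norm s * norm (s + 1) / 4"
  define \<psi> where "\<psi> = (\<lambda>u::real. - (K / b) * (a + u) powr (- b))"
  have D: "(\<Phi> has_field_derivative \<Phi>' (of_real u)) (at (of_real u))" if u: "u \<in> {0..1}" for u
  proof -
    have pos: "of_real a + complex_of_real u \<notin> \<real>\<^sub>\<le>\<^sub>0" 
      using a u by (simp add: complex_nonpos_Reals_iff)
    show ?thesis unfolding \<Phi>_def \<Phi>'_def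
      using s pos
      apply (auto intro!: derivative_eq_intros simp del: powr_minus)
      apply (simp add: algebra_simps)
      done
  qed
  have vd: "((\<lambda>u. \<Phi> (of_real u)) has_vector_derivative \<Phi>' (of_real u)) (at u within {0..1})" if "u \<in> {0..1}" for u
    using has_vector_derivative_real_field[OF D[OF that]] by blast
  have nb: "norm (\<Phi>' (of_real u)) \<le> K * (a + u) powr (- b - 1)" if u: "u \<in> {0..1}" for u
  proof -
    have "norm (\<Phi>' (of_real u)) = (u * (1 - u)) * (norm s * norm (s + 1)) * norm (complex_of_real (a + u) powr (-2 - s))"
      using u unfolding \<Phi>'_def norm_mult by (simp add: norm_mult flip: of_real_add of_real_diff) 
        (metis abs_of_nonneg diff_ge_0_iff_ge norm_of_real of_real_1 of_real_diff)
    also have "norm (complex_of_real (a + u) powr (-2 - s)) = (a + u) powr (- b - 1)"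
      using a u by (subst norm_powr_real_powr) (auto simp: b_def)
    also have "u * (1 - u) * (norm s * norm (s + 1)) * (a + u) powr (- b - 1)
               \<le> 1/4 * (norm s * norm (s + 1)) * (a + u) powr (- b - 1)"
    proof (intro mult_right_mono)
      have "0 \<le> (u - 1/2)^2" by simp
      thus "u * (1 - u) \<le> 1/4" by (simp add: power2_eq_square algebra_simps)
    qed auto
    finally show ?thesis by (simp add: K_def)
  qed
  have pd: "(\<psi> has_vector_derivative K * (a + u) powr (- b - 1)) (at u within {0..1})" if "u \<in> {0..1}" for u
  proof -
    have "((\<lambda>u. (a + u) powr (- b)) has_real_derivative (- b) * (a + u) powr (- b - 1)) (at u within {0..1})"
      using a that by (auto intro!: derivative_eq_intros)
    from DERIV_cmult[OF this, of "- (K / b)"] 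
    have "(\<psi> has_real_derivative K * (a + u) powr (- b - 1)) (at u within {0..1})"
      unfolding \<psi>_def by (rule DERIV_cong) (use b in simp)
    thus ?thesis unfolding has_real_derivative_iff_has_vector_derivative .
  qed
  have c1: "continuous_on {0..1} (\<lambda>u. \<Phi> (of_real u))"
    by (rule continuous_on_vector_derivative[OF vd])
  have c2: "continuous_on {0..1} \<psi>"
    by (rule continuous_on_vector_derivative[OF pd])
  have "norm (\<Phi> (of_real 1) - \<Phi> (of_real 0)) \<le> \<psi> 1 - \<psi> 0"
  proof (rule differentiable_bound_general[OF _ c1 c2])
    fix x :: real assume x: "0 < x" "x < 1"
    hence at: "at x within {0..1} = at x" by (intro at_within_interior) auto
    show "((\<lambda>u. \<Phi> (of_real u)) has_vector_derivative \<Phi>' (of_real x)) (at x)" 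
      using vd[of x] x at by simp
    show "(\<psi> has_vector_derivative K * (a + x) powr (- b - 1)) (at x)" using pd[of x] x at by simp
    show "norm (\<Phi>' (of_real x)) \<le> K * (a + x) powr (- b - 1)" using nb x by simp
  qed simp
  also have "\<Phi> (of_real 1) - \<Phi> (of_real 0) = 2 * zeta_term n s"
    using s by (simp add: \<Phi>_def zeta_term_def a_def divide_simps) (simp add: algebra_simps)
  also have "\<psi> 1 - \<psi> 0 = 2 * (norm s * norm (s + 1) / (8 * (Re s + 1))
           * (real n powr (- Re s - 1) - real (Suc n) powr (- Re s - 1)))"
    using b by (simp add: \<psi>_def K_def a_def b_def divide_simps) (simp add: algebra_simps)
  finally show ?thesis by (simp add: norm_mult)
qed

lemma powr_minus_telescope_le:
  assumes "n > 0" "b > 0"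
  shows "real n powr (-b) - real (Suc n) powr (-b) \<le> b * real n powr (-b - 1)"
proof -
  have "\<exists>z. real n < z \<and> z < real (Suc n) \<and>
      real (Suc n) powr (-b) - real n powr (-b) = (real (Suc n) - real n) * (-b * z powr (-b-1))"
    by (rule MVT2) (use assms in \<open>auto intro!: derivative_eq_intros simp: powr_diff field_simps\<close>)
  then obtain z where z: "real n < z" 
    "real (Suc n) powr (-b) - real n powr (-b) = (real (Suc n) - real n) * (-b * z powr (-b-1))" by blast
  have "z powr (-b-1) \<le> real n powr (-b-1)"
    using z assms by (intro powr_mono2') auto
  hence "b * z powr (-b-1) \<le> b * real n powr (-b-1)" using assms by simp
  with z show ?thesis by simp
qed

lemma norm_zeta_term_le:
  assumes n: "n > 0" and s: "Re s > -1" "s \<noteq> 1"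
  shows "norm (zeta_term n s) \<le> norm s * norm (s + 1) / 8 * real n powr (- Re s - 2)"
proof -
  have "norm s * norm (s + 1) / (8 * (Re s + 1))
           * (real n powr (- Re s - 1) - real (Suc n) powr (- Re s - 1))
        \<le> norm s * norm (s + 1) / (8 * (Re s + 1)) * ((Re s + 1) * real n powr (- (Re s + 1) - 1))"
    using powr_minus_telescope_le[OF n, of "Re s + 1"] s by (intro mult_left_mono) auto
  also have "\<dots> = norm s * norm (s + 1) / 8 * real n powr (- Re s - 2)"
  proof -
    have e: "- (Re s + 1) - 1 = - Re s - 2" by simp
    have gen: "K / (8*c) * (c * p) = K/8*p" if "c \<noteq> 0" for K c p :: real using that by simp
    show ?thesis unfolding e by (rule gen) (use s in auto)
  qed
  finally show ?thesis using norm_zeta_term_le_telescope[OF assms] by linarith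
qed

lemma zeta_term_holomorphic: "zeta_term n holomorphic_on - {1}"
  unfolding zeta_term_def
  by (cases "n = 0") (auto intro!: holomorphic_intros)

lemma summable_zeta_term:
  assumes s: "Re s > -1" "s \<noteq> 1"
  shows "summable (\<lambda>n. zeta_term n s)"
proof (rule summable_comparison_test[OF exI])
  show "\<forall>n\<ge>1. norm (zeta_term n s) \<le> norm s * norm (s + 1) / 8 * real n powr (- Re s - 2)"
    using norm_zeta_term_le s by force
  show "summable (\<lambda>n. norm s * norm (s + 1) / 8 * real n powr (- Re s - 2))"
    using s by (intro summable_mult) (simp add: summable_real_powr_iff)
qed

lemma zeta_strip_holomorphic: "zeta_strip holomorphic_on {s. Re s > -1} - {1}"
proof (rule holomorphic_uniform_sequence)
  show op: "open ({s. Re s > -1} - {1::complex})"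
    by (intro open_Diff open_halfspace_Re_gt) auto
  show "(\<lambda>s. \<Sum>n<N. zeta_term n s) holomorphic_on {s. Re s > -1} - {1}" for N
    by (intro holomorphic_intros holomorphic_on_subset[OF zeta_term_holomorphic]) auto
  fix x :: complex assume x: "x \<in> {s. Re s > -1} - {1}"
  then obtain d where d: "d > 0" "cball x d \<subseteq> {s. Re s > -1} - {1}"
    using op open_contains_cball by blast
  \<comment> \<open>The leftmost point of the disc gives the slowest decay, and there the exponent
    -(Re x - d) - 2 is still below -1.\<close>
  have "x - of_real d \<in> cball x d" using d by (simp add: dist_norm)
  hence "Re (x - of_real d) > -1" using d by blast
  hence d1: "Re x - d > -1" by simp
  define B where "B = (norm x + d) * (norm x + d + 1) / 8"
  have "uniform_limit (cball x d) (\<lambda>N s. \<Sum>n<N. zeta_term n s) zeta_strip sequentially"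
    unfolding zeta_strip_def
  proof (rule Weierstrass_m_test_ev)
    show "\<forall>\<^sub>F n in sequentially. \<forall>s\<in>cball x d. norm (zeta_term n s) \<le> B * real n powr (- (Re x - d) - 2)"
    proof (intro eventually_sequentiallyI[of 1] ballI)
      fix n s assume n: "n \<ge> (1::nat)" and s: "s \<in> cball x d"
      have "norm (zeta_term n s) \<le> norm s * norm (s + 1) / 8 * real n powr (- Re s - 2)"
        using n s d by (intro norm_zeta_term_le) auto
      also have "\<dots> \<le> B * real n powr (- (Re x - d) - 2)"
      proof (intro mult_mono)
        have ns: "norm s \<le> norm x + d"
          using s norm_triangle_ineq2[of s x] by (auto simp: dist_norm norm_minus_commute)
        moreover have "norm (s + 1) \<le> norm s + 1" using norm_triangle_ineq[of s 1] by simp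
        ultimately show "norm s * norm (s + 1) / 8 \<le> B" unfolding B_def
          using d by (intro divide_right_mono mult_mono add_nonneg_nonneg) auto
        have "\<bar>Re (x - s)\<bar> \<le> d" using s abs_Re_le_cmod[of "x - s"] by (auto simp: dist_norm)
        thus "real n powr (- Re s - 2) \<le> real n powr (- (Re x - d) - 2)"
          using n by (intro powr_mono) auto
      qed (use d in \<open>auto simp: B_def\<close>)
      finally show "norm (zeta_term n s) \<le> B * real n powr (- (Re x - d) - 2)" .
    qed
    show "summable (\<lambda>n. B * real n powr (- (Re x - d) - 2))"
      using d1 by (intro summable_mult) (simp add: summable_real_powr_iff)
  qed
  thus "\<exists>d>0. cball x d \<subseteq> {s. Re s > -1} - {1} \<and>
         uniform_limit (cball x d) (\<lambda>N s. \<Sum>n<N. zeta_term n s) zeta_strip sequentially"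
    using d by blast
qed

text \<open>The term n = 0 is split off exactly and the bounds for the others telescope to their
  value at n = 1, which is 1. Being explicit, the inequality yields both polynomial growth and a
  zero-free region at small height.\<close>

lemma zeta_strip_approx:
  assumes s: "Re s > -1" "s \<noteq> 1"
  shows "norm (zeta_strip s - (1 / (s - 1) + 1 / 2)) \<le> norm s * norm (s + 1) / (8 * (Re s + 1))"
proof -
  define K where "K = norm s * norm (s + 1) / (8 * (Re s + 1))"
  define b where "b = Re s + 1"
  have b: "b > 0" using s by (simp add: b_def)
  have lim0: "(\<lambda>n. real (Suc n) powr (- b)) \<longlonglongrightarrow> 0"
    using b by real_asymp
  have tel: "(\<lambda>n. real (Suc n) powr (- b) - real (Suc (Suc n)) powr (- b)) sums (real (Suc 0) powr (- b) - 0)"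
    by (rule telescope_sums'[OF lim0])
  have "norm (\<Sum>n. zeta_term (Suc n) s) \<le> (\<Sum>n. K * (real (Suc n) powr (- b) - real (Suc (Suc n)) powr (- b)))"
  proof (rule norm_suminf_le)
    show "summable (\<lambda>n. K * (real (Suc n) powr (- b) - real (Suc (Suc n)) powr (- b)))"
      using tel by (intro summable_mult) (simp add: sums_iff)
    show "norm (zeta_term (Suc n) s) \<le> K * (real (Suc n) powr (- b) - real (Suc (Suc n)) powr (- b))" for n
      using norm_zeta_term_le_telescope[of "Suc n" s] s by (simp add: K_def b_def)
  qed
  also have "\<dots> = K"
    using tel by (subst suminf_mult) (auto simp: sums_iff)
  also have "(\<Sum>n. zeta_term (Suc n) s) = zeta_strip s - zeta_term 0 s"
    unfolding zeta_strip_def using suminf_split_head[OF summable_zeta_term[OF s]] by simp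
  finally show ?thesis by (simp add: K_def zeta_term_0)
qed

text \<open>The sum of trapezoid terms collapses to the Dirichlet partial sum plus two boundary
  terms, and these vanish in the limit because Re s > 1.\<close>

lemma zeta_strip_eq_dirichlet:
  assumes s: "Re s > 1"
  shows "(\<lambda>n. 1 / of_nat (Suc n) powr s) sums zeta_strip s"
proof -
  have s1: "s \<noteq> 1" using s by auto
  have part: "(\<Sum>n<Suc N. zeta_term n s) = (\<Sum>n<N. 1 / of_nat (Suc n) powr s) + of_nat (Suc N) powr (-s) / 2
                 + of_nat (Suc N) powr (1 - s) / (s - 1)" for N
  proof (induction N)
    case 0
    show ?case using s1 by (simp add: zeta_term_def)
  next
    case (Suc N)
    show ?case
      unfolding sum.lessThan_Suc[of _ "Suc N"] Suc.IH using s1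
      by (simp add: zeta_term_def powr_minus divide_simps) (simp add: algebra_simps)
  qed
  have l1: "(\<lambda>N. \<Sum>n<Suc N. zeta_term n s) \<longlonglongrightarrow> zeta_strip s"
    using summable_sums[OF summable_zeta_term] s s1 unfolding zeta_strip_def sums_def
    by (intro LIMSEQ_Suc) auto
  have l2: "(\<lambda>N. of_nat (Suc N) powr (-s) :: complex) \<longlonglongrightarrow> 0"
  proof (rule tendsto_norm_zero_cancel)
    have "(\<lambda>N. real (Suc N) powr (- Re s)) \<longlonglongrightarrow> 0" using s by real_asymp
    thus "(\<lambda>N. norm (of_nat (Suc N) powr (-s) :: complex)) \<longlonglongrightarrow> 0"
      by (subst norm_powr_real_powr) auto
  qed
  have l3: "(\<lambda>N. of_nat (Suc N) powr (1-s) :: complex) \<longlonglongrightarrow> 0"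
  proof (rule tendsto_norm_zero_cancel)
    have "(\<lambda>N. real (Suc N) powr (1 - Re s)) \<longlonglongrightarrow> 0" using s by real_asymp
    thus "(\<lambda>N. norm (of_nat (Suc N) powr (1-s) :: complex)) \<longlonglongrightarrow> 0"
      by (subst norm_powr_real_powr) auto
  qed
  have "(\<lambda>N. (\<Sum>n<Suc N. zeta_term n s) - of_nat (Suc N) powr (-s) / 2 - of_nat (Suc N) powr (1 - s) / (s - 1))
      \<longlonglongrightarrow> zeta_strip s - 0 / 2 - 0 / (s - 1)"
    using s1 by (intro tendsto_intros l1 l2 l3) auto
  thus ?thesis unfolding part sums_def by simp
qed

section \<open>Estimates for the Gamma factor\<close>

text \<open>The mean value inequality in u on [0, 1]: the derivative 1 / (z + u) - 1 / z equals -u /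
  (z (z + u)), and |z + u| \<ge> |z| in the right half-plane.\<close>

lemma norm_Ln_increment_le:
  assumes z: "Re z > 0"
  shows "norm (Ln (z + 1) - Ln z - 1 / z) \<le> 1 / norm z ^ 2"
proof -
  have z0: "z \<noteq> 0" using z by auto
  have "norm ((Ln (z + 1) - 1 / z) - (Ln (z + 0) - 0 / z)) \<le> 1 / norm z ^ 2 * norm (1 - 0 :: complex)"
  proof (rule field_differentiable_bound[of "closed_segment 0 1" "\<lambda>u. Ln (z + u) - u / z" "\<lambda>u. 1 / (z + u) - 1 / z"])
    fix u :: complex assume "u \<in> closed_segment 0 1"
    then obtain x where x: "u = of_real x" "0 \<le> x" "x \<le> 1" 
      by (auto simp: closed_segment_def scaleR_conv_of_real)
    have n1: "z + u \<notin> \<real>\<^sub>\<le>\<^sub>0" using z x by (auto simp: complex_nonpos_Reals_iff)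
    hence n2: "z + u \<noteq> 0" by auto
    show "((\<lambda>u. Ln (z + u) - u / z) has_field_derivative 1 / (z + u) - 1 / z) (at u within closed_segment 0 1)"
    proof (rule DERIV_diff)
      show "((\<lambda>u. Ln (z + u)) has_field_derivative 1 / (z + u)) (at u within closed_segment 0 1)"
        using n1 n2 by (auto intro!: derivative_eq_intros simp: inverse_eq_divide)
      show "((\<lambda>u. u / z) has_field_derivative 1 / z) (at u within closed_segment 0 1)"
        by (rule DERIV_cdivide[OF DERIV_ident])
    qed
    have "norm z \<le> norm (z + u)"
      unfolding cmod_def using z x by (auto intro!: power_mono)
    hence "norm u / (norm z * norm (z + u)) \<le> 1 / (norm z * norm z)"
      using z0 x by (intro frac_le mult_left_mono) auto
    moreover have "1 / (z + u) - 1 / z = - u / (z * (z + u))" using z0 n2 by (simp add: field_simps)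
    ultimately show "norm (1 / (z + u) - 1 / z) \<le> 1 / norm z ^ 2"
      by (simp add: norm_mult norm_divide power2_eq_square)
  qed auto
  thus ?thesis by (simp add: algebra_simps)
qed

text \<open>The limit formula for \<open>Digamma\<close> turns the difference into the sum of the
  logarithmic increments \<open>d n\<close>. The term n = 0 is at most 1 / t. The others use |s +
  n|^2 \<ge> (n + c)^2 / 2 with c = Re s + Im s and telescope to at most 2 / c, which is at most 2 /
  t.\<close>

lemma Digamma_approx:
  assumes s: "Re s > 0" "Im s \<ge> 1"
  shows "norm (Digamma s - Ln s) \<le> 3 / Im s"
proof -
  define \<sigma> t where "\<sigma> = Re s" and "t = Im s"
  have st: "\<sigma> > 0" "t \<ge> 1" using s by (auto simp: \<sigma>_def t_def)
  have s0: "s \<noteq> 0" using s by auto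
  define d where "d = (\<lambda>n. Ln (s + of_nat n + 1) - Ln (s + of_nat n) - 1 / (s + of_nat n))"
  define c where "c = \<sigma> + t"
  have c: "c > 1" using st by (simp add: c_def)
  have sum_eq: "(\<Sum>n<m. d n) = Ln (s + of_nat m) - Ln s - (\<Sum>n<m. inverse (s + of_nat n))" for m
    by (induction m) (auto simp: d_def add_ac inverse_eq_divide)
  have dn: "norm (d n) \<le> 2 / (real n + c) ^ 2" for n
  proof -
    have "norm (d n) \<le> 1 / norm (s + of_nat n) ^ 2"
      unfolding d_def by (rule norm_Ln_increment_le) (use s in auto)
    also have "norm (s + of_nat n) ^ 2 = (\<sigma> + n) ^ 2 + t ^ 2" by (simp add: cmod_power2 \<sigma>_def t_def)
    also have "1 / ((\<sigma> + n) ^ 2 + t ^ 2) \<le> 1 / ((real n + c) ^ 2 / 2)"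
    proof (rule divide_left_mono)
      have "0 \<le> (\<sigma> + n - t)^2" by simp
      thus "(real n + c) ^ 2 / 2 \<le> (\<sigma> + n) ^ 2 + t ^ 2" by (simp add: c_def power2_eq_square algebra_simps)
    qed (use c st in \<open>auto intro!: mult_pos_pos add_nonneg_pos\<close>)
    finally show ?thesis by simp
  qed
  have part: "norm (\<Sum>n<m. d n) \<le> 3 / t" for m
  proof (cases "m = 0")
    case False
    then obtain k where k: "m = Suc k" by (cases m) auto
    have d0: "norm (d 0) \<le> 1 / t"
    proof -
      have "norm (d 0) \<le> 1 / norm s ^ 2" using norm_Ln_increment_le[OF s(1)] by (simp add: d_def)
      also have "\<dots> \<le> 1 / t ^ 2"
        using st abs_Im_le_cmod[of s] by (intro frac_le power_mono) (auto simp: t_def)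
      also have "\<dots> \<le> 1 / t" using st by (intro divide_left_mono) (auto simp: power2_eq_square)
      finally show ?thesis .
    qed
    have "norm (d 0 + (\<Sum>n<k. d (Suc n))) \<le> 1 / t + (2 / c - 2 / (real k + c))"
    proof (induction k)
      case 0 thus ?case using d0 by simp
    next
      case (Suc k)
      have "norm (d (Suc k)) \<le> 2 / (real (Suc k) + c) ^ 2" by (rule dn)
      also have "\<dots> \<le> 2 / ((real k + c) * (real (Suc k) + c))"
        using c by (intro divide_left_mono) (auto simp: power2_eq_square intro!: mult_pos_pos add_nonneg_pos)
      also have "\<dots> = 2 / (real k + c) - 2 / (real (Suc k) + c)"
      proof -
        have "real k + c \<noteq> 0" "real (Suc k) + c \<noteq> 0" using c by linarith+
        thus ?thesis by (simp add: divide_simps)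
      qed
      finally show ?case 
        using Suc norm_triangle_ineq[of "d 0 + (\<Sum>n<k. d (Suc n))" "d (Suc k)"] by (simp add: add_ac)
    qed
    also have "\<dots> \<le> 1 / t + 2 / c" using c by simp
    also have "2 / c \<le> 2 / t" using st by (intro divide_left_mono) (auto simp: c_def)
    also have "1 / t + 2 / t = 3 / t" by simp
    finally show ?thesis unfolding k sum.lessThan_Suc_shift by simp
  qed (use st in auto)
  \<comment> \<open>\<open>Digamma_LIMSEQ\<close> contains ln m where the telescoped sum contains Ln
    (s + m); they differ by Ln (1 + s / m), which tends to 0.\<close>
  have lim1: "(\<lambda>m. Ln (1 + s / of_nat m)) \<longlonglongrightarrow> Ln (1 + 0)"
    by (intro tendsto_Ln tendsto_add tendsto_const lim_const_over_n) auto
  have "(\<lambda>m. of_real (ln (real m)) - (\<Sum>n<m. inverse (s + of_nat n)) - Ln s + Ln (1 + s / of_nat m)) \<longlonglongrightarrow> Digamma s - Ln s + Ln (1 + 0)"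
    by (intro tendsto_intros Digamma_LIMSEQ s0 lim1)
  hence "(\<lambda>m. \<Sum>n<m. d n) \<longlonglongrightarrow> Digamma s - Ln s + Ln (1 + 0)"
  proof (rule Lim_transform_eventually)
    show "\<forall>\<^sub>F m in sequentially. of_real (ln (real m)) - (\<Sum>n<m. inverse (s + of_nat n)) - Ln s + Ln (1 + s / of_nat m) = (\<Sum>n<m. d n)"
    proof (rule eventually_sequentiallyI[of 1])
      fix m :: nat assume m: "1 \<le> m"
      have "1 + s / of_nat m \<noteq> 0" 
      proof
        assume "1 + s / of_nat m = 0"
        hence "Im (1 + s / of_nat m) = 0" by simp
        thus False using m s by simp
      qed
      hence "Ln (of_real (real m) * (1 + s / of_nat m)) = of_real (ln (real m)) + Ln (1 + s / of_nat m)"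
        using m by (subst Ln_times_of_real) (auto simp: Ln_of_real)
      moreover have "of_real (real m) * (1 + s / of_nat m) = s + of_nat m" using m by (simp add: field_simps)
      ultimately show "of_real (ln (real m)) - (\<Sum>n<m. inverse (s + of_nat n)) - Ln s + Ln (1 + s / of_nat m) = (\<Sum>n<m. d n)"
        unfolding sum_eq by simp
    qed
  qed
  hence "(\<lambda>m. norm (\<Sum>n<m. d n)) \<longlonglongrightarrow> norm (Digamma s - Ln s)"
    using tendsto_norm by fastforce
  thus ?thesis using part unfolding t_def by (intro LIMSEQ_le_const2) auto
qed

section \<open>The factor of the functional equation and its logarithmic derivative\<close>

text \<open>The factor in \<zeta>(1 - s) = \<chi>(s) \<zeta>(s), the reciprocal of the one usually
  called \<chi>. In this orientation it is holomorphic for Re s > 0, the side on which it is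
  used.\<close>

definition zeta_chi :: "complex \<Rightarrow> complex" where
  "zeta_chi s = 2 * of_real (2 * pi) powr (-s) * cos (of_real pi * s / 2) * Gamma s"

definition zeta_chi_log_deriv :: "complex \<Rightarrow> complex" where
  "zeta_chi_log_deriv s = Digamma s - of_real (ln (2 * pi)) - of_real (pi / 2) * tan (of_real pi * s / 2)"

lemma zeta_chi_holomorphic: "zeta_chi holomorphic_on {s. Re s > 0}"
  unfolding zeta_chi_def by (intro holomorphic_intros) (auto elim!: nonpos_Ints_cases)

lemma cos_half_pi_nonzero:
  assumes "Im s \<noteq> 0"
  shows "cos (of_real pi * s / 2) \<noteq> 0"
proof
  assume "cos (of_real pi * s / 2) = 0"
  then obtain n :: int where "of_real pi * s / 2 = of_real (n * pi) + of_real pi / 2" by (auto simp: cos_eq_0)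
  hence "Im (of_real pi * s / 2) = Im (of_real (n * pi) + of_real pi / 2)" by (rule arg_cong)
  thus False using assms by simp
qed

lemma zeta_chi_nonzero: "Re s > 0 \<Longrightarrow> Im s \<noteq> 0 \<Longrightarrow> zeta_chi s \<noteq> 0"
  using cos_half_pi_nonzero[of s] by (auto simp: zeta_chi_def Gamma_eq_zero_iff elim!: nonpos_Ints_cases)

lemma deriv_zeta_chi:
  assumes "Re s > 0" "Im s \<noteq> 0"
  shows "(zeta_chi has_field_derivative zeta_chi s * zeta_chi_log_deriv s) (at s)"
proof -
  have 1: "s \<notin> \<int>\<^sub>\<le>\<^sub>0" using assms by (auto elim!: nonpos_Ints_cases)
  have D1: "((\<lambda>s. of_real (2 * pi) powr (-s)) has_field_derivative - of_real (ln (2 * pi)) * of_real (2 * pi) powr (-s)) (at s)"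
  proof -
    have "((\<lambda>s. of_real (2 * pi) powr (-s)) has_field_derivative (ln (of_real (2 * pi)) * of_real (2 * pi) powr (-s)) * (-1)) (at s)"
      by (rule DERIV_chain2[OF has_field_derivative_powr_right]) (auto intro!: derivative_eq_intros)
    moreover have "ln (complex_of_real (2 * pi)) = of_real (ln (2 * pi))" by (rule Ln_of_real) simp
    ultimately show ?thesis by simp
  qed
  have D2: "((\<lambda>s. cos (of_real pi * s / 2)) has_field_derivative - sin (of_real pi * s / 2) * (of_real pi / 2)) (at s)"
    by (auto intro!: derivative_eq_intros)
  have D3: "(Gamma has_field_derivative Gamma s * Digamma s) (at s)"
    by (rule has_field_derivative_Gamma[OF 1])
  have 2: "cos (of_real pi * s / 2) \<noteq> 0" using assms by (rule_tac cos_half_pi_nonzero)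
  show ?thesis
    unfolding zeta_chi_def zeta_chi_log_deriv_def
    by (rule DERIV_cong[OF DERIV_mult[OF DERIV_mult[OF DERIV_cmult[OF D1] D2] D3]])
       (use 2 in \<open>simp add: tan_def divide_simps; simp add: algebra_simps\<close>)
qed

lemma zeta_chi_log_deriv_holomorphic: "zeta_chi_log_deriv holomorphic_on {s. Re s > 0 \<and> Im s > 0}"
  unfolding zeta_chi_log_deriv_def tan_def
  by (intro holomorphic_intros) (use cos_half_pi_nonzero in \<open>auto elim!: nonpos_Ints_cases\<close>)

lemma norm_tan_le:
  assumes "Im z \<ge> 1"
  shows "norm (tan z) \<le> 2"
proof -
  define e where "e = exp (2 * Im z)"
  have "e \<ge> 1 + 2 * Im z" unfolding e_def by (rule exp_ge_add_one_self)
  hence e: "e \<ge> 3" using assms by simp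
  \<comment> \<open>Exactly what |sin z|^2 \<le> (e + 1/e + 2) / 4 and 4 |cos z|^2 \<ge> e + 1/e - 2
    require for |sin z| \<le> 2 |cos z|.\<close>
  have e3: "3 * (e + inverse e) \<ge> 10" using e mult_right_mono[of 3 e "e - 1/3"] by (simp add: field_simps)
  have c: "\<bar>cos (2 * Re z)\<bar> \<le> 1" by simp
  have "(exp (Im z) - inverse (exp (Im z))) ^ 2 = e + inverse e - 2"
  proof -
    have "e = exp (Im z) * exp (Im z)" by (simp add: e_def flip: exp_add)
    thus ?thesis by (simp add: power2_eq_square algebra_simps)
  qed
  hence "norm (cos z) ^ 2 = cos (Re z) ^ 2 + (e + inverse e - 2) / 4" by (simp add: norm_cos_squared)
  moreover have "cos (Re z) ^ 2 \<ge> 0" by simp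
  moreover have "norm (sin z) ^ 2 = (e + inverse e - 2 * cos (2 * Re z)) / 4" by (simp add: norm_sin_squared e_def)
  ultimately have "norm (sin z) ^ 2 \<le> 4 * norm (cos z) ^ 2" using c e3 by argo
  hence "norm (sin z) ^ 2 \<le> (2 * norm (cos z)) ^ 2" by (simp add: power_mult_distrib)
  hence "norm (sin z) \<le> 2 * norm (cos z)" by (rule power2_le_imp_le) simp
  thus ?thesis by (cases "cos z = 0") (auto simp: tan_def norm_divide field_simps)
qed

text \<open>On Re s = 2 the argument \<pi> s / 2 has real part \<pi>, so the tangent is purely
  imaginary and drops out. The 5 is 3 from \<open>Digamma_approx\<close> and 2 from replacing |2 +
  it| by t inside the logarithm.\<close>

lemma Re_zeta_chi_log_deriv_2:
  assumes t: "t \<ge> 1"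
  shows "\<bar>Re (zeta_chi_log_deriv (Complex 2 t)) - ln (t / (2 * pi))\<bar> \<le> 5 / t"
proof -
  define s where "s = Complex 2 t"
  have s: "Re s = 2" "Im s = t" by (auto simp: s_def)
  have "Re (of_real pi * s / 2) = pi" using s by simp
  hence "Re (tan (of_real pi * s / 2)) = 0"
    unfolding tan_def Re_divide by (simp add: Re_sin Im_cos)
  hence 1: "Re (of_real (pi / 2) * tan (of_real pi * s / 2)) = 0" by simp
  have "norm (Digamma s - Ln s) \<le> 3 / t"
    using Digamma_approx[of s] s t by simp
  hence 2: "\<bar>Re (Digamma s - Ln s)\<bar> \<le> 3 / t" using abs_Re_le_cmod order_trans by blast
  have s0: "s \<noteq> 0" using s by auto
  have "ln (norm s) - ln t \<le> 2 / t" "ln (norm s) \<ge> ln t"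
  proof -
    have "norm s \<le> \<bar>Re s\<bar> + \<bar>Im s\<bar>" by (rule cmod_le)
    hence n: "norm s \<le> 2 + t" using s t by simp
    have n2: "norm s \<ge> t" using abs_Im_le_cmod[of s] s t by simp
    have "ln (norm s) - ln t = ln (norm s / t)" using s0 t by (subst ln_div) auto
    also have "\<dots> \<le> norm s / t - 1" using s0 t by (intro ln_le_minus_one) auto
    also have "norm s / t \<le> (2 + t) / t" using n t by (intro divide_right_mono) auto
    also have "(2 + t) / t - 1 = 2 / t" using t by (simp add: field_simps)
    finally show "ln (norm s) - ln t \<le> 2 / t" by simp
    show "ln (norm s) \<ge> ln t" using n2 t by (subst ln_le_cancel_iff) auto
  qed
  moreover have "Re (Ln s) = ln (norm s)" using s0 by simp
  moreover have "ln (t / (2 * pi)) = ln t - ln (2 * pi)" using t by (subst ln_div) auto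
  moreover have "5 / t = 3 / t + 2 / t" by simp
  ultimately show ?thesis using 1 2 unfolding zeta_chi_log_deriv_def s_def[symmetric] by (simp add: abs_le_iff) 
qed

section \<open>The functional equation\<close>

lemma nn_integral_Gamma_scaled:
  assumes b: "b > 0" and c: "c > (0::real)"
  shows "(\<integral>\<^sup>+t. ennreal (indicator {0<..} t * (t powr (b - 1) * exp (- c * t))) \<partial>lborel) = ennreal (Gamma b * c powr (-b))"
proof -
  have G: "Gamma b > 0" using b by (rule Gamma_real_pos)
  have "ennreal (Gamma b) = (\<integral>\<^sup>+t. ennreal (indicator {0..} t * t powr (b - 1) / exp t) \<partial>lborel)"
    using b by (rule Gamma_conv_nn_integral_real)
  also have "\<dots> = ennreal \<bar>c\<bar> * (\<integral>\<^sup>+t. ennreal (indicator {0..} (0 + c * t) * (0 + c * t) powr (b - 1) / exp (0 + c * t)) \<partial>lborel)"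
    using c by (intro nn_integral_real_affine) auto
  also have "\<dots> = ennreal c * (\<integral>\<^sup>+t. ennreal (c powr (b - 1)) * ennreal (indicator {0<..} t * (t powr (b - 1) * exp (- c * t))) \<partial>lborel)"
    using c by (intro arg_cong2[of _ _ _ _ "(*)"] nn_integral_cong)
      (auto simp: indicator_def powr_mult exp_minus field_simps zero_le_mult_iff simp flip: ennreal_mult')
  also have "\<dots> = ennreal c * (ennreal (c powr (b - 1)) * (\<integral>\<^sup>+t. ennreal (indicator {0<..} t * (t powr (b - 1) * exp (- c * t))) \<partial>lborel))"
    by (subst nn_integral_cmult) auto
  also have "\<dots> = ennreal (c powr b) * (\<integral>\<^sup>+t. ennreal (indicator {0<..} t * (t powr (b - 1) * exp (- c * t))) \<partial>lborel)"
    using c by (simp add: powr_diff flip: ennreal_mult' mult.assoc)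
  finally have e: "ennreal (Gamma b) = ennreal (c powr b) * (\<integral>\<^sup>+t. ennreal (indicator {0<..} t * (t powr (b - 1) * exp (- c * t))) \<partial>lborel)" .
  have "ennreal (Gamma b * c powr (-b)) = ennreal (c powr (-b)) * ennreal (Gamma b)"
    by (simp add: ennreal_mult'' mult.commute)
  also have "\<dots> = ennreal (c powr (-b) * c powr b) * (\<integral>\<^sup>+t. ennreal (indicator {0<..} t * (t powr (b - 1) * exp (- c * t))) \<partial>lborel)"
    unfolding e by (simp add: ennreal_mult' mult.assoc)
  also have "c powr (-b) * c powr b = 1" using c by (simp add: powr_add[symmetric])
  finally show ?thesis by simp
qed

text \<open>Writing 1 / (1 + y) as the integral of exp (-(1 + y) w) over w > 0 and exchanging the
  integrals produces Gamma b * Gamma (1 - b), which the reflection formula evaluates.\<close>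

lemma nn_integral_powr_over_1_plus:
  assumes b: "0 < b" "b < (1::real)"
  shows "(\<integral>\<^sup>+y. ennreal (indicator {0<..} y * (y powr (b - 1) / (1 + y))) \<partial>lborel) = ennreal (pi / sin (pi * b))"
proof -
  interpret lborel_pair: pair_sigma_finite lborel lborel ..
  define F where "F = (\<lambda>y w::real. ennreal (indicator {0<..} y * indicator {0<..} w * (y powr (b - 1) * exp (- (1 + y) * w))))"
  have "(\<integral>\<^sup>+y. ennreal (indicator {0<..} y * (y powr (b - 1) / (1 + y))) \<partial>lborel) = (\<integral>\<^sup>+y. \<integral>\<^sup>+w. F y w \<partial>lborel \<partial>lborel)"
  proof (intro nn_integral_cong)
    fix y :: real
    show "ennreal (indicator {0<..} y * (y powr (b - 1) / (1 + y))) = (\<integral>\<^sup>+w. F y w \<partial>lborel)"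
    proof (cases "y > 0")
      case True
      have "(\<integral>\<^sup>+w. F y w \<partial>lborel) = (\<integral>\<^sup>+w. ennreal (y powr (b - 1)) * ennreal (indicator {0<..} w * (w powr (1 - 1) * exp (- (1 + y) * w))) \<partial>lborel)"
        using True by (intro nn_integral_cong) (auto simp: F_def indicator_def simp flip: ennreal_mult')
      also have "\<dots> = ennreal (y powr (b - 1)) * ennreal (Gamma 1 * (1 + y) powr (-1))"
        using True by (subst nn_integral_cmult, simp, subst nn_integral_Gamma_scaled) simp_all
      also have "\<dots> = ennreal (y powr (b - 1) / (1 + y))" 
        using True by (simp add: powr_minus divide_inverse flip: ennreal_mult')
      finally show ?thesis using True by simp
    qed (simp add: F_def)
  qed
  also have "\<dots> = (\<integral>\<^sup>+w. \<integral>\<^sup>+y. F y w \<partial>lborel \<partial>lborel)"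
    by (rule lborel_pair.Fubini'[symmetric]) (simp add: F_def)
  also have "\<dots> = (\<integral>\<^sup>+w. ennreal (Gamma b) * ennreal (indicator {0<..} w * (w powr ((1 - b) - 1) * exp (- 1 * w))) \<partial>lborel)"
  proof (intro nn_integral_cong)
    fix w :: real
    show "(\<integral>\<^sup>+y. F y w \<partial>lborel) = ennreal (Gamma b) * ennreal (indicator {0<..} w * (w powr ((1 - b) - 1) * exp (- 1 * w)))"
    proof (cases "w > 0")
      case True
      have "(\<integral>\<^sup>+y. F y w \<partial>lborel) = (\<integral>\<^sup>+y. ennreal (exp (-w)) * ennreal (indicator {0<..} y * (y powr (b - 1) * exp (- w * y))) \<partial>lborel)"
        using True by (intro nn_integral_cong) (auto simp: F_def indicator_def algebra_simps exp_add exp_diff exp_minus field_simps simp flip: ennreal_mult')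
      also have "\<dots> = ennreal (exp (-w)) * ennreal (Gamma b * w powr (-b))"
        using True b by (subst nn_integral_cmult, simp, subst nn_integral_Gamma_scaled) simp_all
      finally show ?thesis using True b Gamma_real_pos[of b] by (simp add: mult_ac flip: ennreal_mult')
    qed (simp add: F_def)
  qed
  also have "\<dots> = ennreal (Gamma b) * ennreal (Gamma (1 - b) * 1 powr (-(1 - b)))"
    by (subst nn_integral_cmult, simp, subst nn_integral_Gamma_scaled) (use b in auto)
  also have "\<dots> = ennreal (Gamma b * Gamma (1 - b))"
    using Gamma_real_pos[of b] b by (simp add: ennreal_mult')
  also have "Gamma b * Gamma (1 - b) = pi / sin (pi * b)"
  proof -
    have "complex_of_real (Gamma b * Gamma (1 - b)) = Gamma (of_real b) * Gamma (1 - of_real b)"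
      using Gamma_complex_of_real[of b] Gamma_complex_of_real[of "1 - b"] by simp
    also have "\<dots> = of_real pi / sin (of_real pi * of_real b)" by (rule Gamma_reflection_complex)
    also have "\<dots> = complex_of_real (pi / sin (pi * b))"
      using sin_of_real[of "pi * b", where 'a = complex] by simp
    finally have "complex_of_real (Gamma b * Gamma (1 - b)) = complex_of_real (pi / sin (pi * b))" .
    thus ?thesis by (simp only: of_real_eq_iff)
  qed
  finally show ?thesis .
qed

text \<open>The substitution y = x^2 in \<open>nn_integral_powr_over_1_plus\<close> with b = a /
  2.\<close>

lemma nn_integral_powr_over_1_plus_square:
  assumes a: "0 < a" "a < (2::real)"
  shows "(\<integral>\<^sup>+x. ennreal (indicator {0<..} x * (x powr (a - 1) / (1 + x ^ 2))) \<partial>lborel) = ennreal (pi / (2 * sin (pi * a / 2)))"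
proof -
  define b where "b = a / 2"
  have b: "0 < b" "b < 1" using a by (auto simp: b_def)
  define f where "f = (\<lambda>y::real. y powr (b - 1) / (1 + y))"
  define I where "I = pi / sin (pi * b)"
  have sinpos: "sin (pi * b) > 0" using b by (intro sin_gt_zero) auto
  have "((\<lambda>y. indicator {0<..} y * f y) has_integral I) UNIV"
    by (rule nn_integral_has_integral) 
       (use nn_integral_powr_over_1_plus[OF b] sinpos in \<open>auto simp: f_def I_def indicator_def\<close>)
  also have "(\<lambda>y. indicator {0<..} y * f y) = (\<lambda>y. if y \<in> {0<..} then f y else 0)" by (auto simp: indicator_def)
  finally have fI: "(f has_integral I) {0<..}" by (simp only: has_integral_restrict_UNIV)
  have fabs: "f absolutely_integrable_on {0<..}"
    using fI by (intro nonnegative_absolutely_integrable_1) (auto simp: f_def integrable_on_def)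
  have img: "(\<lambda>x::real. x ^ 2) ` {0<..} = {0<..}"
  proof safe
    fix x :: real assume "x > 0"
    thus "x \<in> (\<lambda>x. x ^ 2) ` {0<..}" by (intro image_eqI[of _ _ "sqrt x"]) auto
  qed auto
  have "(\<lambda>x. \<bar>2 * x\<bar> * f (x ^ 2)) absolutely_integrable_on {0<..} \<and> integral {0<..} (\<lambda>x. \<bar>2 * x\<bar> * f (x ^ 2)) = I
       \<longleftrightarrow> f absolutely_integrable_on ((\<lambda>x. x ^ 2) ` {0<..}) \<and> integral ((\<lambda>x. x ^ 2) ` {0<..}) f = I"
    by (intro has_absolute_integral_change_of_variables_1') (auto intro!: derivative_eq_intros inj_onI simp: power2_eq_iff_nonneg)
  hence "(\<lambda>x. \<bar>2 * x\<bar> * f (x ^ 2)) absolutely_integrable_on {0<..} \<and> integral {0<..} (\<lambda>x. \<bar>2 * x\<bar> * f (x ^ 2)) = I"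
    unfolding img using fabs fI by (simp add: integral_unique)
  hence "((\<lambda>x. \<bar>2 * x\<bar> * f (x ^ 2)) has_integral I) {0<..}"
    by (simp add: has_integral_iff absolutely_integrable_on_def)
  from has_integral_mult_right[OF this, of "1/2"]
  have hI: "((\<lambda>x. 1/2 * (\<bar>2 * x\<bar> * f (x ^ 2))) has_integral 1/2 * I) {0<..}" .
  have e: "1/2 * (\<bar>2 * x\<bar> * f (x ^ 2)) = x powr (a - 1) / (1 + x ^ 2)" if "x > 0" for x
  proof -
    have "x * (x ^ 2) powr (b - 1) = x powr (a - 1)"
    proof -
      have "(x ^ 2) powr (b - 1) = (x powr 2) powr (b - 1)" using that by simp
      also have "\<dots> = x powr (2 * (b - 1))" by (rule powr_powr)
      finally have "x * (x ^ 2) powr (b - 1) = x powr 1 * x powr (2 * (b - 1))" using that by simp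
      also have "\<dots> = x powr (a - 1)" unfolding powr_add[symmetric] by (simp add: b_def)
      finally show ?thesis .
    qed
    thus ?thesis using that by (simp add: f_def)
  qed
  have "((\<lambda>x. x powr (a - 1) / (1 + x ^ 2)) has_integral 1/2 * I) {0<..}"
    by (rule has_integral_eq[OF _ hI]) (use e in auto)
  from nn_integral_has_integral_lebesgue[OF _ this] show ?thesis 
    by (simp add: I_def b_def mult.commute)
qed

text \<open>The integral of one partial fraction of coth against a power. With c = 2 \<pi> k the
  factor c powr (s - 1) becomes, up to a constant, a term of the Dirichlet series of \<zeta>(1 -
  s).\<close>

lemma nn_integral_powr_over_square_plus_square:
  assumes s: "-1 < s" "s < (1::real)" and c: "c > 0"
  shows "(\<integral>\<^sup>+x. ennreal (indicator {0<..} x * (x powr s / (x ^ 2 + c ^ 2))) \<partial>lborel) = ennreal (c powr (s - 1) * (pi / (2 * cos (pi * s / 2))))"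
proof -
  have "(\<integral>\<^sup>+x. ennreal (indicator {0<..} x * (x powr s / (x ^ 2 + c ^ 2))) \<partial>lborel) = 
        ennreal \<bar>c\<bar> * (\<integral>\<^sup>+x. ennreal (indicator {0<..} (0 + c * x) * ((0 + c * x) powr s / ((0 + c * x) ^ 2 + c ^ 2))) \<partial>lborel)"
    using c by (intro nn_integral_real_affine) auto
  also have "(\<integral>\<^sup>+x. ennreal (indicator {0<..} (0 + c * x) * ((0 + c * x) powr s / ((0 + c * x) ^ 2 + c ^ 2))) \<partial>lborel) = 
        (\<integral>\<^sup>+x. ennreal (c powr (s - 2)) * ennreal (indicator {0<..} x * (x powr ((s + 1) - 1) / (1 + x ^ 2))) \<partial>lborel)"
  proof (intro nn_integral_cong)
    fix x :: real
    show "ennreal (indicator {0<..} (0 + c * x) * ((0 + c * x) powr s / ((0 + c * x) ^ 2 + c ^ 2))) = 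
        ennreal (c powr (s - 2)) * ennreal (indicator {0<..} x * (x powr ((s + 1) - 1) / (1 + x ^ 2)))"
    proof (cases "x > 0")
      case True
      have "(c * x) powr s / ((c * x) ^ 2 + c ^ 2) = c powr s * x powr s / (c ^ 2 * (1 + x ^ 2))"
        using True c by (simp add: powr_mult power_mult_distrib algebra_simps)
      also have "\<dots> = c powr (s - 2) * (x powr s / (1 + x ^ 2))"
        using c by (simp add: powr_diff powr_numeral)
      finally show ?thesis using True c by (simp flip: ennreal_mult')
    qed (use c in \<open>auto simp: zero_less_mult_iff\<close>)
  qed
  also have "\<dots> = ennreal (c powr (s - 2)) * ennreal (pi / (2 * sin (pi * (s + 1) / 2)))"
    by (subst nn_integral_cmult, simp, subst nn_integral_powr_over_1_plus_square) (use s in auto)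
  also have "sin (pi * (s + 1) / 2) = cos (pi * s / 2)"
    by (simp add: sin_cos_eq algebra_simps add_divide_distrib)
  also have "ennreal \<bar>c\<bar> * (ennreal (c powr (s - 2)) * ennreal (pi / (2 * cos (pi * s / 2)))) = 
     ennreal (c powr 1 * c powr (s - 2) * (pi / (2 * cos (pi * s / 2))))"
    using c by (subst ennreal_mult', simp, subst ennreal_mult', simp) (simp add: mult.assoc)
  also have "c powr 1 * c powr (s - 2) = c powr (s - 1)" unfolding powr_add[symmetric] by simp
  finally show ?thesis .
qed

section \<open>Partial fractions of the hyperbolic cotangent\<close>

text \<open>Logarithmic differentiation of Gamma z * Gamma (1 - z) = \<pi> / sin (\<pi> z).\<close>

lemma Digamma_reflection_complex:
  fixes z :: complex
  assumes z: "z \<notin> \<int>"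
  shows "Digamma (1 - z) - Digamma z = of_real pi * cot (of_real pi * z)"
proof -
  have z1: "1 - z \<notin> \<int>" using z by (metis Ints_1 Ints_diff diff_diff_eq2 add_diff_cancel_left')
  have n: "z \<notin> \<int>\<^sub>\<le>\<^sub>0" "1 - z \<notin> \<int>\<^sub>\<le>\<^sub>0" using z z1 nonpos_Ints_subset_Ints by blast+
  have s0: "sin (of_real pi * z) \<noteq> 0" 
  proof
    assume "sin (of_real pi * z) = 0"
    then obtain m :: int where "of_real pi * z = of_real (m * pi)" by (auto simp: sin_eq_0)
    hence "z = of_int m" by simp
    thus False using z by auto
  qed
  have D1: "((\<lambda>w. Gamma w * Gamma (1 - w)) has_field_derivative 
        (Gamma z * Gamma (1 - z)) * (Digamma z - Digamma (1 - z))) (at z)"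
    using n by (auto intro!: derivative_eq_intros simp: algebra_simps)
  have D2: "((\<lambda>w. of_real pi / sin (of_real pi * w)) has_field_derivative 
        - (of_real pi * of_real pi * cos (of_real pi * z) / sin (of_real pi * z) ^ 2)) (at z)"
    using s0 by (auto intro!: derivative_eq_intros simp: power2_eq_square)
  have "(\<lambda>w. Gamma w * Gamma (1 - w)) = (\<lambda>w::complex. of_real pi / sin (of_real pi * w))"
    using Gamma_reflection_complex by auto
  hence "(Gamma z * Gamma (1 - z)) * (Digamma z - Digamma (1 - z)) = - (of_real pi * of_real pi * cos (of_real pi * z) / sin (of_real pi * z) ^ 2)"
    using DERIV_unique[OF D1] D2 by simp
  hence "of_real pi / sin (of_real pi * z) * (Digamma z - Digamma (1 - z)) = of_real pi / sin (of_real pi * z) * (- (of_real pi * cot (of_real pi * z)))"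
    unfolding Gamma_reflection_complex by (simp add: cot_def power2_eq_square)
  moreover have "of_real pi / sin (of_real pi * z) \<noteq> 0" using s0 by simp
  ultimately have "Digamma z - Digamma (1 - z) = - (of_real pi * cot (of_real pi * z))"
    by (simp only: mult_cancel_left) auto
  thus ?thesis by (simp add: algebra_simps)
qed

text \<open>The quotient on the right is coth (v / 2). At z = iv / (2 \<pi>) the cotangent in
  \<open>Digamma_reflection_complex\<close> becomes this coth up to a factor, and the limit formula
  for \<open>Digamma\<close> supplies the series.\<close>

lemma coth_partial_fractions:
  fixes v :: real
  assumes v: "v > 0"
  shows "(\<lambda>k. 4 * v / (v ^ 2 + (2 * pi * real (Suc k)) ^ 2)) sums ((1 + exp (- v)) / (1 - exp (- v)) - 2 / v)"
proof -
  define y where "y = v / (2 * pi)"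
  have y: "y > 0" using v by (simp add: y_def)
  define z where "z = \<i> * complex_of_real y"
  have zI: "z \<notin> \<int>" using y by (auto simp: z_def complex_is_Int_iff)
  have z0: "z \<noteq> 0" "1 - z \<noteq> 0" using y by (auto simp: z_def complex_eq_iff)
  have nz: "of_nat m + z \<noteq> 0" "of_nat m - z \<noteq> 0" for m using y by (auto simp: z_def complex_eq_iff)
  define S where "S = (\<lambda>m. (\<Sum>n<m. inverse (z + of_nat n)) - (\<Sum>n<m. inverse (1 - z + of_nat n)))"
  define q where "q = (\<lambda>k. 2 * y / (real (Suc k) ^ 2 + y ^ 2))"
  have lim: "S \<longlonglongrightarrow> of_real pi * cot (of_real pi * z)"
  proof -
    have "(\<lambda>m. (of_real (ln (real m)) - (\<Sum>n<m. inverse (1 - z + of_nat n))) - (of_real (ln (real m)) - (\<Sum>n<m. inverse (z + of_nat n))))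
       \<longlonglongrightarrow> Digamma (1 - z) - Digamma z"
      by (intro tendsto_diff Digamma_LIMSEQ z0)
    thus ?thesis unfolding Digamma_reflection_complex[OF zI] S_def by (simp add: algebra_simps)
  qed
  \<comment> \<open>The term k + 1 of one sum is paired with the term k of the other. This shift
    leaves 1 / z at the start and 1 / (m + 1 - z), which tends to 0, at the end.\<close>
  have S_eq: "S (Suc m) = 1 / z - 1 / (of_nat (Suc m) - z) - \<i> * of_real (\<Sum>k<m. q k)" for m
  proof (induction m)
    case 0 thus ?case by (simp add: S_def inverse_eq_divide)
  next
    case (Suc m)
    have a1: "S (Suc (Suc m)) = S (Suc m) + (1 / (of_nat (Suc m) + z) - 1 / (of_nat (Suc (Suc m)) - z))"
      by (simp add: S_def inverse_eq_divide add_ac diff_diff_eq2)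
    have a2: "1 / (of_nat (Suc m) + z) - 1 / (of_nat (Suc m) - z) = - (\<i> * of_real (q m))"
    proof -
      have "(of_nat (Suc m) + z) * (of_nat (Suc m) - z) = of_real (real (Suc m) ^ 2 + y ^ 2)"
        by (simp add: z_def power2_eq_square algebra_simps)
      moreover have "1 / (of_nat (Suc m) + z) - 1 / (of_nat (Suc m) - z) = - 2 * z / ((of_nat (Suc m) + z) * (of_nat (Suc m) - z))"
        using nz[of "Suc m"] by (simp add: divide_simps del: of_nat_Suc)
      ultimately show ?thesis by (simp add: q_def z_def)
    qed
    have a3: "1 / (of_nat (Suc m) + z) = 1 / (of_nat (Suc m) - z) - \<i> * of_real (q m)"
      using a2 by (simp only: diff_eq_eq) simp
    show ?case unfolding a1 Suc.IH a3 sum.lessThan_Suc of_real_add by (simp add: algebra_simps del: of_nat_Suc)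
  qed
  have "(\<lambda>m. 1 / (of_nat (Suc m) - z)) \<longlonglongrightarrow> 0"
  proof (rule tendsto_norm_zero_cancel, rule tendsto_sandwich[of "\<lambda>_. 0" _ _ "\<lambda>m. 1 / real (Suc m)"])
    show "\<forall>\<^sub>F m in sequentially. norm (1 / (of_nat (Suc m) - z)) \<le> 1 / real (Suc m)"
    proof (intro always_eventually allI)
      fix m
      have "\<bar>Re (of_nat (Suc m) - z)\<bar> \<le> norm (of_nat (Suc m) - z)" by (rule abs_Re_le_cmod)
      hence "real (Suc m) \<le> norm (of_nat (Suc m) - z)" by (simp add: z_def)
      thus "norm (1 / (of_nat (Suc m) - z)) \<le> 1 / real (Suc m)" unfolding norm_divide
        by (intro frac_le) auto
    qed
    show "(\<lambda>m. 1 / real (Suc m)) \<longlonglongrightarrow> 0" by real_asymp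
  qed auto
  hence "(\<lambda>m. Im (1 / z - 1 / (of_nat (Suc m) - z) - S (Suc m))) \<longlonglongrightarrow> Im (1 / z - 0 - of_real pi * cot (of_real pi * z))"
    by (intro tendsto_intros LIMSEQ_Suc[OF lim])
  hence "q sums Im (1 / z - 0 - of_real pi * cot (of_real pi * z))"
    unfolding S_eq sums_def by simp
  moreover have "Im (1 / z) = - (1 / y)" using y by (simp add: z_def Im_divide power2_eq_square)
  moreover have "Im (of_real pi * cot (of_real pi * z)) = - pi * ((1 + exp (- v)) / (1 - exp (- v)))"
  proof -
    define E where "E = exp (v / 2)"
    have E: "E > 1" using v by (simp add: E_def)
    have iz: "of_real pi * z = \<i> * of_real (v / 2)" using pi_gt_zero by (simp add: z_def y_def field_simps)
    have s: "sin (of_real pi * z) = \<i> * of_real ((E - inverse E) / 2)"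
      unfolding iz by (simp add: power2_eq_square field_simps complex_eq_iff Re_sin Im_sin E_def exp_minus)
    have c: "cos (of_real pi * z) = of_real ((E + inverse E) / 2)"
      unfolding iz by (simp add: power2_eq_square field_simps complex_eq_iff Re_cos Im_cos E_def exp_minus)
    have e: "exp (- v) = inverse E * inverse E" by (simp add: E_def flip: exp_minus exp_add)
    have gen: "complex_of_real a / (\<i> * of_real b) = - \<i> * of_real (a / b)" for a b
      by (cases "b = 0") (auto simp: divide_simps)
    have "cot (of_real pi * z) = of_real ((E + inverse E) / 2) / (\<i> * of_real ((E - inverse E) / 2))"
      unfolding cot_def s c ..
    also have "\<dots> = - \<i> * of_real (((E + inverse E) / 2) / ((E - inverse E) / 2))"
      by (rule gen)
    also have "((E + inverse E) / 2) / ((E - inverse E) / 2) = (1 + exp (- v)) / (1 - exp (- v))"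
    proof -
      have "E * E > 1 * 1" using E by (intro mult_strict_mono) auto
      hence "E - inverse E \<noteq> 0" "1 - inverse E * inverse E \<noteq> 0" using E by (auto simp: field_simps)
      thus ?thesis using E unfolding e by (simp add: divide_simps)
    qed
    finally show ?thesis by simp
  qed
  ultimately have "q sums (pi * ((1 + exp (- v)) / (1 - exp (- v))) - 1 / y)" by simp
  from sums_mult[OF this, of "1 / pi"]
  have "(\<lambda>k. 1 / pi * q k) sums (((1 + exp (- v)) / (1 - exp (- v))) - 2 / v)"
    using v by (simp add: y_def right_diff_distrib)
  moreover have "1 / pi * q k = 4 * v / (v ^ 2 + (2 * pi * real (Suc k)) ^ 2)" for k
  proof -
    have "real (Suc k) ^ 2 + y ^ 2 = (v ^ 2 + (2 * pi * real (Suc k)) ^ 2) / (4 * pi ^ 2)"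
      by (simp add: y_def power_divide power_mult_distrib divide_simps del: of_nat_Suc)
    hence "q k = 2 * y / ((v ^ 2 + (2 * pi * real (Suc k)) ^ 2) / (4 * pi ^ 2))" by (simp add: q_def)
    thus ?thesis by (simp add: y_def power2_eq_square)
  qed
  ultimately show ?thesis by simp
qed

section \<open>The functional equation from the trapezoid series\<close>

text \<open>\<open>\<phi>\<close> is the antiderivative of
  \<open>norm_zeta_term_le_telescope\<close> divided by s (s + 1), now including n = 0. There the
  integrand behaves like u powr (-s - 1) at 0, which is integrable because s < 0. The derivative is
  only available inside the interval, so the fundamental theorem is applied with continuity at the
  ends; grouping u with (n + u) powr (-s - 1) makes this continuity visible.\<close>

lemma zeta_term_real_integral:
  assumes s: "-1 < s" "s < (0::real)"
  obtains U where "((\<lambda>u. u * (1 - u) * (real n + u) powr (- s - 2)) has_integral U) {0..1}"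
    "zeta_term n (of_real s) = of_real (s * (s + 1) / 2 * U)"
proof -
  define \<phi> where "\<phi> = (\<lambda>u. (u * (real n + u) powr (-s - 1) * ((1 - u) * (-s)) - (1 - 2 * u) * (real n + u) powr (-s)
        - 2 * ((real n + u) powr (1 - s) / (1 - s))) / (s * (s + 1)))"
  have ss: "s * (s + 1) \<noteq> 0" using s by simp
  have c0: "continuous_on {0..1} (\<lambda>u. u * (real n + u) powr (-s - 1))"
  proof (cases "n = 0")
    case True
    have "continuous_on {0..1} (\<lambda>u::real. u powr (- s))"
      using s by (intro continuous_on_powr' continuous_intros) auto
    also have "?this \<longleftrightarrow> ?thesis"
    proof (rule continuous_on_cong[OF refl])
      fix u :: real assume "u \<in> {0..1}"
      thus "u powr (- s) = u * (real n + u) powr (-s - 1)"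
        using True powr_mult_base[of u "-s - 1"] by simp
    qed
    finally show ?thesis .
  next
    case False
    thus ?thesis by (intro continuous_intros) auto
  qed
  have c1: "continuous_on {0..1} (\<lambda>u. (real n + u) powr r)" if "r > 0" for r
    by (rule continuous_on_powr') (use that in \<open>auto intro!: continuous_intros\<close>)
  have c2: "-s > 0" "1 - s > 0" "1 - s \<noteq> 0" using s by auto
  have "continuous_on {0..1} \<phi>" unfolding \<phi>_def
    by (rule c0 c1[OF c2(1)] c1[OF c2(2)] continuous_on_divide continuous_on_diff continuous_on_mult
          continuous_on_const continuous_on_id | use ss c2 in simp)+
  moreover have "(\<phi> has_vector_derivative u * (1 - u) * (real n + u) powr (- s - 2)) (at u)" if u: "u \<in> {0<..<1}" for u
  proof -
    define x where "x = real n + u"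
    have x: "x > 0" using u by (simp add: x_def add_nonneg_pos)
    have D: "((\<lambda>u. (real n + u) powr r) has_real_derivative r * x powr (r - 1)) (at u)" for r
      using x unfolding x_def by (auto intro!: derivative_eq_intros)
    have e0: "x powr r = x * x powr (r - 1)" for r
      using powr_mult_base[of x "r - 1"] x by simp
    have "(-s - 1) - 1 = - s - 2" by simp
    note e1 = e0[of "-s - 1", unfolded this]
    have e2: "x powr (-s) = x * (x * x powr (- s - 2))" using e0[of "-s"] unfolding e1 .
    have "((\<lambda>u. u * (real n + u) powr (-s - 1) * ((1 - u) * (-s)) - (1 - 2 * u) * (real n + u) powr (-s)
        - 2 * ((real n + u) powr (1 - s) / (1 - s))) has_real_derivative 
        (s * (s + 1) * (u * (1 - u) * x powr (- s - 2)))) (at u)"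
    proof -
      have DA: "((\<lambda>u. (1 - u) * (-s)) has_real_derivative s) (at u)"
        and DB: "((\<lambda>u. 1 - 2 * u) has_real_derivative -2) (at u)"
        by (auto intro!: derivative_eq_intros)
      have a: "(-s - 1) - 1 = - s - 2" "(1 - s) - 1 = - s" by simp_all
      note D1 = D[of "-s-1", unfolded a] and D2 = D[of "-s"] and D3 = D[of "1 - s", unfolded a]
      have "1 - s \<noteq> 0" using s by simp
      thus ?thesis
        by (intro DERIV_cong[OF DERIV_diff[OF DERIV_diff[OF DERIV_mult[OF DERIV_mult[OF DERIV_ident D1] DA] 
                DERIV_mult[OF DB D2]] DERIV_cmult[OF DERIV_cdivide[OF D3]]]], fold x_def, unfold e1 e2)
           (simp add: divide_simps; simp add: algebra_simps)
    qed
    from DERIV_cdivide[OF this, of "s * (s + 1)"]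
    have "(\<phi> has_real_derivative u * (1 - u) * x powr (- s - 2)) (at u)" 
      unfolding \<phi>_def by (rule DERIV_cong) (use ss in simp)
    thus ?thesis by (simp add: x_def has_real_derivative_iff_has_vector_derivative)
  qed
  ultimately have I: "((\<lambda>u. u * (1 - u) * (real n + u) powr (- s - 2)) has_integral (\<phi> 1 - \<phi> 0)) {0..1}"
    by (intro fundamental_theorem_of_calculus_interior) auto
  have p: "of_nat m powr complex_of_real r = of_real (real m powr r)" for m r
    using powr_of_real[of "real m" r] by simp
  have "s * (s + 1) / 2 * (\<phi> 1 - \<phi> 0) = (real n powr (-s) + real (Suc n) powr (-s)) / 2 + (real (Suc n) powr (1 - s) - real n powr (1 - s)) / (s - 1)"
    using s ss by (simp add: \<phi>_def divide_simps) (simp add: algebra_simps)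
  also have "complex_of_real \<dots> = zeta_term n (of_real s)"
    unfolding zeta_term_def of_real_add of_real_divide of_real_diff p[symmetric] by simp
  finally have "zeta_term n (of_real s) = of_real (s * (s + 1) / 2 * (\<phi> 1 - \<phi> 0))" by simp
  with I show ?thesis using that by blast
qed

lemma has_integral_parabola_exp:
  assumes v: "v > (0::real)"
  shows "((\<lambda>u. u * (1 - u) * exp (- v * u)) has_integral ((1 + exp (- v)) / v ^ 2 - 2 * (1 - exp (- v)) / v ^ 3)) {0..1}"
proof -
  define A where "A = (\<lambda>u. - exp (- v * u) * (u * (1 - u) / v + (1 - 2 * u) / v ^ 2 - 2 / v ^ 3))"
  have "((\<lambda>u. u * (1 - u) * exp (- v * u)) has_integral (A 1 - A 0)) {0..1}"
  proof (rule fundamental_theorem_of_calculus)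
    fix u :: real
    show "(A has_vector_derivative u * (1 - u) * exp (- v * u)) (at u within {0..1})"
    proof -
      have D0: "((\<lambda>u. u * (1 - u)) has_real_derivative (1 - 2 * u)) (at u within {0..1})"
        "((\<lambda>u. 1 - 2 * u) has_real_derivative - 2) (at u within {0..1})"
        by (auto intro!: derivative_eq_intros)
      have D1: "((\<lambda>u. u * (1 - u) / v + (1 - 2 * u) / v ^ 2 - 2 / v ^ 3) has_real_derivative ((1 - 2 * u) / v + -2 / v ^ 2 - 0)) (at u within {0..1})"
        by (intro DERIV_diff DERIV_add DERIV_cdivide D0 DERIV_const)
      have D2: "((\<lambda>u. - exp (- v * u)) has_real_derivative v * exp (- v * u)) (at u within {0..1})"
        by (auto intro!: derivative_eq_intros)
      show ?thesis
        unfolding A_def has_real_derivative_iff_has_vector_derivative[symmetric]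
        by (rule DERIV_cong[OF DERIV_mult[OF D2 D1]])
           (use v in \<open>simp add: divide_simps power2_eq_square power3_eq_cube; simp add: algebra_simps\<close>)
    qed
  qed simp
  also have "A 1 - A 0 = (1 + exp (- v)) / v ^ 2 - 2 * (1 - exp (- v)) / v ^ 3"
    using v by (simp add: A_def divide_simps power2_eq_square power3_eq_cube) (simp add: algebra_simps)
  finally show ?thesis .
qed

text \<open>The geometric series in exp (-v) divides \<open>w\<close> by 1 - exp (-v), which leaves
  (coth (v / 2) - 2 / v) / v^2. The powers of v combine to v powr (s - 1), and
  \<open>coth_partial_fractions\<close> expands the bracket.\<close>

lemma parabola_laplace_series:
  assumes v: "v > (0::real)" 
  defines "w \<equiv> (1 + exp (- v)) / v ^ 2 - 2 * (1 - exp (- v)) / v ^ 3"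
  shows "(\<Sum>n. ennreal (v powr (s + 1) * exp (- v * real n) * w)) = 
         (\<Sum>k. ennreal (4 * (v powr s / (v ^ 2 + (2 * pi * real (Suc k)) ^ 2))))"
proof -
  define q where "q = exp (- v)"
  have q: "0 < q" "q < 1" using v by (auto simp: q_def)
  have w0: "w \<ge> 0"
    by (rule has_integral_nonneg[OF has_integral_parabola_exp[OF v, folded w_def]]) auto
  have "(\<lambda>n. q ^ n) sums (1 / (1 - q))" using q by (intro geometric_sums) auto
  hence "(\<lambda>n. v powr (s + 1) * w * q ^ n) sums (v powr (s + 1) * w * (1 / (1 - q)))" by (rule sums_mult)
  moreover have "v powr (s + 1) * w * q ^ n = v powr (s + 1) * exp (- v * real n) * w" for n
    by (simp add: q_def mult_ac flip: exp_of_nat_mult)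
  ultimately have 1: "(\<lambda>n. v powr (s + 1) * exp (- v * real n) * w) sums (v powr (s + 1) * w * (1 / (1 - q)))" by simp
  have "v powr (s + 1) * w * (1 / (1 - q)) = v powr s / v * ((1 + q) / (1 - q) - 2 / v)"
  proof -
    have "v powr (s + 1) = v * v powr s" using v powr_mult_base[of v s] by (simp add: add.commute)
    moreover have "w * (1 / (1 - q)) = 1 / v ^ 2 * ((1 + q) / (1 - q) - 2 / v)"
      using v q unfolding w_def q_def[symmetric]
      by (simp add: divide_simps power2_eq_square power3_eq_cube)
    moreover have "v powr (s + 1) * w * (1 / (1 - q)) = v powr (s + 1) * (w * (1 / (1 - q)))" by simp
    moreover have "v * v powr s * (1 / v ^ 2 * X) = v powr s / v * X" for X
      using v by (simp add: power2_eq_square)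
    ultimately show ?thesis by (simp only:)
  qed
  moreover have A: "(\<lambda>k. v powr s / v * (4 * v / (v ^ 2 + (2 * pi * real (Suc k)) ^ 2))) sums (v powr s / v * ((1 + q) / (1 - q) - 2 / v))"
    unfolding q_def by (intro sums_mult coth_partial_fractions v)
  moreover have "v powr s / v * (4 * v / X) = 4 * (v powr s / X)" for X using v by simp
  note A[unfolded this]
  ultimately have 2: "(\<lambda>k. 4 * (v powr s / (v ^ 2 + (2 * pi * real (Suc k)) ^ 2))) sums (v powr (s + 1) * w * (1 / (1 - q)))"
    by (simp only:)
  have "(\<Sum>n. ennreal (v powr (s + 1) * exp (- v * real n) * w)) = ennreal (v powr (s + 1) * w * (1 / (1 - q)))"
    by (rule suminf_ennreal_eq[OF _ 1]) (use w0 in auto)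
  also have "\<dots> = (\<Sum>k. ennreal (4 * (v powr s / (v ^ 2 + (2 * pi * real (Suc k)) ^ 2))))"
    by (rule suminf_ennreal_eq[OF _ 2, symmetric]) auto
  finally show ?thesis .
qed

text \<open>For \<open>-1 < s < 0\<close> each term of the trapezoid series is \<open>s (s + 1) / 2\<close> times the integral of
  \<open>u (1 - u) (n + u) powr (-s - 2)\<close> over the unit interval. Writing the power as a Laplace transform and summing
  over \<open>n\<close> first turns the series into the integral of \<open>v powr (s - 1) (coth (v / 2) - 2 / v)\<close>; the
  partial fractions of \<open>coth\<close> then produce \<open>\<zeta>(1 - s)\<close>. All integrands are nonnegative.\<close>

lemma zeta_strip_functional_equation_real:
  assumes s: "-1 < s" "s < (0::real)"
  shows "zeta_strip (1 - of_real s) = zeta_chi (of_real s) * zeta_strip (of_real s)"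
proof -
  interpret lborel_pair: pair_sigma_finite lborel lborel ..
  define G where "G = Gamma (s + 2)"
  have G: "G > 0" using s by (simp add: G_def Gamma_real_pos)
  have "\<exists>U. \<forall>n. ((\<lambda>u. u * (1 - u) * (real n + u) powr (- s - 2)) has_integral U n) {0..1} \<and>
    zeta_term n (of_real s) = of_real (s * (s + 1) / 2 * U n)"
    using zeta_term_real_integral[OF s] by (intro choice allI) metis
  then obtain U where U: "\<And>n. ((\<lambda>u. u * (1 - u) * (real n + u) powr (- s - 2)) has_integral U n) {0..1}"
    "\<And>n. zeta_term n (of_real s) = of_real (s * (s + 1) / 2 * U n)" by blast
  have U0: "U n \<ge> 0" for n by (rule has_integral_nonneg[OF U(1)]) auto
  define F where "F = (\<lambda>n u v::real. ennreal (indicator {0..1} u * indicator {0<..} v * (u * (1 - u) * (v powr (s + 1) * exp (- v * (real n + u))))))"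
  have Fm: "(\<lambda>(u, v). F n u v) \<in> borel_measurable (lborel \<Otimes>\<^sub>M lborel)" for n
    unfolding F_def by measurable
  have Fu: "ennreal (G * U n) = (\<integral>\<^sup>+u. \<integral>\<^sup>+v. F n u v \<partial>lborel \<partial>lborel)" for n
  proof -
    have "ennreal (G * U n) = ennreal G * ennreal (U n)" using G by (simp add: ennreal_mult')
    also have "ennreal (U n) = (\<integral>\<^sup>+u. ennreal (indicator {0..1} u * (u * (1 - u) * (real n + u) powr (- s - 2))) \<partial>lborel)"
      by (rule nn_integral_has_integral_lebesgue[OF _ U(1), symmetric]) auto
    also have "ennreal G * \<dots> = (\<integral>\<^sup>+u. ennreal G * ennreal (indicator {0..1} u * (u * (1 - u) * (real n + u) powr (- s - 2))) \<partial>lborel)"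
      by (subst nn_integral_cmult) auto
    also have "\<dots> = (\<integral>\<^sup>+u. \<integral>\<^sup>+v. F n u v \<partial>lborel \<partial>lborel)"
    proof (intro nn_integral_cong)
      fix u :: real
      show "ennreal G * ennreal (indicator {0..1} u * (u * (1 - u) * (real n + u) powr (- s - 2))) = (\<integral>\<^sup>+v. F n u v \<partial>lborel)"
      proof (cases "u \<in> {0<..1}")
        case True
        have "(\<integral>\<^sup>+v. F n u v \<partial>lborel) = (\<integral>\<^sup>+v. ennreal (u * (1 - u)) * ennreal (indicator {0<..} v * (v powr ((s + 2) - 1) * exp (- (real n + u) * v))) \<partial>lborel)"
          using True by (intro nn_integral_cong) (auto simp: F_def indicator_def algebra_simps simp flip: ennreal_mult')
        also have "\<dots> = ennreal (u * (1 - u)) * ennreal (G * (real n + u) powr (- (s + 2)))"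
          unfolding G_def using True s
          by (subst nn_integral_cmult, simp, subst nn_integral_Gamma_scaled) (simp_all add: add_nonneg_pos)
        also have "- (s + 2) = - s - 2" by simp
        also have "ennreal (u * (1 - u)) * ennreal (G * (real n + u) powr (- s - 2)) = ennreal (u * (1 - u) * (G * (real n + u) powr (- s - 2)))"
          using True by (intro ennreal_mult'[symmetric]) auto
        also have "u * (1 - u) * (G * (real n + u) powr (- s - 2)) = G * (u * (1 - u) * (real n + u) powr (- s - 2))" by simp
        also have "ennreal \<dots> = ennreal G * ennreal (indicator {0..1} u * (u * (1 - u) * (real n + u) powr (- s - 2)))"
          using True G by (subst ennreal_mult') auto
        finally show ?thesis by simp
      next
        case False
        \<comment> \<open>At u = 0 the Laplace formula would have rate 0 when n = 0; the factor u
          makes both sides vanish there.\<close>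
        hence "u \<notin> {0..1} \<or> u = 0" by auto
        thus ?thesis by (auto simp: F_def)
      qed
    qed
    finally show ?thesis .
  qed
  define w where "w = (\<lambda>v::real. (1 + exp (- v)) / v ^ 2 - 2 * (1 - exp (- v)) / v ^ 3)"
  have Fv: "(\<integral>\<^sup>+u. F n u v \<partial>lborel) = indicator {0<..} v * ennreal (v powr (s + 1) * exp (- v * real n) * w v)" for n v
  proof (cases "v > 0")
    case True
    have "(\<integral>\<^sup>+u. F n u v \<partial>lborel) = (\<integral>\<^sup>+u. ennreal (v powr (s + 1) * exp (- v * real n)) * ennreal (indicator {0..1} u * (u * (1 - u) * exp (- v * u))) \<partial>lborel)"
      using True by (intro nn_integral_cong) (auto simp: F_def indicator_def algebra_simps exp_add exp_diff exp_minus field_simps simp flip: ennreal_mult')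
    also have "\<dots> = ennreal (v powr (s + 1) * exp (- v * real n)) * (\<integral>\<^sup>+u. ennreal (indicator {0..1} u * (u * (1 - u) * exp (- v * u))) \<partial>lborel)"
      by (subst nn_integral_cmult) auto
    also have "(\<integral>\<^sup>+u. ennreal (indicator {0..1} u * (u * (1 - u) * exp (- v * u))) \<partial>lborel) = ennreal (w v)"
      unfolding w_def by (rule nn_integral_has_integral_lebesgue[OF _ has_integral_parabola_exp[OF True]]) auto
    finally show ?thesis using True by (simp add: ennreal_mult')
  qed (simp add: F_def)
  define R where "R = (\<lambda>k. 4 * ((2 * pi * real (Suc k)) powr (s - 1) * (pi / (2 * cos (pi * s / 2)))))"
  have cpos: "cos (pi * s / 2) > 0" 
    using s mult_strict_left_mono[of "-1" s pi] by (intro cos_gt_zero_pi) (auto simp: field_simps)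
  have "(\<Sum>n. ennreal (G * U n)) = (\<Sum>n. \<integral>\<^sup>+v. \<integral>\<^sup>+u. F n u v \<partial>lborel \<partial>lborel)"
    unfolding Fu using lborel_pair.Fubini'[OF Fm] by simp
  also have "\<dots> = (\<integral>\<^sup>+v. (\<Sum>n. \<integral>\<^sup>+u. F n u v \<partial>lborel) \<partial>lborel)"
  proof (rule nn_integral_suminf[symmetric])
    show "(\<lambda>v. \<integral>\<^sup>+u. F n u v \<partial>lborel) \<in> borel_measurable lborel" for n
      unfolding Fv w_def by measurable
  qed
  also have "\<dots> = (\<integral>\<^sup>+v. (\<Sum>k. ennreal 4 * ennreal (indicator {0<..} v * (v powr s / (v ^ 2 + (2 * pi * real (Suc k)) ^ 2)))) \<partial>lborel)"
  proof (intro nn_integral_cong)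
    fix v :: real
    show "(\<Sum>n. \<integral>\<^sup>+u. F n u v \<partial>lborel) = (\<Sum>k. ennreal 4 * ennreal (indicator {0<..} v * (v powr s / (v ^ 2 + (2 * pi * real (Suc k)) ^ 2))))"
    proof (cases "v > 0")
      case True
      have "ennreal 4 * ennreal (indicator {0<..} v * X) = ennreal (4 * X)" for X
        using True by (subst ennreal_mult') auto
      moreover have "indicator {0<..} v = (1 :: ennreal)" using True by simp
      ultimately show ?thesis unfolding Fv w_def 
        using parabola_laplace_series[OF True, of s] by (simp only: mult_1)
    qed (simp add: Fv)
  qed
  also have "\<dots> = (\<Sum>k. \<integral>\<^sup>+v. ennreal 4 * ennreal (indicator {0<..} v * (v powr s / (v ^ 2 + (2 * pi * real (Suc k)) ^ 2))) \<partial>lborel)"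
    by (rule nn_integral_suminf) measurable
  also have "\<dots> = (\<Sum>k. ennreal (R k))"
  proof (intro suminf_cong)
    fix k
    have "(\<integral>\<^sup>+v. ennreal 4 * ennreal (indicator {0<..} v * (v powr s / (v ^ 2 + (2 * pi * real (Suc k)) ^ 2))) \<partial>lborel)
      = ennreal 4 * ennreal ((2 * pi * real (Suc k)) powr (s - 1) * (pi / (2 * cos (pi * s / 2))))"
      using s by (subst nn_integral_cmult, simp, subst nn_integral_powr_over_square_plus_square) simp_all
    thus "(\<integral>\<^sup>+v. ennreal 4 * ennreal (indicator {0<..} v * (v powr s / (v ^ 2 + (2 * pi * real (Suc k)) ^ 2))) \<partial>lborel) = ennreal (R k)"
      unfolding R_def by (subst ennreal_mult') simp_all
  qed
  finally have sums_eq: "(\<Sum>n. ennreal (G * U n)) = (\<Sum>k. ennreal (R k))" .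
  have R0: "R k \<ge> 0" for k using cpos by (simp add: R_def)
  define B where "B = 4 * ((2 * pi) powr (s - 1) * (pi / (2 * cos (pi * s / 2))))"
  define Z where "Z = (\<Sum>k. real (Suc k) powr (s - 1))"
  have sumZ: "(\<lambda>k. real (Suc k) powr (s - 1)) sums Z"
    unfolding Z_def using s by (intro summable_sums) (subst summable_Suc_iff, simp add: summable_real_powr_iff)
  have R_eq: "R k = B * real (Suc k) powr (s - 1)" for k
    unfolding R_def B_def by (subst powr_mult) auto
  have sumR: "R sums (B * Z)" unfolding R_eq[abs_def] by (rule sums_mult[OF sumZ])
  have eR: "(\<Sum>n. ennreal (G * U n)) = ennreal (B * Z)"
    unfolding sums_eq by (rule suminf_ennreal_eq[OF R0 sumR])
  \<comment> \<open>Finiteness of the extended sum turns the identity of extended sums into one of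
    convergent real series.\<close>
  have sumGU: "summable (\<lambda>n. G * U n)"
    by (rule summable_suminf_not_top) (use G U0 eR in auto)
  have "ennreal (\<Sum>n. G * U n) = ennreal (B * Z)"
    using suminf_ennreal2[OF _ sumGU] G U0 eR by simp
  moreover have "(\<Sum>n. G * U n) \<ge> 0" using sumGU G U0 by (intro suminf_nonneg) auto
  moreover have "B * Z \<ge> 0" using sumR R0 by (metis suminf_nonneg sums_iff)
  ultimately have "(\<Sum>n. G * U n) = B * Z" by simp
  hence GU: "(\<lambda>n. G * U n) sums (B * Z)" using sumGU by (simp add: sums_iff)
  have "(\<lambda>n. complex_of_real (s * (s + 1) / (2 * G) * (G * U n))) sums of_real (s * (s + 1) / (2 * G) * (B * Z))"
    by (intro sums_of_real sums_mult GU)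
  moreover have "complex_of_real (s * (s + 1) / (2 * G) * (G * U n)) = zeta_term n (of_real s)" for n
    using G unfolding U(2) by simp
  ultimately have zs: "zeta_strip (of_real s) = of_real (s * (s + 1) / (2 * G) * (B * Z))"
    unfolding zeta_strip_def by (simp add: sums_iff)
  have z1s: "zeta_strip (1 - of_real s) = of_real Z"
  proof -
    have "(\<lambda>n. 1 / of_nat (Suc n) powr (1 - complex_of_real s)) sums zeta_strip (1 - of_real s)"
      by (rule zeta_strip_eq_dirichlet) (use s in auto)
    moreover have "1 / of_nat (Suc n) powr (1 - complex_of_real s) = of_real (real (Suc n) powr (s - 1))" for n
    proof -
      have "of_nat (Suc n) powr (1 - complex_of_real s) = of_real (real (Suc n) powr (1 - s))"
        using powr_of_real[of "real (Suc n)" "1 - s"] by (simp del: of_nat_Suc)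
      moreover have "real (Suc n) powr (s - 1) = 1 / real (Suc n) powr (1 - s)"
        using powr_minus_divide[of "real (Suc n)" "1 - s"] by simp
      ultimately show ?thesis by (simp del: of_nat_Suc)
    qed
    ultimately have "(\<lambda>n. complex_of_real (real (Suc n) powr (s - 1))) sums zeta_strip (1 - of_real s)" by simp
    moreover have "(\<lambda>n. complex_of_real (real (Suc n) powr (s - 1))) sums of_real Z"
      by (rule sums_of_real[OF sumZ])
    ultimately show ?thesis by (rule sums_unique2)
  qed
  have chi: "zeta_chi (of_real s) = of_real (2 * (2 * pi) powr (-s) * cos (pi * s / 2) * Gamma s)"
  proof -
    have "complex_of_real (2 * pi) powr (- of_real s) = of_real ((2 * pi) powr (-s))"
      using powr_of_real[of "2 * pi" "-s"] by simp
    moreover have "cos (complex_of_real pi * of_real s / 2) = of_real (cos (pi * s / 2))"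
      using cos_of_real[of "pi * s / 2", where 'a = complex] by simp
    ultimately show ?thesis unfolding zeta_chi_def by (simp add: Gamma_complex_of_real)
  qed
  \<comment> \<open>The Laplace transform brought in Gamma (s + 2); reducing it to Gamma s cancels
    the prefactor s (s + 1) of the trapezoid terms.\<close>
  have G_eq: "G = s * (s + 1) * Gamma s"
  proof -
    have n1: "s \<notin> \<int>\<^sub>\<le>\<^sub>0" "s + 1 \<notin> \<int>\<^sub>\<le>\<^sub>0" using s by (auto elim!: nonpos_Ints_cases)
    have "Gamma (s + 1 + 1) = (s + 1) * (s * Gamma s)"
      using Gamma_plus1[of s] Gamma_plus1[of "s + 1"] n1 by simp
    thus ?thesis by (simp add: G_def add.assoc)
  qed
  have Gs: "Gamma s \<noteq> 0" using G G_eq by auto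
  have "2 * (2 * pi) powr (-s) * cos (pi * s / 2) * Gamma s * (s * (s + 1) / (2 * G) * (B * Z)) = Z"
  proof -
    have "(2 * pi) powr (-s) * ((2 * pi) powr (s - 1) * (2 * pi)) = 1"
    proof -
      have "(2 * pi) powr (s - 1) * (2 * pi) = (2 * pi) powr s"
        using powr_mult_base[of "2 * pi" "s - 1"] by (simp add: mult.commute)
      thus ?thesis by (simp add: powr_minus)
    qed
    hence P: "(2 * pi) powr (-s) * (2 * pi) powr (s - 1) * (2 * pi) = 1" by simp
    have "2 * (2 * pi) powr (-s) * cos (pi * s / 2) * Gamma s * (s * (s + 1) / (2 * G) * (B * Z)) =
       ((2 * pi) powr (-s) * (2 * pi) powr (s - 1) * (2 * pi)) * Z"
      using s Gs cpos unfolding G_eq B_def by (simp add: divide_simps)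
    thus ?thesis unfolding P by simp
  qed
  hence "zeta_chi (of_real s) * zeta_strip (of_real s) = of_real Z"
    unfolding chi zs of_real_mult[symmetric] by simp
  with z1s show ?thesis by simp
qed

text \<open>Euler's reflection formula together with sin (\<pi> s) = 2 sin (\<pi> s / 2) cos (\<pi>
  s / 2). It inverts the functional equation, so that \<zeta> on the left is expressed by the factor
  at 1 - s, where \<open>zeta_chi\<close> is known to be holomorphic.\<close>

lemma zeta_chi_mult_reflect:
  assumes s: "s \<notin> \<int>"
  shows "zeta_chi s * zeta_chi (1 - s) = 1"
proof -
  define c d where "c = cos (of_real pi * s / 2)" and "d = sin (of_real pi * s / 2)"
  have sn: "sin (of_real pi * s) \<noteq> 0"
  proof
    assume "sin (of_real pi * s) = 0"
    then obtain m :: int where "of_real pi * s = of_real (m * pi)" by (auto simp: sin_eq_0)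
    hence "s = of_int m" by simp
    thus False using s by auto
  qed
  have sd: "sin (of_real pi * s) = 2 * d * c"
    using sin_double[of "of_real pi * s / 2"] by (simp add: c_def d_def)
  have c1: "cos (of_real pi * (1 - s) / 2) = d"
  proof -
    have "of_real pi * (1 - s) / 2 = of_real pi / 2 - of_real pi * s / 2" by (simp add: field_simps)
    thus ?thesis by (simp only: d_def sin_cos_eq)
  qed
  have p: "complex_of_real (2 * pi) powr (- s) * of_real (2 * pi) powr (- (1 - s)) = 1 / of_real (2 * pi)"
  proof -
    have e: "- s + - (1 - s) = - 1" by simp
    have "complex_of_real (2 * pi) powr (- s) * of_real (2 * pi) powr (- (1 - s)) = of_real (2 * pi) powr (- 1)"
      unfolding powr_add[symmetric] e ..
    also have "\<dots> = inverse (of_real (2 * pi) powr 1)" by (rule powr_minus)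
    also have "\<dots> = 1 / of_real (2 * pi)" by (simp only: powr_to_1 inverse_eq_divide)
    finally show ?thesis .
  qed
  have "zeta_chi s * zeta_chi (1 - s) = 4 * (complex_of_real (2 * pi) powr (- s) * of_real (2 * pi) powr (- (1 - s))) * (c * d) * (Gamma s * Gamma (1 - s))"
    unfolding zeta_chi_def c1 by (simp add: c_def mult_ac)
  also have "\<dots> = 1"
    unfolding p Gamma_reflection_complex sd using sn unfolding sd by (simp add: divide_simps)
  finally show ?thesis .
qed

lemma holomorphic_on_compose_reflect:
  assumes "f holomorphic_on T" "\<And>s. s \<in> A \<Longrightarrow> 1 - s \<in> T"
  shows "(\<lambda>s. f (1 - s)) holomorphic_on A"
proof -
  have "(f \<circ> (\<lambda>s. 1 - s)) holomorphic_on A"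
    by (rule holomorphic_on_compose_gen[OF _ assms(1)]) (use assms(2) in \<open>auto intro!: holomorphic_intros\<close>)
  thus ?thesis by (simp add: o_def)
qed

text \<open>Both sides are holomorphic in the strip and agree on the real interval (-1, 0), which
  accumulates at -1/2.\<close>

lemma zeta_strip_functional_equation:
  assumes s: "-1 < Re s" "Re s < 0"
  shows "zeta_strip s = zeta_chi (1 - s) * zeta_strip (1 - s)"
proof -
  define S where "S = {s. -1 < Re s \<and> Re s < 0}"
  define x0 where "x0 = complex_of_real (-1/2)"
  have "zeta_strip s - zeta_chi (1 - s) * zeta_strip (1 - s) = 0"
  proof (rule analytic_continuation[of "\<lambda>s. zeta_strip s - zeta_chi (1 - s) * zeta_strip (1 - s)" S "of_real ` {-1<..<0}" x0])
    have "zeta_strip holomorphic_on S"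
      by (rule holomorphic_on_subset[OF zeta_strip_holomorphic]) (auto simp: S_def)
    moreover have "(\<lambda>s. zeta_chi (1 - s)) holomorphic_on S"
      by (rule holomorphic_on_compose_reflect[OF zeta_chi_holomorphic]) (auto simp: S_def)
    moreover have "(\<lambda>s. zeta_strip (1 - s)) holomorphic_on S"
      by (rule holomorphic_on_compose_reflect[OF zeta_strip_holomorphic]) (auto simp: S_def)
    ultimately show "(\<lambda>s. zeta_strip s - zeta_chi (1 - s) * zeta_strip (1 - s)) holomorphic_on S"
      by (intro holomorphic_intros)
    have S_eq: "S = {s. Re s > -1} \<inter> {s. Re s < 0}" by (auto simp: S_def)
    show "open S" unfolding S_eq by (intro open_Int open_halfspace_Re_gt open_halfspace_Re_lt)
    show "connected S" unfolding S_eq 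
      by (intro convex_connected convex_Int convex_halfspace_Re_gt convex_halfspace_Re_lt)
    show "x0 \<in> S" by (simp add: S_def x0_def)
    show "x0 islimpt of_real ` {-1<..<0}" unfolding islimpt_approachable
    proof (intro allI impI)
      fix e :: real assume e: "e > 0"
      define d where "d = min (e / 2) (1 / 4)"
      have d: "d > 0" "d < e" "d < 1 / 2" using e by (auto simp: d_def)
      show "\<exists>x'\<in>of_real ` {-1<..<0}. x' \<noteq> x0 \<and> dist x' x0 < e"
      proof (intro bexI[of _ "complex_of_real (-1/2 + d)"] conjI)
        show "complex_of_real (- 1 / 2 + d) \<noteq> x0" using d unfolding x0_def of_real_eq_iff by simp
        have "dist (complex_of_real (- 1 / 2 + d)) x0 = \<bar>d\<bar>" 
          unfolding x0_def dist_of_real by (simp add: dist_real_def)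
        thus "dist (complex_of_real (- 1 / 2 + d)) x0 < e" using d by simp
        show "complex_of_real (- 1 / 2 + d) \<in> of_real ` {-1<..<0}" using d by (intro imageI) auto
      qed
    qed
    show "zeta_strip z - zeta_chi (1 - z) * zeta_strip (1 - z) = 0" if z: "z \<in> of_real ` {-1<..<0}" for z
    proof -
      obtain x where x: "z = of_real x" "-1 < x" "x < 0" using z by auto
      have "z \<notin> \<int>"
      proof
        assume "z \<in> \<int>"
        then obtain m :: int where "x = of_int m" using x 
          by (metis Ints_cases of_real_eq_iff of_real_of_int_eq)
        hence "m < 0" "-1 < m" using x by simp_all
        thus False by linarith
      qed
      hence "zeta_chi (1 - z) * zeta_chi z = 1" using zeta_chi_mult_reflect[of z] by (simp add: mult.commute)
      moreover have "zeta_strip (1 - z) = zeta_chi z * zeta_strip z"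
        using zeta_strip_functional_equation_real[of x] x by simp
      ultimately show ?thesis by (simp add: mult.assoc[symmetric])
    qed
  qed (use s in \<open>auto simp: S_def\<close>)
  thus ?thesis by simp
qed

section \<open>Continuation to the punctured plane and identification with
  \<open>zeta\<close>\<close>

text \<open>The last two branches agree on the strip -1 < Re s < 0, so the function is holomorphic
  across the seam. The value at 1 is the one prescribed in the description of
  \<open>zeta\<close>.\<close>

definition zeta_glued :: "complex \<Rightarrow> complex" where
  "zeta_glued s = (if s = 1 then 0 else if Re s > -1 then zeta_strip s else zeta_chi (1 - s) * zeta_strip (1 - s))"

lemma zeta_glued_left: "Re s < 0 \<Longrightarrow> zeta_glued s = zeta_chi (1 - s) * zeta_strip (1 - s)"
  using zeta_strip_functional_equation[of s] by (auto simp: zeta_glued_def)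

lemma zeta_glued_holomorphic: "zeta_glued holomorphic_on - {1}"
proof -
  define S1 where "S1 = {s. Re s > -1} - {1::complex}"
  define S2 where "S2 = {s. Re s < 0}"
  have "zeta_glued holomorphic_on S1"
    by (rule holomorphic_transform[OF zeta_strip_holomorphic[folded S1_def]]) (auto simp: zeta_glued_def S1_def)
  moreover have "zeta_glued holomorphic_on S2"
  proof (rule holomorphic_transform)
    have "(\<lambda>s. zeta_chi (1 - s)) holomorphic_on S2"
      by (rule holomorphic_on_compose_reflect[OF zeta_chi_holomorphic]) (auto simp: S2_def)
    moreover have "(\<lambda>s. zeta_strip (1 - s)) holomorphic_on S2"
      by (rule holomorphic_on_compose_reflect[OF zeta_strip_holomorphic]) (auto simp: S2_def)
    ultimately show "(\<lambda>s. zeta_chi (1 - s) * zeta_strip (1 - s)) holomorphic_on S2"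
      by (intro holomorphic_intros)
  qed (auto simp: S2_def zeta_glued_left)
  moreover have "open S1" unfolding S1_def by (intro open_Diff open_halfspace_Re_gt) auto
  moreover have "open S2" unfolding S2_def by (intro open_halfspace_Re_lt)
  ultimately have "zeta_glued holomorphic_on (S1 \<union> S2)" by (intro holomorphic_on_Un) auto
  moreover have "S1 \<union> S2 = - {1}" by (auto simp: S1_def S2_def)
  ultimately show ?thesis by simp
qed

lemma holomorphic_eq_of_eq_halfplane:
  assumes "f holomorphic_on - {1}" "g holomorphic_on - {1}" "\<And>s. Re s > 1 \<Longrightarrow> f s = g s" "s \<noteq> (1::complex)"
  shows "f s = g s"
proof (rule analytic_continuation_open[of "{s. Re s > 1}" "- {1}" f g s])
  have "complex_of_real 2 \<in> {s. Re s > 1}" by simp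
  thus "{s. Re s > 1} \<noteq> {}" by blast
  show "connected (- {1::complex})" by (rule connected_punctured_universe) simp
qed (use assms in \<open>auto intro: open_halfspace_Re_gt\<close>)

text \<open>This discharges the definite description: \<open>zeta_glued\<close> is a witness, and
  the identity theorem on the connected punctured plane gives uniqueness.\<close>

lemma zeta_eq_glued: "zeta = zeta_glued"
  unfolding zeta_def
proof (rule the_equality)
  have d: "zeta_glued s = (\<Sum>n. 1 / of_nat (Suc n) powr s)" if "Re s > 1" for s
    using zeta_strip_eq_dirichlet[OF that] that by (auto simp: zeta_glued_def sums_iff)
  thus "zeta_glued holomorphic_on - {1} \<and> (\<forall>s. 1 < Re s \<longrightarrow> zeta_glued s = (\<Sum>n. 1 / of_nat (Suc n) powr s)) \<and> zeta_glued 1 = 0"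
    using zeta_glued_holomorphic by (auto simp: zeta_glued_def)
  fix f assume f: "f holomorphic_on - {1} \<and> (\<forall>s. 1 < Re s \<longrightarrow> f s = (\<Sum>n. 1 / of_nat (Suc n) powr s)) \<and> f 1 = 0"
  show "f = zeta_glued"
  proof
    fix s show "f s = zeta_glued s"
      using holomorphic_eq_of_eq_halfplane[OF _ zeta_glued_holomorphic, of f s] f d
      by (cases "s = 1") (auto simp: zeta_glued_def)
  qed
qed

lemma zeta_holomorphic: "zeta holomorphic_on - {1}"
  unfolding zeta_eq_glued by (rule zeta_glued_holomorphic)

lemma zeta_eq_strip: "Re s > -1 \<Longrightarrow> s \<noteq> 1 \<Longrightarrow> zeta s = zeta_strip s"
  by (simp add: zeta_eq_glued zeta_glued_def)

lemma zeta_sums: "Re s > 1 \<Longrightarrow> (\<lambda>n. 1 / of_nat (Suc n) powr s) sums zeta s"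
  using zeta_strip_eq_dirichlet[of s] zeta_eq_strip[of s] by fastforce

text \<open>For Re s > 1 the point 1 - s lies in the region where \<open>zeta_glued\<close> is given
  by this very formula; the identity theorem carries it through the critical strip.\<close>

lemma zeta_functional_equation:
  assumes "Re s > 0" "s \<noteq> 1"
  shows "zeta (1 - s) = zeta_chi s * zeta s"
proof (rule analytic_continuation_open[of "{s. Re s > 1}" "{s. Re s > 0} - {1}" "\<lambda>s. zeta (1 - s)" "\<lambda>s. zeta_chi s * zeta s" s])
  have "complex_of_real 2 \<in> {s. Re s > 1}" by simp
  thus "{s. Re s > 1} \<noteq> {}" by blast
  show "open ({s. Re s > 0} - {1::complex})" by (intro open_Diff open_halfspace_Re_gt) auto
  show "connected ({s. Re s > 0} - {1::complex})"
    by (intro connected_open_delete convex_connected convex_halfspace_Re_gt open_halfspace_Re_gt) auto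
  show "(\<lambda>s. zeta (1 - s)) holomorphic_on {s. Re s > 0} - {1}"
    by (rule holomorphic_on_compose_reflect[OF zeta_holomorphic]) auto
  show "(\<lambda>s. zeta_chi s * zeta s) holomorphic_on {s. Re s > 0} - {1}"
    by (intro holomorphic_intros holomorphic_on_subset[OF zeta_holomorphic] holomorphic_on_subset[OF zeta_chi_holomorphic]) auto
  show "zeta (1 - s) = zeta_chi s * zeta s" if "s \<in> {s. Re s > 1}" for s
    using that zeta_glued_left[of "1 - s"] by (auto simp: zeta_eq_glued zeta_glued_def)
qed (use assms in \<open>auto intro: open_halfspace_Re_gt\<close>)

text \<open>The Dirichlet series has real coefficients. Combined with s to 1 - s this yields a
  reflection in the line Re s = 1/2 that preserves the upper half-plane.\<close>

lemma zeta_cnj: "zeta (cnj s) = cnj (zeta s)"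
proof (cases "s = 1")
  case True
  thus ?thesis by (simp add: zeta_eq_glued zeta_glued_def)
next
  case False
  have "(cnj \<circ> zeta \<circ> cnj) s = zeta s"
  proof (rule holomorphic_eq_of_eq_halfplane[OF _ zeta_holomorphic _ False])
    have "zeta holomorphic_on cnj ` (- {1})"
      by (rule holomorphic_on_subset[OF zeta_holomorphic]) auto
    thus "cnj \<circ> zeta \<circ> cnj holomorphic_on - {1}" by (rule holomorphic_on_compose_cnj_cnj) auto
    fix s :: complex assume s: "Re s > 1"
    have "(\<lambda>n. cnj (1 / of_nat (Suc n) powr (cnj s))) sums cnj (zeta (cnj s))"
      unfolding sums_cnj using zeta_sums[of "cnj s"] s by simp
    moreover have "cnj (1 / of_nat (Suc n) powr (cnj s)) = 1 / of_nat (Suc n) powr s" for n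
      by (simp add: powr_def cnj_Ln exp_cnj del: of_nat_Suc)
    ultimately have "(\<lambda>n. 1 / of_nat (Suc n) powr s) sums cnj (zeta (cnj s))" by simp
    thus "(cnj \<circ> zeta \<circ> cnj) s = zeta s" using zeta_sums[OF s] by (auto simp: sums_iff)
  qed
  thus ?thesis by (metis comp_apply complex_cnj_cnj)
qed

section \<open>Regions without zeros\<close>

text \<open>The term for 2 contributes 1/4, and the squares from 3 on telescope to at most 1/2. A
  bound below 1 keeps \<zeta> away from 0 and inside the right half-plane.\<close>

lemma norm_zeta_minus_1_le:
  assumes s: "Re s \<ge> 2"
  shows "norm (zeta s - 1) \<le> 3 / 4"
proof -
  have "(\<lambda>n. 1 / of_nat (Suc n) powr s) sums zeta s" using zeta_sums[of s] s by simp
  hence "(\<lambda>n. 1 / of_nat (Suc (Suc n)) powr s) sums (zeta s - 1)"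
    by (subst sums_Suc_iff) simp
  hence "(\<lambda>N. norm (\<Sum>n<N. 1 / of_nat (Suc (Suc n)) powr s)) \<longlonglongrightarrow> norm (zeta s - 1)"
    unfolding sums_def by (rule tendsto_norm)
  moreover have "norm (\<Sum>n<N. 1 / of_nat (Suc (Suc n)) powr s) \<le> 3 / 4" for N
  proof -
    have t: "norm (1 / of_nat (Suc (Suc n)) powr s) \<le> 1 / real (Suc (Suc n)) ^ 2" for n
    proof -
      have "norm (of_nat (Suc (Suc n)) powr s) = real (Suc (Suc n)) powr (Re s)"
        by (subst norm_powr_real_powr) (auto simp del: of_nat_Suc)
      moreover have "real (Suc (Suc n)) ^ 2 \<le> real (Suc (Suc n)) powr (Re s)"
        using powr_mono[of 2 "Re s" "real (Suc (Suc n))"] s by (simp add: powr_numeral del: of_nat_Suc) 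
      ultimately show ?thesis unfolding norm_divide
        by (intro frac_le) (auto simp del: of_nat_Suc)
    qed
    show ?thesis
    proof (cases N)
      case (Suc M)
      have "norm (\<Sum>n<Suc M. 1 / of_nat (Suc (Suc n)) powr s) \<le> 3 / 4 - 1 / (real M + 2)"
      proof (induction M)
        case 0
        show ?case using t[of 0] by simp
      next
        case (Suc M)
        have "1 / real (Suc (Suc (Suc M))) ^ 2 \<le> 1 / (real M + 2) - 1 / (real M + 3)"
          by (simp add: divide_simps power2_eq_square) (simp add: algebra_simps)
        thus ?case using Suc t[of "Suc M"] norm_triangle_ineq[of "\<Sum>n<Suc M. 1 / of_nat (Suc (Suc n)) powr s" "1 / of_nat (Suc (Suc (Suc M))) powr s"]
          unfolding sum.lessThan_Suc[of _ "Suc M"] by (simp add: add.commute)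
      qed
      moreover have "1 / (real M + 2) \<ge> 0" by simp
      ultimately show ?thesis unfolding Suc by linarith
    qed auto
  qed
  ultimately show ?thesis by (intro LIMSEQ_le_const2) auto
qed

lemma zeta_nonzero_right: "Re s \<ge> 2 \<Longrightarrow> zeta s \<noteq> 0"
  using norm_zeta_minus_1_le[of s] by auto

lemma zeta_eq_0_reflect:
  assumes "Re s > 0" "Im s \<noteq> 0"
  shows "zeta (1 - s) = 0 \<longleftrightarrow> zeta s = 0"
proof -
  have "s \<noteq> 1" using assms by auto
  thus ?thesis using zeta_functional_equation[of s] zeta_chi_nonzero[of s] assms by simp
qed

text \<open>At a zero \<open>zeta_strip_approx\<close> bounds |s + 1| / (2 |s - 1|), the modulus of
  the leading part. Cancelling |s + 1| leaves 4 (Re s + 1) \<le> |s| |s - 1|; but the left side is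
  at least 4 and the right side at most the square root of 10.\<close>

lemma zeta_nonzero_low:
  assumes s: "0 \<le> Re s" "Re s \<le> 2" "Im s \<noteq> 0" "\<bar>Im s\<bar> \<le> 1"
  shows "zeta s \<noteq> 0"
proof
  assume z: "zeta s = 0"
  have s1: "s \<noteq> 1" using s by auto
  have "norm (zeta_strip s - (1 / (s - 1) + 1 / 2)) \<le> norm s * norm (s + 1) / (8 * (Re s + 1))"
    using s s1 by (intro zeta_strip_approx) auto
  hence "norm (1 / (s - 1) + 1 / 2) \<le> norm s * norm (s + 1) / (8 * (Re s + 1))"
  proof -
    have "zeta_strip s = 0" using z zeta_eq_strip[of s] s s1 by simp
    thus ?thesis using \<open>norm (zeta_strip s - (1 / (s - 1) + 1 / 2)) \<le> _\<close> by (simp only: diff_0 norm_minus_cancel)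
  qed
  also have "1 / (s - 1) + 1 / 2 = (s + 1) / (2 * (s - 1))" using s1 by (simp add: divide_simps) (simp add: algebra_simps)
  finally have "norm (s + 1) / (2 * norm (s - 1)) \<le> norm s * norm (s + 1) / (8 * (Re s + 1))"
    by (simp only: norm_divide norm_mult norm_numeral)
  moreover have "norm (s + 1) > 0" using s by (auto simp: complex_eq_iff)
  moreover have "norm (s - 1) > 0" using s1 by simp
  ultimately have "4 * (Re s + 1) \<le> norm s * norm (s - 1)"
    using s by (simp add: divide_simps split: if_splits)
  hence "(4 * (Re s + 1)) ^ 2 \<le> (norm s * norm (s - 1)) ^ 2"
    using s by (intro power_mono) auto
  also have "(norm s * norm (s - 1)) ^ 2 = (Re s ^ 2 + Im s ^ 2) * ((Re s - 1) ^ 2 + Im s ^ 2)"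
    by (simp add: power_mult_distrib cmod_power2)
  also have "\<dots> \<le> 5 * 2"
  proof (intro mult_mono)
    have i: "Im s ^ 2 \<le> 1" using s by (simp add: abs_square_le_1)
    have "Re s ^ 2 \<le> 2 ^ 2" using s by (intro power_mono) auto
    thus "Re s ^ 2 + Im s ^ 2 \<le> 5" using i by simp
    have "(Re s - 1) ^ 2 \<le> 1" using s by (simp add: abs_square_le_1)
    thus "(Re s - 1) ^ 2 + Im s ^ 2 \<le> 2" using i by simp
  qed auto
  finally have "(4 * (Re s + 1)) ^ 2 \<le> 10" by simp
  moreover have "(4 * (Re s + 1)) ^ 2 \<ge> 4 ^ 2" using s by (intro power_mono) auto
  ultimately show False by simp
qed

text \<open>The right bound comes from the Dirichlet series and the left one from its reflection.
  For small height a zero with Re s < 0 is reflected into the range of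
  \<open>zeta_nonzero_low\<close>.\<close>

lemma nontrivial_zeros_region:
  assumes "zeta s = 0" "Im s \<noteq> 0"
  shows "-1 < Re s" "Re s < 2" "\<bar>Im s\<bar> > 1"
proof -
  show 2: "Re s < 2" using zeta_nonzero_right[of s] assms by force
  show 1: "-1 < Re s"
  proof (rule ccontr)
    assume "\<not> -1 < Re s"
    hence "Re (1 - s) \<ge> 2" by simp
    hence "zeta (1 - s) \<noteq> 0" by (rule zeta_nonzero_right)
    thus False using zeta_eq_0_reflect[of "1 - s"] \<open>\<not> -1 < Re s\<close> assms by simp
  qed
  show "\<bar>Im s\<bar> > 1"
  proof (rule ccontr)
    assume le: "\<not> \<bar>Im s\<bar> > 1"
    show False
    proof (cases "Re s \<ge> 0")
      case True
      thus ?thesis using zeta_nonzero_low[of s] le assms 2 by auto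
    next
      case False
      hence "zeta (1 - s) \<noteq> 0" using zeta_nonzero_low[of "1 - s"] le assms 1 by auto
      thus ?thesis using zeta_eq_0_reflect[of "1 - s"] False assms by simp
    qed
  qed
qed

section \<open>Counting zeros\<close>

lemma Im_log_deriv_integral_bound:
  fixes r r1 R :: real
  assumes r: "0 < r" "r < r1" "r1 < R"
    and seg: "closed_segment a b \<subseteq> cball c r"
    and U: "open U" "cball c R \<subseteq> U" 
    and f: "f holomorphic_on U" 
    and fc: "f c \<noteq> 0"
    and bd: "\<And>z. dist c z = R \<Longrightarrow> norm (f z) \<le> exp m * norm (f c)"
    and nz: "\<And>z. z \<in> closed_segment a b \<Longrightarrow> f z \<noteq> 0"
    and m: "m \<le> real n * ln (R / r1)"
  shows "\<bar>Im (contour_integral (linepath a b) (\<lambda>z. deriv f z / f z))\<bar>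
           \<le> 4 * (m + 1) * r / (r1 - r) + real n * (2 * pi + norm (b - a) * (r1 / (R * (R - r1))))"
proof -
  define g where "g = (\<lambda>z. f (c + z))"
  have gz: "g z = f (c + z)" for z by (simp add: g_def)
  define V where "V = (\<lambda>z. z - c) ` U"
  have V: "z \<in> V \<longleftrightarrow> c + z \<in> U" for z unfolding V_def by (force simp: image_iff)
  have oV: "open V" unfolding V_def using U(1) by (rule open_translation_subtract)
  have gV: "g holomorphic_on V"
  proof -
    have "(f \<circ> (\<lambda>z. c + z)) holomorphic_on V"
      by (rule holomorphic_on_compose_gen[OF _ f]) (auto intro!: holomorphic_intros simp: V)
    thus ?thesis by (simp add: g_def o_def)
  qed
  have cz: "c + z \<in> closed_segment a b" if "z \<in> closed_segment (a - c) (b - c)" for z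
    using that closed_segment_translation_eq[of c z "a - c" "b - c"] by simp
  have dg: "deriv g z = deriv f (c + z)" if "z \<in> V" for z
  proof -
    have "(f has_field_derivative deriv f (c + z)) (at (c + z))"
      using f U(1) that V holomorphic_derivI by blast
    moreover have "((\<lambda>z. c + z) has_field_derivative 1) (at z)" by (auto intro!: derivative_eq_intros)
    ultimately have "((\<lambda>z. f (c + z)) has_field_derivative deriv f (c + z) * 1) (at z)"
      by (rule DERIV_chain2[where f = f and g = "\<lambda>z. c + z"])
    hence "(g has_field_derivative deriv f (c + z)) (at z)" by (simp add: g_def)
    thus ?thesis by (rule DERIV_imp_deriv)
  qed
  have segV: "z \<in> V" if "z \<in> closed_segment (a - c) (b - c)" for z
    using cz[OF that] seg U(2) r unfolding V by force
  have "\<bar>Im (contour_integral (linepath (a - c) (b - c)) (\<lambda>z. deriv g z / g z))\<bar>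
           \<le> 4 * (m + 1) * r / (r1 - r) + real n * (2 * pi + norm ((b - c) - (a - c)) * (r1 / (R * (R - r1))))"
  proof (rule Im_log_deriv_integral_aux[OF r _ oV _ gV _ _ _ m])
    show "closed_segment (a - c) (b - c) \<subseteq> cball 0 r"
    proof
      fix z assume "z \<in> closed_segment (a - c) (b - c)"
      hence "c + z \<in> cball c r" using cz seg by blast
      thus "z \<in> cball 0 r" by (simp add: dist_norm)
    qed
    show "cball 0 R \<subseteq> V"
    proof
      fix z :: complex assume "z \<in> cball 0 R"
      hence "c + z \<in> cball c R" by (simp add: dist_norm)
      thus "z \<in> V" using U(2) V by blast
    qed
    show "g 0 \<noteq> 0" using fc by (simp add: g_def)
    show "norm (g z) \<le> exp m * norm (g 0)" if "norm z = R" for z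
      using bd[of "c + z"] that by (simp add: g_def dist_norm)
    show "g z \<noteq> 0" if "z \<in> closed_segment (a - c) (b - c)" for z
      using nz[OF cz[OF that]] by (simp add: g_def)
  qed
  also have "contour_integral (linepath (a - c) (b - c)) (\<lambda>z. deriv g z / g z) = contour_integral (linepath (a - c) (b - c)) (\<lambda>z. deriv f (c + z) / f (c + z))"
    by (rule contour_integral_cong) (auto simp: dg segV gz)
  also have "\<dots> = contour_integral (linepath a b) (\<lambda>z. deriv f z / f z)"
  proof -
    have "c + linepath (a - c) (b - c) x = linepath a b x" for x
      by (simp add: linepath_def scaleR_conv_of_real algebra_simps)
    hence "(\<lambda>z. deriv f (c + z) / f (c + z)) (linepath (a - c) (b - c) x) = (\<lambda>z. deriv f z / f z) (linepath a b x)" for x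
      by simp
    thus ?thesis by (simp add: contour_integral_integral)
  qed
  finally show ?thesis by simp
qed

text \<open>The constant is 3 + 2 + 7 + 4, for \<open>Digamma_approx\<close>, the argument of s, ln
  (2 \<pi>) and the tangent. The bound serves only on a horizontal segment of length 3/2.\<close>

lemma norm_zeta_chi_log_deriv_le:
  assumes s: "Re s > 0" "Im s \<ge> 1"
  shows "norm (zeta_chi_log_deriv s) \<le> ln (norm s) + 16"
proof -
  have "3 / Im s \<le> 3 / 1" using s by (intro divide_left_mono) auto
  hence 1: "norm (Digamma s - Ln s) \<le> 3" using Digamma_approx[OF s] by linarith
  have s0: "s \<noteq> 0" using s by auto
  have "norm s \<ge> 1" using abs_Im_le_cmod[of s] s by linarith
  hence lns: "ln (norm s) \<ge> 0" by simp
  have "\<bar>Im (Ln s)\<bar> \<le> pi / 2" using s Re_Ln_pos_le[of s] by fastforce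
  moreover have "Re (Ln s) = ln (norm s)" using s0 by simp
  ultimately have 2: "norm (Ln s) \<le> ln (norm s) + 2" 
    using cmod_le[of "Ln s"] lns pi_less_4 by linarith
  have "norm (tan (of_real pi * s / 2)) \<le> 2"
  proof (rule norm_tan_le)
    have "pi / 2 * 1 \<le> pi / 2 * Im s" using s by (intro mult_left_mono) auto
    moreover have "Im (of_real pi * s / 2) = pi / 2 * Im s" by simp
    ultimately show "Im (of_real pi * s / 2) \<ge> 1" using pi_ge_two by linarith
  qed
  hence "norm (of_real (pi / 2) * tan (of_real pi * s / 2)) \<le> pi / 2 * 2"
    unfolding norm_mult by (intro mult_mono) auto
  hence 3: "norm (of_real (pi / 2) * tan (of_real pi * s / 2)) \<le> 4" using pi_less_4 by linarith
  have "ln (2 * pi) \<le> 2 * pi - 1" by (rule ln_le_minus_one) simp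
  moreover have "ln (2 * pi) \<ge> 0" using pi_ge_two by (intro ln_ge_zero) linarith
  ultimately have 4: "norm (complex_of_real (ln (2 * pi))) \<le> 7" using pi_less_4 by simp
  have "zeta_chi_log_deriv s = (Digamma s - Ln s) + Ln s - of_real (ln (2 * pi)) - of_real (pi / 2) * tan (of_real pi * s / 2)"
    by (simp add: zeta_chi_log_deriv_def)
  also have "norm \<dots> \<le> norm (Digamma s - Ln s) + norm (Ln s) + norm (complex_of_real (ln (2 * pi))) + norm (of_real (pi / 2) * tan (of_real pi * s / 2))"
    by (intro norm_triangle_le_diff add_mono order_refl norm_triangle_ineq)
  finally show ?thesis using 1 2 3 4 by linarith
qed

section \<open>The logarithmic derivative and its reflection\<close>

definition zeta_log_deriv :: "complex \<Rightarrow> complex" where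
  "zeta_log_deriv s = deriv zeta s / zeta s"

lemma zeta_has_field_derivative: "s \<noteq> 1 \<Longrightarrow> (zeta has_field_derivative deriv zeta s) (at s)"
  using holomorphic_derivI[OF zeta_holomorphic, of s] by auto

lemma zeta_log_deriv_cnj:
  assumes "s \<noteq> 1"
  shows "zeta_log_deriv (cnj s) = cnj (zeta_log_deriv s)"
proof -
  have "(cnj \<circ> zeta \<circ> cnj has_field_derivative cnj (deriv zeta s)) (at (cnj s))"
    using zeta_has_field_derivative[OF assms] by (intro has_field_derivative_cnj_cnj) auto
  moreover have "cnj \<circ> zeta \<circ> cnj = zeta" by (auto simp: zeta_cnj)
  ultimately have "deriv zeta (cnj s) = cnj (deriv zeta s)" by (metis DERIV_imp_deriv)
  thus ?thesis by (simp add: zeta_log_deriv_def zeta_cnj)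
qed

lemma zeta_log_deriv_reflect:
  assumes s: "Re s > 0" "Im s \<noteq> 0" "zeta s \<noteq> 0"
  shows "zeta_log_deriv (1 - s) = - (zeta_chi_log_deriv s + zeta_log_deriv s)"
proof -
  have s1: "s \<noteq> 1" "1 - s \<noteq> 1" using s by auto
  have chi0: "zeta_chi s \<noteq> 0" using zeta_chi_nonzero s by auto
  have "((\<lambda>w. zeta (1 - w)) has_field_derivative - deriv zeta (1 - s)) (at s)"
  proof -
    have "((\<lambda>w. 1 - w) has_field_derivative -1) (at s)" by (auto intro!: derivative_eq_intros)
    with zeta_has_field_derivative[OF s1(2)]
    have "((\<lambda>w. zeta (1 - w)) has_field_derivative deriv zeta (1 - s) * (-1)) (at s)"
      by (rule DERIV_chain2[where f = zeta and g = "\<lambda>w. 1 - w"])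
    thus ?thesis by simp
  qed
  moreover have "((\<lambda>w. zeta_chi w * zeta w) has_field_derivative 
      zeta_chi s * zeta_chi_log_deriv s * zeta s + deriv zeta s * zeta_chi s) (at s)"
    by (intro DERIV_mult deriv_zeta_chi zeta_has_field_derivative s s1)
  hence "((\<lambda>w. zeta (1 - w)) has_field_derivative 
      zeta_chi s * zeta_chi_log_deriv s * zeta s + deriv zeta s * zeta_chi s) (at s)"
  proof (rule has_field_derivative_transform_within_open)
    show "open ({s. Re s > 0} - {1::complex})" by (intro open_Diff open_halfspace_Re_gt) auto
  qed (use s s1 in \<open>auto simp: zeta_functional_equation\<close>)
  ultimately have "- deriv zeta (1 - s) = zeta_chi s * zeta_chi_log_deriv s * zeta s + deriv zeta s * zeta_chi s"
    by (rule DERIV_unique)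
  hence d: "deriv zeta (1 - s) = - (zeta_chi s * zeta_chi_log_deriv s * zeta s + deriv zeta s * zeta_chi s)"
    by (metis minus_minus)
  have "zeta (1 - s) = zeta_chi s * zeta s" using zeta_functional_equation s s1 by auto
  thus ?thesis using chi0 s(3) unfolding zeta_log_deriv_def d
    by (simp add: divide_simps) (simp add: algebra_simps)
qed

lemma zeta_log_deriv_holomorphic: "zeta_log_deriv holomorphic_on {s. s \<noteq> 1 \<and> zeta s \<noteq> 0}"
proof -
  have d: "deriv zeta holomorphic_on - {1}" by (rule holomorphic_deriv[OF zeta_holomorphic]) auto
  have "(\<lambda>s. deriv zeta s / zeta s) holomorphic_on {s. s \<noteq> 1 \<and> zeta s \<noteq> 0}"
    by (rule holomorphic_on_divide[OF holomorphic_on_subset[OF d] holomorphic_on_subset[OF zeta_holomorphic]]) auto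
  thus ?thesis by (simp add: zeta_log_deriv_def[abs_def])
qed

lemma continuous_on_zeta_log_deriv:
  assumes "\<And>s. s \<in> A \<Longrightarrow> Im s > 0 \<and> zeta s \<noteq> 0"
  shows "continuous_on A zeta_log_deriv"
proof -
  have "A \<subseteq> {s. s \<noteq> 1 \<and> zeta s \<noteq> 0}" using assms by force
  thus ?thesis using holomorphic_on_imp_continuous_on[OF zeta_log_deriv_holomorphic] continuous_on_subset by blast
qed

text \<open>The map s to 1 - cnj s reflects in the critical line and keeps the height. The minus
  sign of \<open>zeta_log_deriv_reflect\<close> cancels against the one from the reversed direction
  of the segment.\<close>

lemma contour_integral_zeta_log_deriv_reflect:
  assumes ab: "\<And>s. s \<in> closed_segment a b \<Longrightarrow> Re s > 0 \<and> Im s > 0 \<and> zeta s \<noteq> 0"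
  shows "contour_integral (linepath (1 - cnj a) (1 - cnj b)) zeta_log_deriv = 
         cnj (contour_integral (linepath a b) zeta_chi_log_deriv + contour_integral (linepath a b) zeta_log_deriv)"
proof -
  have c1: "zeta_log_deriv contour_integrable_on linepath a b"
    by (intro contour_integrable_continuous_linepath continuous_on_zeta_log_deriv) (use ab in auto)
  have c2: "zeta_chi_log_deriv contour_integrable_on linepath a b"
    by (intro contour_integrable_continuous_linepath holomorphic_on_imp_continuous_on 
          holomorphic_on_subset[OF zeta_chi_log_deriv_holomorphic]) (use ab in auto)
  define I where "I = contour_integral (linepath a b) zeta_chi_log_deriv + contour_integral (linepath a b) zeta_log_deriv"
  have "((\<lambda>s. zeta_chi_log_deriv s + zeta_log_deriv s) has_contour_integral I) (linepath a b)"
    unfolding I_def using c1 c2 by (intro has_contour_integral_add has_contour_integral_integral)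
  hence "((\<lambda>x. (zeta_chi_log_deriv (linepath a b x) + zeta_log_deriv (linepath a b x)) * (b - a)) has_integral I) {0..1}"
    by (simp add: has_contour_integral_linepath)
  hence "(cnj \<circ> (\<lambda>x. (zeta_chi_log_deriv (linepath a b x) + zeta_log_deriv (linepath a b x)) * (b - a)) has_integral cnj I) {0..1}"
    by (simp only: has_integral_cnj)
  hence "((\<lambda>x. zeta_log_deriv (linepath (1 - cnj a) (1 - cnj b) x) * ((1 - cnj b) - (1 - cnj a))) has_integral cnj I) {0..1}"
  proof (rule has_integral_eq[rotated])
    fix x :: real assume x: "x \<in> {0..1}"
    define s where "s = linepath a b x"
    have "s \<in> closed_segment a b" using x unfolding s_def by (rule linepath_in_path)
    hence s: "Re s > 0" "Im s > 0" "zeta s \<noteq> 0" using ab by auto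
    have "linepath (1 - cnj a) (1 - cnj b) x = cnj (1 - s)"
      by (simp add: s_def linepath_def scaleR_conv_of_real algebra_simps)
    hence e2: "zeta_log_deriv (linepath (1 - cnj a) (1 - cnj b) x) = cnj (- (zeta_chi_log_deriv s + zeta_log_deriv s))"
    proof -
      have "1 - s \<noteq> 1" using s by auto
      thus ?thesis using zeta_log_deriv_cnj[of "1 - s"] zeta_log_deriv_reflect[of s] s 
        \<open>linepath (1 - cnj a) (1 - cnj b) x = cnj (1 - s)\<close> by simp
    qed
    thus "(cnj \<circ> (\<lambda>x. (zeta_chi_log_deriv (linepath a b x) + zeta_log_deriv (linepath a b x)) * (b - a))) x =
          zeta_log_deriv (linepath (1 - cnj a) (1 - cnj b) x) * ((1 - cnj b) - (1 - cnj a))"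
      unfolding e2 o_def s_def[symmetric] by (simp add: algebra_simps)
  qed
  thus ?thesis unfolding I_def[symmetric] by (intro contour_integral_unique) (simp add: has_contour_integral_linepath)
qed

section \<open>Zeros below a height and the argument principle\<close>

lemma finite_zeta_zeros_below: "finite {\<rho>. \<rho> \<in> nontrivial_zeros \<and> 0 < Im \<rho> \<and> Im \<rho> < T}"
proof -
  define K where "K = cbox (Complex (-1) 1) (Complex 2 (max 1 T))"
  have "finite {z\<in>K. zeta z = 0}"
  proof (rule holomorphic_compact_finite_zeros[OF zeta_holomorphic])
    show "connected (- {1::complex})" by (rule connected_punctured_universe) simp
    show "K \<subseteq> - {1}" by (auto simp: K_def in_cbox_complex_iff)
    \<comment> \<open>If \<zeta> were constant, reflection would make the logarithmic derivative of
      the Gamma factor vanish on Re s = 2, against its logarithmic growth.\<close>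
    show "\<not> zeta constant_on - {1}"
    proof
      assume "zeta constant_on - {1}"
      then obtain c where c: "\<And>s. s \<noteq> 1 \<Longrightarrow> zeta s = c" by (auto simp: constant_on_def)
      have "zeta (Complex 2 1) \<noteq> 0" by (rule zeta_nonzero_right) simp
      hence c0: "c \<noteq> 0" using c[of "Complex 2 1"] by (auto simp: complex_eq_iff)
      have s: "zeta_log_deriv s = 0" if "s \<noteq> 1" for s
      proof -
        have "(zeta has_field_derivative 0) (at s)"
          by (rule has_field_derivative_transform_within_open[of "\<lambda>_. c" _ _ "- {1}"]) (use that c in auto)
        thus ?thesis by (simp add: zeta_log_deriv_def DERIV_imp_deriv)
      qed
      have "zeta_chi_log_deriv (Complex 2 t) = 0" if "t \<ge> 1" for t
      proof -
        have "Complex 2 t \<noteq> 1" "1 - Complex 2 t \<noteq> 1" using that by (auto simp: complex_eq_iff)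
        thus ?thesis using zeta_log_deriv_reflect[of "Complex 2 t"] zeta_nonzero_right[of "Complex 2 t"] that by (simp add: s)
      qed
      hence b: "\<bar>ln (t / (2 * pi))\<bar> \<le> 5 / t" if "t \<ge> 1" for t 
        using Re_zeta_chi_log_deriv_2[OF that] that by simp
      \<comment> \<open>Chosen so that ln (t / (2 \<pi>)) is 5, while the error bound 5 / t is at
        most 1.\<close>
      define t where "t = 2 * pi * exp 5"
      have "exp 5 \<ge> (1 + 5 :: real)" by (rule exp_ge_add_one_self)
      hence "t \<ge> 2 * pi * 6" unfolding t_def by (intro mult_left_mono) auto
      hence t: "t \<ge> 5" using pi_ge_two by linarith
      have "\<bar>ln (t / (2 * pi))\<bar> = 5" by (simp add: t_def)
      moreover have "5 / t \<le> 5 / 5" using t by (intro divide_left_mono) auto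
      moreover have "\<bar>ln (t / (2 * pi))\<bar> \<le> 5 / t" by (rule b) (use t in simp)
      ultimately show False by simp
    qed
  qed (auto simp: K_def)
  thus ?thesis
    by (rule rev_finite_subset) 
       (auto simp: nontrivial_zeros_def K_def in_cbox_complex_iff dest: nontrivial_zeros_region)
qed

definition zeta_zero_count :: "real \<Rightarrow> real" where
  "zeta_zero_count T = (\<Sum>\<rho> | \<rho> \<in> nontrivial_zeros \<and> 0 < Im \<rho> \<and> Im \<rho> < T. real_of_int (zorder zeta \<rho>))"

lemma zeta_zero_count_argument_principle:
  assumes T: "T > 1" and nz: "\<And>\<rho>. \<rho> \<in> nontrivial_zeros \<Longrightarrow> Im \<rho> \<noteq> T"
  shows "contour_integral (rectpath (Complex (-1) 1) (Complex 2 T)) zeta_log_deriv = 2 * pi * \<i> * zeta_zero_count T"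
proof -
  define a b where "a = Complex (-1) 1" and "b = Complex 2 T"
  \<comment> \<open>An open box around the contour that avoids the pole at 1. It may contain further
    zeros between heights T and T + 1, but their winding number is 0; zeros below the lower edge do
    not exist.\<close>
  define S where "S = box (Complex (-2) (1/2)) (Complex 3 (T + 1))"
  have pz_eq: "{w\<in>S. zeta w = 0 \<or> w \<in> {}} = {\<rho>. \<rho> \<in> nontrivial_zeros \<and> 0 < Im \<rho> \<and> Im \<rho> < T + 1}"
    using nontrivial_zeros_region by (fastforce simp: S_def in_box_complex_iff nontrivial_zeros_def)
  have fin: "finite {w\<in>S. zeta w = 0 \<or> w \<in> {}}"
    unfolding pz_eq by (rule finite_zeta_zeros_below)
  have le: "Re a \<le> Re b" "Im a \<le> Im b" using T by (auto simp: a_def b_def)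
  have cS: "cbox a b \<subseteq> S" using T by (auto simp: a_def b_def S_def in_box_complex_iff in_cbox_complex_iff)
  have w: "winding_number (rectpath a b) p = (if Im p < T then 1 else 0)"
    if p: "p \<in> {\<rho>. \<rho> \<in> nontrivial_zeros \<and> 0 < Im \<rho> \<and> Im \<rho> < T + 1}" for p
  proof -
    have reg: "-1 < Re p" "Re p < 2" "Im p > 1" "Im p \<noteq> T"
      using p nz[of p] nontrivial_zeros_region[of p] by (auto simp: nontrivial_zeros_def)
    show ?thesis
    proof (cases "Im p < T")
      case True
      hence "p \<in> box a b" using reg by (auto simp: a_def b_def in_box_complex_iff)
      thus ?thesis using True by (simp add: winding_number_rectpath)
    next
      case False
      hence "p \<notin> cbox a b" using reg by (auto simp: a_def b_def in_cbox_complex_iff)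
      thus ?thesis using False le by (simp add: winding_number_rectpath_outside)
    qed
  qed
  have "contour_integral (rectpath a b) (\<lambda>x. deriv zeta x * 1 / zeta x) = 2 * pi * \<i> * 
    (\<Sum>p\<in>{w\<in>S. zeta w = 0 \<or> w \<in> {}}. winding_number (rectpath a b) p * 1 * zorder zeta p)"
  proof (rule argument_principle[where S = S and h = "\<lambda>_. 1" and poles = "{}"])
    show "path_image (rectpath a b) \<subseteq> S - {w \<in> S. zeta w = 0 \<or> w \<in> {}}"
    proof safe
      fix p assume p: "p \<in> path_image (rectpath a b)"
      thus "p \<in> S" using path_image_rectpath_subset_cbox[OF le] cS by blast
      assume "zeta p = 0" "p \<in> S"
      hence "p \<in> nontrivial_zeros" by (auto simp: nontrivial_zeros_def S_def in_box_complex_iff)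
      hence "-1 < Re p" "Re p < 2" "Im p \<noteq> T" "\<bar>Im p\<bar> > 1"
        using nontrivial_zeros_region[of p] nz[of p] by (auto simp: nontrivial_zeros_def)
      thus False using p le unfolding path_image_rectpath[OF le] by (auto simp: a_def b_def)
    qed
    show "\<forall>z. z \<notin> S \<longrightarrow> winding_number (rectpath a b) z = 0"
      using winding_number_rectpath_outside[OF le] cS by blast
    show "zeta holomorphic_on S - {}"
      by (rule holomorphic_on_subset[OF zeta_holomorphic]) (auto simp: S_def in_box_complex_iff)
    show "connected S" unfolding S_def by (intro convex_connected) auto
  qed (use fin in \<open>auto simp: S_def\<close>)
  also have "(\<lambda>x. deriv zeta x * 1 / zeta x) = zeta_log_deriv" by (simp add: zeta_log_deriv_def fun_eq_iff)
  also have "(\<Sum>p\<in>{w\<in>S. zeta w = 0 \<or> w \<in> {}}. winding_number (rectpath a b) p * 1 * of_int (zorder zeta p)) =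
     (\<Sum>p\<in>{\<rho>. \<rho> \<in> nontrivial_zeros \<and> 0 < Im \<rho> \<and> Im \<rho> < T + 1}. if Im p < T then of_int (zorder zeta p) else 0)"
    unfolding pz_eq by (intro sum.cong refl) (simp add: w)
  also have "\<dots> = (\<Sum>p\<in>{\<rho>. \<rho> \<in> nontrivial_zeros \<and> 0 < Im \<rho> \<and> Im \<rho> < T}. of_int (zorder zeta p))"
    by (rule sum.mono_neutral_cong_right[OF finite_zeta_zeros_below]) auto
  also have "\<dots> = complex_of_real (zeta_zero_count T)" by (simp add: zeta_zero_count_def)
  finally show ?thesis by (simp add: a_def b_def)
qed

text \<open>On Re s = 2 the values of \<zeta> lie in the right half-plane, so Ln (zeta s) is a
  primitive with argument at most \<pi> / 2 at each end.\<close>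

lemma Im_zeta_log_deriv_vertical:
  "\<bar>Im (contour_integral (linepath (Complex 2 1) (Complex 2 T)) zeta_log_deriv)\<bar> \<le> pi"
proof -
  have re: "Re s = 2" if "s \<in> closed_segment (Complex 2 1) (Complex 2 T)" for s
    using that by (auto simp: closed_segment_def complex_eq_iff algebra_simps)
  have pos: "Re (zeta s) > 0" if "Re s = 2" for s
    using norm_zeta_minus_1_le[of s] abs_Re_le_cmod[of "zeta s - 1"] that by auto
  have "(zeta_log_deriv has_contour_integral (Ln (zeta (pathfinish (linepath (Complex 2 1) (Complex 2 T)))) 
      - Ln (zeta (pathstart (linepath (Complex 2 1) (Complex 2 T)))))) (linepath (Complex 2 1) (Complex 2 T))"
  proof (rule contour_integral_primitive)
    fix s assume "s \<in> closed_segment (Complex 2 1) (Complex 2 T)"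
    hence s: "Re s = 2" by (rule re)
    hence s1: "s \<noteq> 1" by auto
    have "zeta s \<notin> \<real>\<^sub>\<le>\<^sub>0" using pos[OF s] by (auto simp: complex_nonpos_Reals_iff)
    hence "((\<lambda>s. Ln (zeta s)) has_field_derivative zeta_log_deriv s) (at s)"
      using zeta_has_field_derivative[OF s1] unfolding zeta_log_deriv_def 
      by (auto intro!: derivative_eq_intros simp: inverse_eq_divide)
    thus "((\<lambda>s. Ln (zeta s)) has_field_derivative zeta_log_deriv s) (at s within closed_segment (Complex 2 1) (Complex 2 T))"
      by (rule has_field_derivative_at_within)
  qed auto
  hence "contour_integral (linepath (Complex 2 1) (Complex 2 T)) zeta_log_deriv = Ln (zeta (Complex 2 T)) - Ln (zeta (Complex 2 1))"
    by (simp add: contour_integral_unique)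
  moreover have b: "\<bar>Im (Ln (zeta (Complex 2 t)))\<bar> \<le> pi / 2" for t
    using pos[of "Complex 2 t"] Re_Ln_pos_le[of "zeta (Complex 2 t)"] by fastforce
  ultimately show ?thesis using b[of T] b[of 1] by (simp add: abs_le_iff; linarith)
qed

text \<open>Along a vertical line ds = i dt, so the imaginary part is the integral of
  \<open>Re_zeta_chi_log_deriv_2\<close>. Integrating ln (t / (2 \<pi>)) gives the main term,
  integrating 5 / t gives 5 ln T, and 10 covers the lower limit t = 1.\<close>

lemma Im_zeta_chi_log_deriv_vertical:
  assumes T: "T > 1"
  shows "\<bar>Im (contour_integral (linepath (Complex 2 1) (Complex 2 T)) zeta_chi_log_deriv)
            - (T * ln (T / (2 * pi)) - T)\<bar> \<le> 5 * ln T + 10"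
proof -
  define E where "E = (\<lambda>t. Re (zeta_chi_log_deriv (Complex 2 t)))"
  define G where "G = (\<lambda>t. t * ln (t / (2 * pi)) - t)"
  have ch: "continuous_on {1..T} (\<lambda>t. zeta_chi_log_deriv (Complex 2 t))"
  proof (rule continuous_on_compose2[OF holomorphic_on_imp_continuous_on[OF zeta_chi_log_deriv_holomorphic]])
    show "continuous_on {1..T} (\<lambda>t. Complex 2 t)" by (auto intro!: continuous_intros simp: Complex_eq)
  qed auto
  have "contour_integral (linepath (Complex 2 1) (Complex 2 T)) zeta_chi_log_deriv = \<i> * integral {1..T} (\<lambda>t. zeta_chi_log_deriv (Complex 2 t))"
    by (rule contour_integral_linepath_same_Re) (use T in auto)
  hence im: "Im (contour_integral (linepath (Complex 2 1) (Complex 2 T)) zeta_chi_log_deriv) = Re (integral {1..T} (\<lambda>t. zeta_chi_log_deriv (Complex 2 t)))"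
    by simp
  have "((\<lambda>t. zeta_chi_log_deriv (Complex 2 t)) has_integral integral {1..T} (\<lambda>t. zeta_chi_log_deriv (Complex 2 t))) {1..T}"
    using integrable_continuous_real[OF ch] by (rule integrable_integral)
  from has_integral_linear[OF this bounded_linear_Re]
  have hE: "(E has_integral Re (integral {1..T} (\<lambda>t. zeta_chi_log_deriv (Complex 2 t)))) {1..T}"
    by (simp add: E_def o_def)
  have hG: "((\<lambda>t. ln (t / (2 * pi))) has_integral (G T - G 1)) {1..T}"
  proof (rule fundamental_theorem_of_calculus)
    fix t assume t: "t \<in> {1..T}"
    show "(G has_vector_derivative ln (t / (2 * pi))) (at t within {1..T})"
      unfolding G_def has_real_derivative_iff_has_vector_derivative[symmetric]
      using t by (auto intro!: derivative_eq_intros)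
  qed (use T in auto)
  have d: "((\<lambda>t. E t - ln (t / (2 * pi))) has_integral 
      (Im (contour_integral (linepath (Complex 2 1) (Complex 2 T)) zeta_chi_log_deriv) - (G T - G 1))) {1..T}"
    unfolding im by (rule has_integral_diff[OF hE hG])
  have l: "((\<lambda>t. 5 * (1 / t)) has_integral (5 * (ln T - ln 1))) {1..T}"
  proof (intro has_integral_mult_right fundamental_theorem_of_calculus)
    fix t assume t: "t \<in> {1..T}"
    show "(ln has_vector_derivative 1 / t) (at t within {1..T})"
      unfolding has_real_derivative_iff_has_vector_derivative[symmetric]
      using t by (auto intro!: derivative_eq_intros)
  qed (use T in auto)
  have "norm (integral {1..T} (\<lambda>t. E t - ln (t / (2 * pi)))) \<le> integral {1..T} (\<lambda>t. 5 * (1 / t))"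
  proof (rule integral_norm_bound_integral)
    show "(\<lambda>t. E t - ln (t / (2 * pi))) integrable_on {1..T}" "(\<lambda>t. 5 * (1 / t)) integrable_on {1..T}"
      using d l by (auto simp: integrable_on_def)
    show "norm (E t - ln (t / (2 * pi))) \<le> 5 * (1 / t)" if "t \<in> {1..T}" for t
      using Re_zeta_chi_log_deriv_2[of t] that by (simp add: E_def)
  qed
  hence "\<bar>Im (contour_integral (linepath (Complex 2 1) (Complex 2 T)) zeta_chi_log_deriv) - (G T - G 1)\<bar> \<le> 5 * ln T"
    using d l by (simp add: integral_unique)
  moreover have "\<bar>G 1\<bar> \<le> 10"
  proof -
    have "ln (2 * pi) \<le> 2 * pi - 1" by (rule ln_le_minus_one) simp
    moreover have "ln (2 * pi) \<ge> 0" using pi_ge_two by (intro ln_ge_zero) linarith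
    moreover have "ln (1 / (2 * pi)) = - ln (2 * pi)" by (simp add: ln_div)
    ultimately show ?thesis using pi_less_4 unfolding G_def mult_1 by linarith
  qed
  ultimately show ?thesis unfolding G_def by linarith
qed

text \<open>The radii around 2 + iT are 3/2, reaching the critical line, then 2, then 9/4. The
  largest disc stays in Re s \<ge> -1/4, where the trapezoid estimate gives |\<zeta>| \<le> 3 T^2.
  The number of removable zeros is then of order ln T, as is every other contribution.\<close>

lemma Im_zeta_log_deriv_horizontal:
  obtains K where "K \<ge> 0" "\<And>T. T \<ge> 4 \<Longrightarrow> (\<And>\<rho>. \<rho> \<in> nontrivial_zeros \<Longrightarrow> Im \<rho> \<noteq> T) \<Longrightarrow>
    \<bar>Im (contour_integral (linepath (Complex 2 T) (Complex (1/2) T)) zeta_log_deriv)\<bar> \<le> K * ln T"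
proof -
  \<comment> \<open>This is ln (R / r1) for R = 9/4 and r1 = 2, the gain per removed zero;
    \<open>P\<close> is the cost of one removal along a segment of length 3/2.\<close>
  define c where "c = ln (9 / 8 :: real)"
  have c: "c > 0" by (simp add: c_def)
  define P where "P = 2 * pi + 3 / 2 * (2 / (9/4 * (9/4 - 2 :: real)))"
  have P: "P \<ge> 0" by (simp add: P_def)
  define K where "K = 72 + (5 / c + 1) * P"
  show ?thesis
  proof (rule that[of K])
    show "K \<ge> 0" using c P by (simp add: K_def)
    fix T :: real assume T: "T \<ge> 4" and nz: "\<And>\<rho>. \<rho> \<in> nontrivial_zeros \<Longrightarrow> Im \<rho> \<noteq> T"
    define C M where "C = Complex 2 T" and "M = Complex (1/2) T"
    define U where "U = {s. Re s > -1} \<inter> {s. Im s > 0}"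
    \<comment> \<open>The exponent must turn the lower bound 1/4 at the centre into 3 T^2 on the
      circle; T^5 suffices since T^3 \<ge> 64.\<close>
    define m where "m = 5 * ln T"
    have "exp 1 \<le> (3 :: real)" by (rule exp_le)
    hence "exp 1 < T" using T by simp
    hence "ln (exp 1) < ln T" by (subst ln_less_cancel_iff) (use T in auto)
    hence lnT: "ln T \<ge> 1" by simp
    define n where "n = nat \<lceil>m / c\<rceil>"
    have n: "m / c \<le> real n" "real n \<le> m / c + 1"
      using lnT c unfolding n_def m_def by (auto simp: of_nat_nat intro!: of_nat_ceiling) 
    have bounds: "-1/4 \<le> Re z" "Im z \<ge> 7/4" "norm z \<le> 3 * T - 1" if "z \<in> cball C (9/4)" for z
    proof -
      have d: "norm (C - z) \<le> 9/4" using that by (simp add: dist_norm)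
      have "\<bar>Re (C - z)\<bar> \<le> 9/4" "\<bar>Im (C - z)\<bar> \<le> 9/4" 
        using d abs_Re_le_cmod[of "C - z"] abs_Im_le_cmod[of "C - z"] by linarith+
      hence "Re (C - z) \<le> 9/4" "Im (C - z) \<le> 9/4" by linarith+
      moreover have "Re (C - z) = 2 - Re z" "Im (C - z) = T - Im z" by (simp_all add: C_def)
      ultimately have "2 - Re z \<le> 9/4" "T - Im z \<le> 9/4" by simp_all
      thus "-1/4 \<le> Re z" "Im z \<ge> 7/4" using T by linarith+
      have "norm z \<le> norm C + norm (C - z)" using norm_triangle_ineq4[of C "C - z"] by simp
      also have "norm C \<le> 2 + T" using cmod_le[of C] T by (simp add: C_def)
      finally show "norm z \<le> 3 * T - 1" using d T by linarith
    qed
    have zC: "norm (zeta C) \<ge> 1 / 4"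
      using norm_zeta_minus_1_le[of C] norm_triangle_ineq2[of 1 "1 - zeta C"] by (simp add: C_def norm_minus_commute)
    have lw: "exp m * norm (zeta C) \<ge> 3 * T ^ 2"
    proof -
      have "exp m = T ^ 5" using T by (simp add: m_def exp_of_nat_mult[of 5, simplified] )
      moreover have "T ^ 5 \<ge> 4 ^ 3 * T ^ 2"
      proof -
        have "T ^ 3 \<ge> 4 ^ 3" using T by (intro power_mono) auto
        hence "T ^ 3 * T ^ 2 \<ge> 4 ^ 3 * T ^ 2" by (intro mult_right_mono) auto
        thus ?thesis by (simp add: power_add[symmetric])
      qed
      ultimately have "exp m \<ge> 64 * T ^ 2" by simp
      hence "exp m * norm (zeta C) \<ge> 64 * T ^ 2 * (1 / 4)" using zC by (intro mult_mono) auto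
      thus ?thesis using zero_le_power2[of T] by linarith
    qed
    have "\<bar>Im (contour_integral (linepath C M) (\<lambda>z. deriv zeta z / zeta z))\<bar>
           \<le> 4 * (m + 1) * (3/2) / (2 - 3/2) + real n * (2 * pi + norm (M - C) * (2 / (9/4 * (9/4 - 2))))"
    proof (rule Im_log_deriv_integral_bound[where c = C and U = U])
      have "C \<in> cball C (3/2)" by simp
      moreover have "M \<in> cball C (3/2)" by (simp add: C_def M_def dist_norm cmod_def)
      ultimately show "closed_segment C M \<subseteq> cball C (3/2)" by (intro closed_segment_subset) auto
      show "open U" unfolding U_def by (intro open_Int open_halfspace_Re_gt open_halfspace_Im_gt)
      show "cball C (9/4) \<subseteq> U" using bounds by (force simp: U_def)
      show "zeta holomorphic_on U" 
        by (rule holomorphic_on_subset[OF zeta_holomorphic]) (auto simp: U_def)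
      show "zeta C \<noteq> 0" using zC by auto
      show "zeta z \<noteq> 0" if "z \<in> closed_segment C M" for z
      proof -
        have "Im z = T" using that by (auto simp: C_def M_def closed_segment_def complex_eq_iff algebra_simps)
        thus ?thesis using nz[of z] T by (auto simp: nontrivial_zeros_def)
      qed
      show "m \<le> real n * ln (9 / 4 / 2)" using n(1) c by (simp add: c_def pos_divide_le_eq)
      fix z assume "dist C z = 9/4"
      hence z: "-1/4 \<le> Re z" "Im z \<ge> 7/4" "norm z \<le> 3 * T - 1" using bounds[of z] by auto
      have z1: "z \<noteq> 1" using z by auto
      have "norm (zeta z - (1 / (z - 1) + 1 / 2)) \<le> norm z * norm (z + 1) / (8 * (Re z + 1))"
        using zeta_strip_approx[of z] zeta_eq_strip[of z] z z1 by auto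
      also have "\<dots> \<le> (3 * T) * (3 * T) / 6"
      proof (intro frac_le mult_mono)
        show "norm (z + 1) \<le> 3 * T" using z norm_triangle_ineq[of z 1] by simp
      qed (use z T in auto)
      finally have 1: "norm (zeta z - (1 / (z - 1) + 1 / 2)) \<le> 3 / 2 * T ^ 2" by (simp add: power2_eq_square)
      have "norm (z - 1) \<ge> 1" using abs_Im_le_cmod[of "z - 1"] z by simp
      hence "norm (1 / (z - 1)) \<le> 1 / 1" unfolding norm_divide by (intro frac_le) auto
      hence "norm (1 / (z - 1)) \<le> 1" by simp
      hence 2: "norm (1 / (z - 1) + 1 / 2) \<le> 3 / 2" using norm_triangle_ineq[of "1 / (z - 1)" "1 / 2"] by simp
      have "T ^ 2 \<ge> 4 ^ 2" using T by (intro power_mono) auto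
      hence "norm (zeta z) \<le> 3 * T ^ 2" using 1 2 norm_triangle_ineq[of "zeta z - (1 / (z - 1) + 1 / 2)" "1 / (z - 1) + 1 / 2"] by simp
      thus "norm (zeta z) \<le> exp m * norm (zeta C)" using lw by linarith
    qed auto
    also have "norm (M - C) = 3 / 2" by (simp add: M_def C_def cmod_def)
    also have "4 * (m + 1) * (3/2) / (2 - 3/2) + real n * (2 * pi + 3 / 2 * (2 / (9/4 * (9/4 - 2)))) = 12 * (m + 1) + real n * P"
      by (simp add: P_def)
    also have "\<dots> \<le> 12 * (m + 1) + (m / c + 1) * P" using n(2) P by (intro add_left_mono mult_right_mono) auto
    also have "\<dots> \<le> K * ln T"
    proof -
      have "12 * (m + 1) \<le> 72 * ln T" using lnT by (simp add: m_def)
      moreover have "m / c + 1 \<le> (5 / c + 1) * ln T" using lnT by (simp add: m_def algebra_simps)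
      hence "(m / c + 1) * P \<le> (5 / c + 1) * ln T * P" using P by (rule mult_right_mono)
      ultimately show ?thesis by (simp add: K_def algebra_simps)
    qed
    finally show "\<bar>Im (contour_integral (linepath (Complex 2 T) (Complex (1/2) T)) zeta_log_deriv)\<bar> \<le> K * ln T"
      by (simp add: C_def M_def zeta_log_deriv_def[abs_def])
  qed
qed

text \<open>The rectangle is symmetric under s to 1 - cnj s. The left edge and the left half of the
  top edge are therefore expressed by the right ones and by integrals of
  \<open>zeta_chi_log_deriv\<close>; only the fixed bottom edge, bounded by \<open>k0\<close>, is
  left as it is.\<close>

lemma zeta_zero_count_approx_generic:
  obtains K where "K \<ge> 0" "\<And>T. T \<ge> 4 \<Longrightarrow> (\<And>\<rho>. \<rho> \<in> nontrivial_zeros \<Longrightarrow> Im \<rho> \<noteq> T) \<Longrightarrow>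
    \<bar>2 * pi * zeta_zero_count T - (T * ln (T / (2 * pi)) - T)\<bar> \<le> K * ln T"
proof -
  obtain K1 where K1: "K1 \<ge> 0" "\<And>T. T \<ge> 4 \<Longrightarrow> (\<And>\<rho>. \<rho> \<in> nontrivial_zeros \<Longrightarrow> Im \<rho> \<noteq> T) \<Longrightarrow>
    \<bar>Im (contour_integral (linepath (Complex 2 T) (Complex (1/2) T)) zeta_log_deriv)\<bar> \<le> K1 * ln T"
    using Im_zeta_log_deriv_horizontal by blast
  define k0 where "k0 = \<bar>Im (contour_integral (linepath (Complex (-1) 1) (Complex 2 1)) zeta_log_deriv)\<bar>"
  define K where "K = k0 + 2 * K1 + 60"
  show ?thesis
  proof (rule that[of K])
    show "K \<ge> 0" using K1(1) by (simp add: K_def k0_def)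
    fix T :: real assume T: "T \<ge> 4" and nz: "\<And>\<rho>. \<rho> \<in> nontrivial_zeros \<Longrightarrow> Im \<rho> \<noteq> T"
    have "exp 1 \<le> (3 :: real)" by (rule exp_le)
    hence "exp 1 < T" using T by simp
    hence "ln (exp 1) < ln T" by (subst ln_less_cancel_iff) (use T in auto)
    hence lnT: "ln T \<ge> 1" by simp
    \<comment> \<open>The corners run counterclockwise from the lower left. The reflection exchanges
      A with B and C with D and fixes M, the midpoint of the top edge on the critical line.\<close>
    define A B C M D where "A = Complex (-1) 1" and "B = Complex 2 1" and "C = Complex 2 T"
      and "M = Complex (1/2) T" and "D = Complex (-1) T"
    define I where "I = (\<lambda>a b. contour_integral (linepath a b) zeta_log_deriv)"
    define J where "J = (\<lambda>a b. contour_integral (linepath a b) zeta_chi_log_deriv)"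
    have nz_top: "zeta s \<noteq> 0" if "Im s = T" for s
      using nz[of s] that T by (auto simp: nontrivial_zeros_def)
    have nz_bot: "zeta s \<noteq> 0" if "Im s = 1" for s
      using nontrivial_zeros_region(3)[of s] that by auto
    have nz_right: "zeta s \<noteq> 0" if "Re s = 2" for s
      using zeta_nonzero_right[of s] that by auto
    have nz_left: "zeta s \<noteq> 0" if "Re s = -1" "Im s \<noteq> 0" for s
      using nontrivial_zeros_region(1)[of s] that by auto
    have segRe: "Re s = Re a" if "s \<in> closed_segment a b" "Re a = Re b" for s a b :: complex
      using that(1) unfolding closed_segment_def by (auto simp: that(2) left_diff_distrib)
    have segIm: "Im s = Im a" if "s \<in> closed_segment a b" "Im a = Im b" for s a b :: complex
      using that(1) unfolding closed_segment_def by (auto simp: that(2) left_diff_distrib)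
    have segImT: "1 \<le> Im s" if "s \<in> closed_segment a b" "1 \<le> Im a" "1 \<le> Im b" for s a b :: complex
    proof -
      have "closed_segment a b \<subseteq> {s. Im s \<ge> 1}" 
        using that by (intro closed_segment_subset convex_halfspace_Im_ge) auto
      thus ?thesis using that by auto
    qed
    have segRe0: "0 < Re s" if "s \<in> closed_segment a b" "0 < Re a" "0 < Re b" for s a b :: complex
    proof -
      have "closed_segment a b \<subseteq> {s. Re s > 0}" 
        using that by (intro closed_segment_subset convex_halfspace_Re_gt) auto
      thus ?thesis using that by auto
    qed
    have cAB: "continuous_on (closed_segment A B) zeta_log_deriv"
      using segIm[of _ A B] by (intro continuous_on_zeta_log_deriv) (auto simp: A_def B_def nz_bot)
    have cBC: "continuous_on (closed_segment B C) zeta_log_deriv"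
      using segRe[of _ B C] segImT[of _ B C] T by (intro continuous_on_zeta_log_deriv) (force simp: B_def C_def nz_right)
    have cCD: "continuous_on (closed_segment C D) zeta_log_deriv"
      using segIm[of _ C D] T by (intro continuous_on_zeta_log_deriv) (auto simp: C_def D_def nz_top)
    have cMC: "continuous_on (closed_segment M C) zeta_log_deriv"
      using segIm[of _ M C] T by (intro continuous_on_zeta_log_deriv) (auto simp: C_def M_def nz_top)
    have cDA: "continuous_on (closed_segment D A) zeta_log_deriv"
      using segRe[of _ D A] segImT[of _ D A] T by (intro continuous_on_zeta_log_deriv) (force simp: A_def D_def nz_left)
    have MCD: "M \<in> closed_segment C D"
      unfolding closed_segment_def by (rule CollectI, rule exI[of _ "1/2"]) (simp add: M_def C_def D_def complex_eq_iff)
    have "contour_integral (rectpath A C) zeta_log_deriv = I A B + I B C + I C D + I D A"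
    proof -
      have r: "rectpath A C = linepath A B +++ linepath B C +++ linepath C D +++ linepath D A"
        by (simp add: rectpath_def Let_def A_def B_def C_def D_def)
      have i: "zeta_log_deriv contour_integrable_on linepath A B" "zeta_log_deriv contour_integrable_on linepath B C"
        "zeta_log_deriv contour_integrable_on linepath C D" "zeta_log_deriv contour_integrable_on linepath D A"
        using cAB cBC cCD cDA by (auto intro: contour_integrable_continuous_linepath)
      have v: "valid_path (linepath C D +++ linepath D A)" "valid_path (linepath B C +++ linepath C D +++ linepath D A)"
        by (auto intro!: valid_path_join)
      show ?thesis unfolding r I_def using i v by (simp add: contour_integrable_joinI)
    qed
    moreover have "contour_integral (rectpath A C) zeta_log_deriv = 2 * pi * \<i> * zeta_zero_count T"
      unfolding A_def C_def by (rule zeta_zero_count_argument_principle) (use T nz in auto)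
    ultimately have "2 * pi * \<i> * zeta_zero_count T = I A B + I B C + I C D + I D A" by simp
    hence "Im (2 * pi * \<i> * zeta_zero_count T) = Im (I A B + I B C + I C D + I D A)" by simp
    hence N: "2 * pi * zeta_zero_count T = Im (I A B) + Im (I B C) + Im (I C D) + Im (I D A)" by simp
    have CD: "I C D = I C M + I M D"
      unfolding I_def by (rule contour_integral_split_linepath[OF cCD MCD])
    have CM: "I M C = - I C M"
      unfolding I_def by (rule contour_integral_reverse_linepath[OF cMC])
    have MD: "I M D = cnj (J M C + I M C)"
    proof -
      have "M = 1 - cnj M" "D = 1 - cnj C" by (auto simp: M_def D_def C_def complex_eq_iff)
      moreover have "contour_integral (linepath (1 - cnj M) (1 - cnj C)) zeta_log_deriv = cnj (J M C + I M C)"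
        unfolding I_def J_def
        by (rule contour_integral_zeta_log_deriv_reflect) 
           (use segIm[of _ M C] segRe0[of _ M C] T in \<open>auto simp: M_def C_def nz_top\<close>)
      ultimately show ?thesis unfolding I_def by simp
    qed
    have "I A D = cnj (J B C + I B C)"
    proof -
      have "A = 1 - cnj B" "D = 1 - cnj C" by (auto simp: A_def B_def D_def C_def complex_eq_iff)
      moreover have "contour_integral (linepath (1 - cnj B) (1 - cnj C)) zeta_log_deriv = cnj (J B C + I B C)"
        unfolding I_def J_def
      proof (rule contour_integral_zeta_log_deriv_reflect)
        fix s assume s: "s \<in> closed_segment B C"
        have "Re s = 2" using segRe[OF s] by (simp add: B_def C_def)
        moreover have "1 \<le> Im s" using segImT[OF s] T by (simp add: B_def C_def)
        ultimately show "Re s > 0 \<and> Im s > 0 \<and> zeta s \<noteq> 0" using nz_right by auto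
      qed
      ultimately show ?thesis unfolding I_def by simp
    qed
    moreover have "I D A = - I A D"
      unfolding I_def by (rule contour_integral_reverse_linepath[OF cDA])
    ultimately have DA: "Im (I D A) = Im (J B C) + Im (I B C)" by simp
    \<comment> \<open>Conjugation flips the sign of imaginary parts and the reflected left edge is
      traversed backwards, so both \<zeta> integrals double and the vertical \<open>J B C\<close>
      enters with a plus sign. It carries the main term.\<close>
    have Imeq: "2 * pi * zeta_zero_count T = Im (I A B) + 2 * Im (I B C) + 2 * Im (I C M) - Im (J M C) + Im (J B C)"
      unfolding N CD MD DA by (simp add: CM)
    have 1: "\<bar>Im (I A B)\<bar> \<le> k0 * ln T"
    proof -
      have "k0 * 1 \<le> k0 * ln T" using lnT by (intro mult_left_mono) (auto simp: k0_def)
      thus ?thesis by (simp add: I_def A_def B_def k0_def)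
    qed
    have 2: "\<bar>Im (I B C)\<bar> \<le> 4 * ln T"
      using Im_zeta_log_deriv_vertical[of T] pi_less_4 lnT by (simp add: I_def B_def C_def)
    have 3: "\<bar>Im (I C M)\<bar> \<le> K1 * ln T"
      using K1(2)[OF T nz] by (simp add: I_def C_def M_def)
    have 4: "\<bar>Im (J M C)\<bar> \<le> 28 * ln T"
    proof -
      have "norm (J M C) \<le> (ln T + 17) * norm (C - M)"
        unfolding J_def
      proof (rule contour_integral_bound_linepath)
        show "zeta_chi_log_deriv contour_integrable_on linepath M C"
        proof (intro contour_integrable_continuous_linepath holomorphic_on_imp_continuous_on 
              holomorphic_on_subset[OF zeta_chi_log_deriv_holomorphic] subsetI)
          fix s assume "s \<in> closed_segment M C"
          thus "s \<in> {s. Re s > 0 \<and> Im s > 0}"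
            using segIm[of s M C] segRe0[of s M C] T by (simp add: M_def C_def)
        qed
        fix s assume s: "s \<in> closed_segment M C"
        have ims: "Im s = T" using segIm[OF s] by (simp add: M_def C_def)
        have res: "Re s > 0" using segRe0[OF s] by (simp add: M_def C_def)
        have "closed_segment M C \<subseteq> {s. Re s \<le> 2}" 
          by (intro closed_segment_subset convex_halfspace_Re_le) (auto simp: M_def C_def)
        hence res2: "Re s \<le> 2" using s by auto
        have "norm s \<le> 2 + T" using cmod_le[of s] res res2 ims T by simp
        also have "\<dots> \<le> exp 1 * T" 
        proof -
          have "exp 1 \<ge> (1 + 1 :: real)" by (rule exp_ge_add_one_self)
          hence "exp 1 * T \<ge> 2 * T" using T by (intro mult_right_mono) auto
          thus ?thesis using T by linarith
        qed
        finally have "norm s \<le> exp 1 * T" .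
        moreover have "norm s > 0" using res by auto
        ultimately have "ln (norm s) \<le> ln (exp 1 * T)" using T by (subst ln_le_cancel_iff) auto
        also have "\<dots> = 1 + ln T" using T by (subst ln_mult) auto
        finally show "norm (zeta_chi_log_deriv s) \<le> ln T + 17"
          using norm_zeta_chi_log_deriv_le[OF res] ims T by simp
      qed (use lnT in auto)
      also have "norm (C - M) = 3 / 2" by (simp add: C_def M_def cmod_def)
      finally have "norm (J M C) \<le> 28 * ln T" using lnT by simp
      thus ?thesis using abs_Im_le_cmod order_trans by blast
    qed
    have 5: "\<bar>Im (J B C) - (T * ln (T / (2 * pi)) - T)\<bar> \<le> 15 * ln T"
      using Im_zeta_chi_log_deriv_vertical[of T] T lnT by (simp add: J_def B_def C_def)
    \<comment> \<open>The numerical errors add up to 2 * 4 + 28 + 15 = 51, within the allowance of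
      60.\<close>
    have "K * ln T = k0 * ln T + 2 * (K1 * ln T) + 60 * ln T" by (simp add: K_def algebra_simps)
    thus "\<bar>2 * pi * zeta_zero_count T - (T * ln (T / (2 * pi)) - T)\<bar> \<le> K * ln T"
      using 1 2 3 4 5 lnT unfolding Imeq by linarith
  qed
qed

text \<open>Only finitely many ordinates lie below T, so some t just below T is above all of them:
  the count is the same at t and T, and t is not an ordinate. By continuity the main term moves by
  less than 1.\<close>

lemma zeta_zero_count_approx_above_4:
  obtains K where "K \<ge> 0" "\<And>T. T > 4 \<Longrightarrow> \<bar>2 * pi * zeta_zero_count T - (T * ln (T / (2 * pi)) - T)\<bar> \<le> K * ln T + 1"
proof -
  obtain K where K: "K \<ge> 0" "\<And>T. T \<ge> 4 \<Longrightarrow> (\<And>\<rho>. \<rho> \<in> nontrivial_zeros \<Longrightarrow> Im \<rho> \<noteq> T) \<Longrightarrow>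
    \<bar>2 * pi * zeta_zero_count T - (T * ln (T / (2 * pi)) - T)\<bar> \<le> K * ln T"
    using zeta_zero_count_approx_generic by blast
  show ?thesis
  proof (rule that[OF K(1)])
    fix T :: real assume T: "T > 4"
    define G where "G = (\<lambda>T. T * ln (T / (2 * pi)) - T)"
    define Z where "Z = {\<rho>. \<rho> \<in> nontrivial_zeros \<and> 0 < Im \<rho> \<and> Im \<rho> < T}"
    have finZ: "finite Z" unfolding Z_def by (rule finite_zeta_zeros_below)
    define m where "m = Max (insert 4 (Im ` Z))"
    have m: "m < T" "m \<ge> 4" "\<And>\<rho>. \<rho> \<in> Z \<Longrightarrow> Im \<rho> \<le> m"
      using finZ T unfolding m_def by (auto simp: Z_def)
    have "isCont G T" unfolding G_def using T by (intro continuous_intros) auto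
    hence "(G \<longlongrightarrow> G T) (at_left T)" by (simp add: isCont_def filterlim_at_split)
    hence "eventually (\<lambda>t. dist (G t) (G T) < 1) (at_left T)" by (rule tendstoD) simp
    moreover have "eventually (\<lambda>t. t \<in> {m<..<T}) (at_left T)" using m(1) by (rule eventually_at_left_real)
    ultimately have "eventually (\<lambda>t. dist (G t) (G T) < 1 \<and> t \<in> {m<..<T}) (at_left T)" by (rule eventually_conj)
    then obtain t where t: "dist (G t) (G T) < 1" "m < t" "t < T"
      using eventually_happens'[OF trivial_limit_at_left_real] by fastforce
    have "{\<rho>. \<rho> \<in> nontrivial_zeros \<and> 0 < Im \<rho> \<and> Im \<rho> < t} = Z"
      using m(3) t unfolding Z_def by force
    hence N: "zeta_zero_count t = zeta_zero_count T" unfolding zeta_zero_count_def Z_def by simp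
    have "Im \<rho> \<noteq> t" if "\<rho> \<in> nontrivial_zeros" for \<rho>
    proof
      assume "Im \<rho> = t"
      hence "\<rho> \<in> Z" using that t m by (auto simp: Z_def)
      thus False using m(3)[of \<rho>] t \<open>Im \<rho> = t\<close> by simp
    qed
    hence "\<bar>2 * pi * zeta_zero_count t - G t\<bar> \<le> K * ln t"
      unfolding G_def using t m by (intro K(2)) auto
    moreover have "K * ln t \<le> K * ln T" using K(1) t m by (intro mult_left_mono) auto
    ultimately have "\<bar>2 * pi * zeta_zero_count T - G T\<bar> \<le> K * ln T + 1"
      using t(1) unfolding N dist_real_def by linarith
    thus "\<bar>2 * pi * zeta_zero_count T - (T * ln (T / (2 * pi)) - T)\<bar> \<le> K * ln T + 1"
      by (simp only: G_def)
  qed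
qed

text \<open>It handles bounded heights: the count and the twisted sum are both bounded by a constant
  that is independent of \<tau>.\<close>

lemma zeta_zero_sum_below_bound:
  assumes "\<And>\<rho>. norm (f \<rho>) \<le> 1" "T \<le> T'"
  shows "norm (\<Sum>\<rho> | \<rho> \<in> nontrivial_zeros \<and> 0 < Im \<rho> \<and> Im \<rho> < T. of_int (zorder zeta \<rho>) * f \<rho> :: complex)
         \<le> (\<Sum>\<rho> | \<rho> \<in> nontrivial_zeros \<and> 0 < Im \<rho> \<and> Im \<rho> < T'. \<bar>real_of_int (zorder zeta \<rho>)\<bar>)"
proof -
  have "norm (\<Sum>\<rho> | \<rho> \<in> nontrivial_zeros \<and> 0 < Im \<rho> \<and> Im \<rho> < T. of_int (zorder zeta \<rho>) * f \<rho> :: complex)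
     \<le> (\<Sum>\<rho> | \<rho> \<in> nontrivial_zeros \<and> 0 < Im \<rho> \<and> Im \<rho> < T. \<bar>real_of_int (zorder zeta \<rho>)\<bar>)"
  proof (rule sum_norm_le)
    fix \<rho>
    have "norm (of_int (zorder zeta \<rho>) * f \<rho>) = \<bar>real_of_int (zorder zeta \<rho>)\<bar> * norm (f \<rho>)" by (simp add: norm_mult)
    also have "\<dots> \<le> \<bar>real_of_int (zorder zeta \<rho>)\<bar> * 1" using assms(1) by (intro mult_left_mono) auto
    finally show "norm (of_int (zorder zeta \<rho>) * f \<rho>) \<le> \<bar>real_of_int (zorder zeta \<rho>)\<bar>" by simp
  qed
  also have "\<dots> \<le> (\<Sum>\<rho> | \<rho> \<in> nontrivial_zeros \<and> 0 < Im \<rho> \<and> Im \<rho> < T'. \<bar>real_of_int (zorder zeta \<rho>)\<bar>)"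
    using assms(2) by (intro sum_mono2 finite_zeta_zeros_below) auto
  finally show ?thesis .
qed

section \<open>The Riemann-von Mangoldt formula from height 1 on\<close>

text \<open>The smooth approximation to the count itself; the density in the usual sense is its
  derivative ln (t / (2 \<pi>)) / (2 \<pi>).\<close>

definition zeta_zero_density :: "real \<Rightarrow> real" where
  "zeta_zero_density t = (t * ln (t / (2 * pi)) - t) / (2 * pi)"

text \<open>The partial summation integrates from 1, so the formula is extended below 4 by crude
  constants. The shifted logarithm ln (T + 2) is at least 1 and can absorb them, whereas ln T
  vanishes at T = 1.\<close>

theorem Riemann_von_Mangoldt:
  obtains K where "K \<ge> 0" "\<And>T. T \<ge> 1 \<Longrightarrow> \<bar>zeta_zero_count T - zeta_zero_density T\<bar> \<le> K * ln (T + 2)"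
proof -
  obtain K where K: "K \<ge> 0" "\<And>T. T > 4 \<Longrightarrow> \<bar>2 * pi * zeta_zero_count T - (T * ln (T / (2 * pi)) - T)\<bar> \<le> K * ln T + 1"
    using zeta_zero_count_approx_above_4 by blast
  define k where "k = (\<Sum>\<rho> | \<rho> \<in> nontrivial_zeros \<and> 0 < Im \<rho> \<and> Im \<rho> < 4. \<bar>real_of_int (zorder zeta \<rho>)\<bar>)"
  have k0: "k \<ge> 0" unfolding k_def by (intro sum_nonneg) auto
  show ?thesis
  proof (rule that[of "K + k + 40"])
    fix T :: real assume T: "T \<ge> 1"
    have "exp 1 \<le> (3::real)" by (rule exp_le)
    hence "exp 1 \<le> T + 2" using T by simp
    hence "ln (exp 1) \<le> ln (T + 2)" by (subst ln_le_cancel_iff) (use T in auto)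
    hence L: "ln (T + 2) \<ge> 1" by simp
    have p: "2 * pi \<ge> 1" using pi_ge_two by linarith
    show "\<bar>zeta_zero_count T - zeta_zero_density T\<bar> \<le> (K + k + 40) * ln (T + 2)"
    proof (cases "T > 4")
      case True
      have "2 * pi * zeta_zero_density T = T * ln (T / (2 * pi)) - T" by (simp add: zeta_zero_density_def)
      hence "2 * pi * (zeta_zero_count T - zeta_zero_density T) = 2 * pi * zeta_zero_count T - (T * ln (T / (2 * pi)) - T)"
        by (simp only: right_diff_distrib)
      hence "\<bar>2 * pi * (zeta_zero_count T - zeta_zero_density T)\<bar> \<le> K * ln T + 1" using K(2)[OF True] by simp
      moreover have "\<bar>2 * pi * (zeta_zero_count T - zeta_zero_density T)\<bar> = 2 * pi * \<bar>zeta_zero_count T - zeta_zero_density T\<bar>"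
        by (simp add: abs_mult)
      moreover have "1 * \<bar>zeta_zero_count T - zeta_zero_density T\<bar> \<le> 2 * pi * \<bar>zeta_zero_count T - zeta_zero_density T\<bar>"
        by (rule mult_right_mono[OF p]) simp
      ultimately have "\<bar>zeta_zero_count T - zeta_zero_density T\<bar> \<le> K * ln T + 1" by (simp only: mult_1)
      moreover have "K * ln T \<le> K * ln (T + 2)" using K(1) T by (intro mult_left_mono) auto
      moreover have "(K + k + 40) * ln (T + 2) = K * ln (T + 2) + k * ln (T + 2) + 40 * ln (T + 2)" by (simp add: algebra_simps)
      moreover have "k * ln (T + 2) \<ge> 0" using k0 L by simp
      ultimately show ?thesis using L by linarith
    next
      case False
      have "norm (\<Sum>\<rho> | \<rho> \<in> nontrivial_zeros \<and> 0 < Im \<rho> \<and> Im \<rho> < T. of_int (zorder zeta \<rho>) * 1 :: complex) \<le> k"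
        unfolding k_def by (rule zeta_zero_sum_below_bound) (use False in auto)
      also have "(\<Sum>\<rho> | \<rho> \<in> nontrivial_zeros \<and> 0 < Im \<rho> \<and> Im \<rho> < T. of_int (zorder zeta \<rho>) * 1 :: complex) = of_real (zeta_zero_count T)"
        by (simp add: zeta_zero_count_def)
      finally have N: "\<bar>zeta_zero_count T\<bar> \<le> k" by simp
      have lb: "ln (T / (2 * pi)) = ln T - ln (2 * pi)" using T by (subst ln_div) auto
      have "ln (2 * pi) \<le> 2 * pi - 1" by (rule ln_le_minus_one) simp
      moreover have "ln (2 * pi) \<ge> 0" using p by simp
      moreover have "ln T \<le> T - 1" using T by (intro ln_le_minus_one) auto
      moreover have "ln T \<ge> 0" using T by simp
      ultimately have l: "\<bar>ln (T / (2 * pi))\<bar> \<le> 7" using False pi_less_4 unfolding lb by linarith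
      have "\<bar>T * ln (T / (2 * pi))\<bar> \<le> 4 * 7" unfolding abs_mult using False T l by (intro mult_mono) auto
      hence "\<bar>T * ln (T / (2 * pi)) - T\<bar> \<le> 40" using False T by linarith
      hence "\<bar>zeta_zero_density T\<bar> \<le> 40 / 1" unfolding zeta_zero_density_def abs_divide
        using p by (intro frac_le) auto
      hence "\<bar>zeta_zero_count T - zeta_zero_density T\<bar> \<le> (k + 40) * 1"
        using N abs_triangle_ineq4[of "zeta_zero_count T" "zeta_zero_density T"] by simp
      also have "\<dots> \<le> (K + k + 40) * ln (T + 2)" using K(1) k0 L by (intro mult_mono) auto
      finally show ?thesis .
    qed
  qed (use K(1) k0 in simp)
qed

section \<open>Partial summation for the sum and for its main term\<close>

lemma has_vector_derivative_of_real_powr: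
  assumes "t > 0"
  shows "((\<lambda>t. complex_of_real t powr c) has_vector_derivative c * complex_of_real t powr (c - 1)) (at t within S)"
proof -
  have "((\<lambda>z. z powr c) has_field_derivative c * complex_of_real t powr (c - 1)) (at (complex_of_real t))"
    using assms by (intro has_field_derivative_powr) (auto simp: complex_nonpos_Reals_iff)
  thus ?thesis by (rule has_vector_derivative_real_field)
qed

lemma has_integral_powr_weight:
  fixes \<tau> :: real
  assumes "0 < a" "a \<le> x"
  shows "((\<lambda>t. \<i> * \<tau> * complex_of_real t powr (- (\<i> * \<tau>) - 1)) has_integral 
           (of_real a powr (- (\<i> * \<tau>)) - of_real x powr (- (\<i> * \<tau>)))) {a..x}"
proof -
  have "((\<lambda>t. \<i> * \<tau> * complex_of_real t powr (- (\<i> * \<tau>) - 1)) has_integral 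
           (- (of_real x powr (- (\<i> * \<tau>))) - - (of_real a powr (- (\<i> * \<tau>))))) {a..x}"
  proof (rule fundamental_theorem_of_calculus[OF assms(2)])
    fix t assume "t \<in> {a..x}"
    hence t: "t > 0" using assms by auto
    show "((\<lambda>t. - (complex_of_real t powr (- (\<i> * \<tau>)))) has_vector_derivative \<i> * \<tau> * complex_of_real t powr (- (\<i> * \<tau>) - 1)) (at t within {a..x})"
      using has_vector_derivative_minus[OF has_vector_derivative_of_real_powr[OF t, of "- (\<i> * \<tau>)"]] by simp
  qed
  thus ?thesis by simp
qed

text \<open>Partial summation: \<open>\<gamma> powr (-i\<tau>)\<close> is \<open>x powr (-i\<tau>)\<close> plus the integral of the weight over \<open>{\<gamma>..x}\<close>.\<close>

lemma zero_ordinate_sum_partial_summation: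
  fixes \<tau> x :: real
  assumes x: "x \<ge> 1"
  shows "((\<lambda>t. of_real (zeta_zero_count t) * (\<i> * \<tau> * complex_of_real t powr (- (\<i> * \<tau>) - 1))) has_integral 
           (zero_ordinate_sum \<tau> x - of_real (zeta_zero_count x) * of_real x powr (- (\<i> * \<tau>)))) {1..x}"
proof -
  define f where "f = (\<lambda>t. \<i> * \<tau> * complex_of_real t powr (- (\<i> * \<tau>) - 1))"
  define Z where "Z = {\<rho>. \<rho> \<in> nontrivial_zeros \<and> 0 < Im \<rho> \<and> Im \<rho> < x}"
  have finZ: "finite Z" unfolding Z_def by (rule finite_zeta_zeros_below)
  have trm: "((\<lambda>t. if Im \<rho> < t then of_int (zorder zeta \<rho>) * f t else 0) has_integral 
      of_int (zorder zeta \<rho>) * (of_real (Im \<rho>) powr (- (\<i> * \<tau>)) - of_real x powr (- (\<i> * \<tau>)))) {1..x}"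
    if \<rho>: "\<rho> \<in> Z" for \<rho>
  proof -
    have g: "1 < Im \<rho>" "Im \<rho> < x" using \<rho> nontrivial_zeros_region(3)[of \<rho>] by (auto simp: Z_def nontrivial_zeros_def)
    have "((\<lambda>t. of_int (zorder zeta \<rho>) * f t) has_integral 
      of_int (zorder zeta \<rho>) * (of_real (Im \<rho>) powr (- (\<i> * \<tau>)) - of_real x powr (- (\<i> * \<tau>)))) {Im \<rho>..x}"
      unfolding f_def using g by (intro has_integral_mult_right has_integral_powr_weight) auto
    hence I1: "((\<lambda>t. if t \<in> {Im \<rho>..x} then of_int (zorder zeta \<rho>) * f t else 0) has_integral 
      of_int (zorder zeta \<rho>) * (of_real (Im \<rho>) powr (- (\<i> * \<tau>)) - of_real x powr (- (\<i> * \<tau>)))) {1..x}"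
      using g by (subst has_integral_restrict) auto
    \<comment> \<open>The two integrands differ only at t = Im \<rho>, because the count is
      strict.\<close>
    show ?thesis
      by (rule has_integral_spike[OF negligible_sing[of "Im \<rho>"] _ I1]) auto
  qed
  have "((\<lambda>t. \<Sum>\<rho>\<in>Z. if Im \<rho> < t then of_int (zorder zeta \<rho>) * f t else 0) has_integral 
      (\<Sum>\<rho>\<in>Z. of_int (zorder zeta \<rho>) * (of_real (Im \<rho>) powr (- (\<i> * \<tau>)) - of_real x powr (- (\<i> * \<tau>))))) {1..x}"
    by (intro has_integral_sum finZ trm)
  also have "(\<Sum>\<rho>\<in>Z. of_int (zorder zeta \<rho>) * (of_real (Im \<rho>) powr (- (\<i> * \<tau>)) - of_real x powr (- (\<i> * \<tau>)))) =
     zero_ordinate_sum \<tau> x - of_real (zeta_zero_count x) * of_real x powr (- (\<i> * \<tau>))"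
    unfolding zero_ordinate_sum_def zeta_zero_count_def Z_def[symmetric]
    by (simp add: right_diff_distrib sum_subtractf sum_distrib_right)
  finally have I: "((\<lambda>t. \<Sum>\<rho>\<in>Z. if Im \<rho> < t then of_int (zorder zeta \<rho>) * f t else 0) has_integral 
      (zero_ordinate_sum \<tau> x - of_real (zeta_zero_count x) * of_real x powr (- (\<i> * \<tau>)))) {1..x}" .
  have "((\<lambda>t. of_real (zeta_zero_count t) * f t) has_integral 
      (zero_ordinate_sum \<tau> x - of_real (zeta_zero_count x) * of_real x powr (- (\<i> * \<tau>)))) {1..x}"
  proof (rule has_integral_eq[OF _ I])
    fix t assume t: "t \<in> {1..x}"
    have "(\<Sum>\<rho>\<in>Z. if Im \<rho> < t then of_int (zorder zeta \<rho>) * f t else 0) = 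
          (\<Sum>\<rho> | \<rho> \<in> nontrivial_zeros \<and> 0 < Im \<rho> \<and> Im \<rho> < t. of_int (zorder zeta \<rho>) * f t)"
      by (rule sum.mono_neutral_cong_right[OF finZ]) (use t in \<open>auto simp: Z_def\<close>)
    also have "\<dots> = of_real (zeta_zero_count t) * f t"
      by (simp add: zeta_zero_count_def sum_distrib_right)
    finally show "(\<Sum>\<rho>\<in>Z. if Im \<rho> < t then of_int (zorder zeta \<rho>) * f t else 0) = of_real (zeta_zero_count t) * f t" .
  qed
  thus ?thesis by (simp only: f_def)
qed

lemma norm_powr_imaginary: "x > 0 \<Longrightarrow> norm (complex_of_real x powr (- (\<i> * of_real \<tau>))) = 1"
  by (subst norm_powr_real_powr) auto

text \<open>The derivative of \<open>zero_ordinate_main \<tau>\<close> is t powr (-i\<tau>) times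
  the derivative of \<open>zeta_zero_density\<close>. So the main term obeys the same partial
  summation as the sum of the zeros, with the smooth approximation in place of the count, and the
  two can be subtracted.\<close>

lemma zero_ordinate_main_partial_summation:
  fixes \<tau> x :: real
  assumes x: "x \<ge> 1"
  defines "H \<equiv> \<lambda>t. zero_ordinate_main \<tau> t - of_real (zeta_zero_density t) * of_real t powr (- (\<i> * \<tau>))"
  shows "((\<lambda>t. of_real (zeta_zero_density t) * (\<i> * \<tau> * complex_of_real t powr (- (\<i> * \<tau>) - 1))) has_integral (H x - H 1)) {1..x}"
proof (rule fundamental_theorem_of_calculus[OF x])
  fix t assume "t \<in> {1..x}"
  hence t: "t > 0" by auto
  define c where "c = 1 - \<i> * complex_of_real \<tau>"
  have c0: "c \<noteq> 0" by (auto simp: c_def complex_eq_iff)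
  define l where "l = complex_of_real (ln (t / (2 * pi)))"
  define P where "P = complex_of_real t powr (c - 1)"
  define S where "S = {1..x}"
  have c1: "- (\<i> * complex_of_real \<tau>) = c - 1" by (simp add: c_def)
  have tP: "complex_of_real t powr c = of_real t * P"
    using powr_add[of "complex_of_real t" 1 "c - 1"] t by (simp add: P_def)
  have D1: "((\<lambda>t. complex_of_real t powr c) has_vector_derivative c * P) (at t within S)"
    unfolding P_def by (rule has_vector_derivative_of_real_powr[OF t])
  have D2: "((\<lambda>t. complex_of_real t powr (c - 1)) has_vector_derivative (c - 1) * of_real t powr (c - 1 - 1)) (at t within S)"
    by (rule has_vector_derivative_of_real_powr[OF t])
  have "((\<lambda>t. ln (t / (2 * pi))) has_real_derivative 1 / t) (at t within S)"
    using t by (auto intro!: derivative_eq_intros)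
  hence D3: "((\<lambda>t. complex_of_real (ln (t / (2 * pi)))) has_vector_derivative of_real (1 / t)) (at t within S)"
    by (intro has_vector_derivative_of_real) (simp add: has_real_derivative_iff_has_vector_derivative)
  have "(zeta_zero_density has_real_derivative ln (t / (2 * pi)) / (2 * pi)) (at t within S)"
    unfolding zeta_zero_density_def using t by (auto intro!: derivative_eq_intros)
  hence D4: "((\<lambda>t. complex_of_real (zeta_zero_density t)) has_vector_derivative of_real (ln (t / (2 * pi)) / (2 * pi))) (at t within S)"
    by (intro has_vector_derivative_of_real) (simp add: has_real_derivative_iff_has_vector_derivative)
  have main: "zero_ordinate_main \<tau> = (\<lambda>t. (1 / (2 * of_real pi * c)) * (of_real t powr c * (of_real (ln (t / (2 * pi))) - 1 / c)))"
    by (simp add: zero_ordinate_main_def c_def fun_eq_iff)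
  have "(H has_vector_derivative
     (1 / (2 * of_real pi * c)) * (of_real t powr c * (of_real (1 / t) - 0) + c * P * (l - 1 / c))
      - (of_real (zeta_zero_density t) * ((c - 1) * of_real t powr (c - 1 - 1)) + of_real (ln (t / (2 * pi)) / (2 * pi)) * P)) (at t within S)"
    unfolding H_def main c1 l_def P_def
    by (intro has_vector_derivative_diff has_vector_derivative_mult has_vector_derivative_mult_right D2 D3 D4 has_vector_derivative_const D1[unfolded P_def])
  also have "(1 / (2 * of_real pi * c)) * (of_real t powr c * (of_real (1 / t) - 0) + c * P * (l - 1 / c)) = of_real (ln (t / (2 * pi)) / (2 * pi)) * P"
  proof -
    have "complex_of_real (ln (t / (2 * pi)) / (2 * pi)) = l / (2 * of_real pi)" by (simp add: l_def)
    thus ?thesis using c0 t unfolding tP by (simp add: field_simps)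
  qed
  finally have "(H has_vector_derivative - (of_real (zeta_zero_density t) * ((c - 1) * of_real t powr (c - 1 - 1)))) (at t within S)"
    by (simp add: algebra_simps)
  thus "(H has_vector_derivative of_real (zeta_zero_density t) * (\<i> * \<tau> * complex_of_real t powr (- (\<i> * \<tau>) - 1))) (at t within {1..x})"
    unfolding c1 S_def by (simp add: c_def)
qed

text \<open>With y = x / (2 \<pi>) < 1 one has y |ln y| \<le> 1, which tames the logarithm at 0. The
  factor 1 / |1 - i\<tau>| is kept because its decay in \<tau> pays for the small right-hand side
  near x = 1.\<close>

lemma norm_zero_ordinate_main_le:
  assumes x: "0 < x" "x < 2"
  shows "norm (zero_ordinate_main \<tau> x) \<le> 2 / norm (1 - \<i> * complex_of_real \<tau>)"
proof -
  define n where "n = norm (1 - \<i> * complex_of_real \<tau>)"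
  have n: "n \<ge> 1" using abs_Re_le_cmod[of "1 - \<i> * complex_of_real \<tau>"] by (simp add: n_def)
  define y where "y = x / (2 * pi)"
  have y: "0 < y" "y < 1" using x pi_ge_two by (auto simp: y_def)
  have "ln (1 / y) \<le> 1 / y - 1" using y by (intro ln_le_minus_one) auto
  hence "- ln y \<le> 1 / y - 1" using y by (simp add: ln_div)
  hence "y * (- ln y) \<le> y * (1 / y - 1)" using y by (intro mult_left_mono) auto
  also have "\<dots> \<le> 1" using y by (simp add: right_diff_distrib)
  finally have "y * \<bar>ln y\<bar> \<le> 1" using y by simp
  hence xl: "x * \<bar>ln (x / (2 * pi))\<bar> \<le> 2 * pi" by (simp add: y_def[symmetric]) (simp add: y_def field_simps)
  have "norm (complex_of_real x powr (1 - \<i> * of_real \<tau>)) = x"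
    using x by (subst norm_powr_real_powr) auto
  hence "norm (zero_ordinate_main \<tau> x) = x / (2 * pi * n) * norm (of_real (ln (x / (2 * pi))) - 1 / (1 - \<i> * complex_of_real \<tau>))"
    by (simp add: zero_ordinate_main_def norm_mult norm_divide n_def)
  also have "\<dots> \<le> x / (2 * pi * n) * (\<bar>ln (x / (2 * pi))\<bar> + 1)"
  proof (intro mult_left_mono)
    have "norm (of_real (ln (x / (2 * pi))) - 1 / (1 - \<i> * complex_of_real \<tau>)) \<le> norm (complex_of_real (ln (x / (2 * pi)))) + norm (1 / (1 - \<i> * complex_of_real \<tau>))"
      by (rule norm_triangle_ineq4)
    also have "norm (1 / (1 - \<i> * complex_of_real \<tau>)) \<le> 1 / 1"
      unfolding norm_divide n_def[symmetric] using n by (intro frac_le) auto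
    finally show "norm (of_real (ln (x / (2 * pi))) - 1 / (1 - \<i> * complex_of_real \<tau>)) \<le> \<bar>ln (x / (2 * pi))\<bar> + 1"
      by simp
  qed (use x n in auto)
  also have "\<dots> = (x * \<bar>ln (x / (2 * pi))\<bar> + x) / (2 * pi) / n" by (simp add: field_simps)
  also have "\<dots> \<le> 2 / n"
  proof (rule divide_right_mono)
    have "x * \<bar>ln (x / (2 * pi))\<bar> + x \<le> 2 * (2 * pi)" using xl x pi_ge_two by linarith
    thus "(x * \<bar>ln (x / (2 * pi))\<bar> + x) / (2 * pi) \<le> 2" by (subst pos_divide_le_eq) auto
  qed (use n in auto)
  finally show ?thesis by (simp add: n_def)
qed

text \<open>Subtracting the two partial summations leaves the error \<open>R\<close> of the counting
  formula: at the boundary x with a factor of modulus 1, and integrated against a weight of modulus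
  |\<tau>| / t. The constant \<open>h\<close> bounds the lower boundary value
  \<open>H 1\<close>.\<close>

lemma zero_ordinate_sum_approx:
  obtains K h where "K \<ge> 0" "h \<ge> 0" 
    "\<And>\<tau> x. x \<ge> 1 \<Longrightarrow> norm (zero_ordinate_sum \<tau> x - zero_ordinate_main \<tau> x) \<le> K * (\<bar>\<tau>\<bar> * (ln (x + 2) * ln x) + ln (x + 2)) + h"
proof -
  obtain K where K: "K \<ge> 0" "\<And>T. T \<ge> 1 \<Longrightarrow> \<bar>zeta_zero_count T - zeta_zero_density T\<bar> \<le> K * ln (T + 2)"
    using Riemann_von_Mangoldt by blast
  define h where "h = 2 + \<bar>zeta_zero_density 1\<bar>"
  show ?thesis
  proof (rule that[of K h])
    show "h \<ge> 0" by (simp add: h_def)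
    fix \<tau> x :: real assume x: "x \<ge> 1"
    define f where "f = (\<lambda>t. \<i> * \<tau> * complex_of_real t powr (- (\<i> * \<tau>) - 1))"
    define u where "u = (\<lambda>t. complex_of_real t powr (- (\<i> * \<tau>)))"
    define R where "R = (\<lambda>t. zeta_zero_count t - zeta_zero_density t)"
    define H where "H = (\<lambda>t. zero_ordinate_main \<tau> t - of_real (zeta_zero_density t) * u t)"
    define J where "J = (zero_ordinate_sum \<tau> x - of_real (zeta_zero_count x) * u x) - (H x - H 1)"
    have "((\<lambda>t. of_real (zeta_zero_count t) * f t - of_real (zeta_zero_density t) * f t) has_integral J) {1..x}"
      unfolding J_def f_def H_def u_def
      by (intro has_integral_diff zero_ordinate_sum_partial_summation zero_ordinate_main_partial_summation x)
    hence hJ: "((\<lambda>t. of_real (R t) * f t) has_integral J) {1..x}"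
      by (simp add: R_def left_diff_distrib)
    have l: "((\<lambda>t. K * ln (x + 2) * \<bar>\<tau>\<bar> * (1 / t)) has_integral (K * ln (x + 2) * \<bar>\<tau>\<bar> * (ln x - ln 1))) {1..x}"
    proof (intro has_integral_mult_right fundamental_theorem_of_calculus)
      fix t assume t: "t \<in> {1..x}"
      show "(ln has_vector_derivative 1 / t) (at t within {1..x})"
        unfolding has_real_derivative_iff_has_vector_derivative[symmetric]
        using t by (auto intro!: derivative_eq_intros)
    qed (use x in auto)
    have "norm (integral {1..x} (\<lambda>t. of_real (R t) * f t)) \<le> integral {1..x} (\<lambda>t. K * ln (x + 2) * \<bar>\<tau>\<bar> * (1 / t))"
    proof (rule integral_norm_bound_integral)
      show "(\<lambda>t. of_real (R t) * f t) integrable_on {1..x}" "(\<lambda>t. K * ln (x + 2) * \<bar>\<tau>\<bar> * (1 / t)) integrable_on {1..x}"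
        using hJ l by (auto simp: integrable_on_def)
      fix t assume t: "t \<in> {1..x}"
      have "\<bar>R t\<bar> \<le> K * ln (t + 2)" using K(2)[of t] t by (simp add: R_def)
      also have "\<dots> \<le> K * ln (x + 2)" using t K(1) by (intro mult_left_mono) auto
      finally have R: "\<bar>R t\<bar> \<le> K * ln (x + 2)" .
      have "norm (complex_of_real t powr (- (\<i> * \<tau>) - 1)) = t powr (-1)"
        using t by (subst norm_powr_real_powr) auto
      also have "\<dots> = 1 / t" using t by (simp add: powr_minus divide_inverse)
      finally have nf: "norm (f t) = \<bar>\<tau>\<bar> * (1 / t)" by (simp add: f_def norm_mult)
      have "norm (of_real (R t) * f t) = \<bar>R t\<bar> * (\<bar>\<tau>\<bar> * (1 / t))" by (simp only: norm_mult norm_of_real nf)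
      also have "\<dots> \<le> K * ln (x + 2) * (\<bar>\<tau>\<bar> * (1 / t))" using R t by (intro mult_right_mono) auto
      finally show "norm (of_real (R t) * f t) \<le> K * ln (x + 2) * \<bar>\<tau>\<bar> * (1 / t)" by (simp only: mult.assoc)
    qed
    hence J: "norm J \<le> K * ln (x + 2) * \<bar>\<tau>\<bar> * ln x"
      unfolding integral_unique[OF hJ] integral_unique[OF l] by simp
    have nu: "norm (u t) = 1" if "t > 0" for t unfolding u_def using that by (rule norm_powr_imaginary)
    have 2: "norm (of_real (R x) * u x) \<le> K * ln (x + 2)"
      using K(2)[OF x] nu[of x] x by (simp only: norm_mult norm_of_real R_def) simp
    have "norm (H 1) \<le> norm (zero_ordinate_main \<tau> 1) + norm (of_real (zeta_zero_density 1) * u 1)"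
      unfolding H_def by (rule norm_triangle_ineq4)
    moreover have "norm (zero_ordinate_main \<tau> 1) \<le> 2 / 1"
    proof -
      have "norm (1 - \<i> * complex_of_real \<tau>) \<ge> 1" using abs_Re_le_cmod[of "1 - \<i> * complex_of_real \<tau>"] by simp
      hence "2 / norm (1 - \<i> * complex_of_real \<tau>) \<le> 2 / 1" by (intro frac_le) auto
      thus ?thesis using norm_zero_ordinate_main_le[of 1 \<tau>] by simp
    qed
    moreover have "norm (of_real (zeta_zero_density 1) * u 1) = \<bar>zeta_zero_density 1\<bar>" by (simp add: norm_mult nu)
    ultimately have 3: "norm (H 1) \<le> h" by (simp add: h_def)
    have "zero_ordinate_sum \<tau> x - zero_ordinate_main \<tau> x = J + of_real (R x) * u x - H 1"
      by (simp add: J_def H_def R_def algebra_simps)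
    also have "norm \<dots> \<le> norm J + norm (of_real (R x) * u x) + norm (H 1)"
      by (intro norm_triangle_le_diff add_mono order_refl norm_triangle_ineq)
    also have "\<dots> \<le> K * ln (x + 2) * \<bar>\<tau>\<bar> * ln x + K * ln (x + 2) + h" using J 2 3 by linarith
    finally show "norm (zero_ordinate_sum \<tau> x - zero_ordinate_main \<tau> x) \<le> K * (\<bar>\<tau>\<bar> * (ln (x + 2) * ln x) + ln (x + 2)) + h"
      by (simp add: algebra_simps)
  qed (rule K(1))
qed

text \<open>For x < 2 only a fixed finite set of zeros and a bounded main term occur; for x \<ge> 2
  the logarithms ln x and ln (x + 2) are comparable.\<close>

theorem theorem1:
  "\<exists>C::real. \<forall>\<tau>::real. \<forall>x::real. x > 0 \<longrightarrow>
     (\<bar>\<tau> * ln x\<bar> \<ge> 1 \<longrightarrow>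
        norm (zero_ordinate_sum \<tau> x - zero_ordinate_main \<tau> x) \<le> C * (\<bar>\<tau>\<bar> * (ln x)\<^sup>2)) \<and>
     norm (zero_ordinate_sum \<tau> x - zero_ordinate_main \<tau> x) \<le> C * (\<bar>\<tau>\<bar> * (ln x)\<^sup>2 + ln (x + 2))"
proof -
  obtain K h where K: "K \<ge> 0" "h \<ge> 0" 
    "\<And>\<tau> x. x \<ge> 1 \<Longrightarrow> norm (zero_ordinate_sum \<tau> x - zero_ordinate_main \<tau> x) \<le> K * (\<bar>\<tau>\<bar> * (ln (x + 2) * ln x) + ln (x + 2)) + h"
    using zero_ordinate_sum_approx by blast
  define Z where "Z = {\<rho>. \<rho> \<in> nontrivial_zeros \<and> 0 < Im \<rho> \<and> Im \<rho> < 2}"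
  have finZ: "finite Z" unfolding Z_def by (rule finite_zeta_zeros_below)
  \<comment> \<open>A height above 1 below which no zero lies: for x \<le> g the sum is empty, and
    for x > g the logarithm ln x is bounded away from 0.\<close>
  define g where "g = Min (insert 2 (Im ` Z))"
  have g1: "g > 1"
    using finZ nontrivial_zeros_region(3) by (force simp: g_def Z_def nontrivial_zeros_def)
  have g2: "g \<le> 2" and gZ: "\<And>\<rho>. \<rho> \<in> Z \<Longrightarrow> g \<le> Im \<rho>" using finZ by (auto simp: g_def)
  define k where "k = (\<Sum>\<rho>\<in>Z. \<bar>real_of_int (zorder zeta \<rho>)\<bar>)"
  have k0: "k \<ge> 0" unfolding k_def by (intro sum_nonneg) auto
  have lng: "ln g > 0" using g1 by simp
  \<comment> \<open>One summand for each case: x \<ge> 2, the main term for x < 2, the zeros for x <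
    2, and the second bound for x < 2.\<close>
  define C where "C = (4 * K + 2 * h) + 2 + k / ln g + (k + 2) / ln 2"
  have Cpos: "4 * K + 2 * h \<ge> 0" "k / ln g \<ge> 0" "(k + 2) / ln 2 \<ge> 0" using K k0 lng by auto
  show ?thesis
  proof (intro exI[of _ C] allI impI)
    fix \<tau> x :: real assume x: "x > 0"
    define E where "E = norm (zero_ordinate_sum \<tau> x - zero_ordinate_main \<tau> x)"
    define r where "r = \<bar>\<tau>\<bar> * (ln x)\<^sup>2"
    have r0: "r \<ge> 0" by (simp add: r_def)
    have r: "\<bar>ln x\<bar> \<le> r" if "\<bar>\<tau> * ln x\<bar> \<ge> 1"
    proof -
      have "1 * \<bar>ln x\<bar> \<le> \<bar>\<tau> * ln x\<bar> * \<bar>ln x\<bar>" using that by (intro mult_right_mono) auto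
      also have "\<dots> = \<bar>\<tau>\<bar> * (\<bar>ln x\<bar> * \<bar>ln x\<bar>)" by (simp only: abs_mult mult.assoc)
      also have "\<bar>ln x\<bar> * \<bar>ln x\<bar> = (ln x)\<^sup>2" by (simp add: power2_eq_square)
      also have "\<bar>\<tau>\<bar> * (ln x)\<^sup>2 = r" by (simp add: r_def)
      finally show ?thesis by simp
    qed
    have "(\<bar>\<tau> * ln x\<bar> \<ge> 1 \<longrightarrow> E \<le> C * r) \<and> E \<le> C * (r + ln (x + 2))"
    proof (cases "x < 2")
      case True
      define n where "n = norm (1 - \<i> * complex_of_real \<tau>)"
      have n: "n \<ge> 1" "n \<ge> \<bar>\<tau>\<bar>" 
        using abs_Re_le_cmod[of "1 - \<i> * complex_of_real \<tau>"] abs_Im_le_cmod[of "1 - \<i> * complex_of_real \<tau>"] by (auto simp: n_def)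
      have main: "norm (zero_ordinate_main \<tau> x) \<le> 2 / n"
        unfolding n_def by (rule norm_zero_ordinate_main_le[OF x True])
      have sum0: "zero_ordinate_sum \<tau> x = 0" if "x \<le> g"
      proof -
        have "{\<rho>. \<rho> \<in> nontrivial_zeros \<and> 0 < Im \<rho> \<and> Im \<rho> < x} = {}" 
          using gZ that g2 by (force simp: Z_def)
        thus ?thesis unfolding zero_ordinate_sum_def by (simp only: sum.empty)
      qed
      have sumk: "norm (zero_ordinate_sum \<tau> x) \<le> k"
      proof -
        \<comment> \<open>Cut off to 0 outside the upper half-plane, because
          \<open>zeta_zero_sum_below_bound\<close> wants modulus at most 1 everywhere.\<close>
        define f where "f = (\<lambda>\<rho>. if 0 < Im \<rho> then complex_of_real (Im \<rho>) powr (- (\<i> * of_real \<tau>)) else 0)"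
        have "zero_ordinate_sum \<tau> x = (\<Sum>\<rho> | \<rho> \<in> nontrivial_zeros \<and> 0 < Im \<rho> \<and> Im \<rho> < x. of_int (zorder zeta \<rho>) * f \<rho>)"
          unfolding zero_ordinate_sum_def by (intro sum.cong) (auto simp: f_def)
        also have "norm \<dots> \<le> k" unfolding k_def Z_def
          by (rule zeta_zero_sum_below_bound) (use True in \<open>auto simp: f_def norm_powr_imaginary\<close>)
        finally show ?thesis .
      qed
      have tri: "E \<le> norm (zero_ordinate_sum \<tau> x) + norm (zero_ordinate_main \<tau> x)"
        unfolding E_def by (rule norm_triangle_ineq4)
      have "E \<le> C * r" if t: "\<bar>\<tau> * ln x\<bar> \<ge> 1"
      proof -
        have \<tau>: "\<bar>\<tau>\<bar> > 0" using t by (cases "\<tau> = 0") auto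
        \<comment> \<open>The decay of the main term in \<tau> is traded for |ln x| through 1 /
          |\<tau>| \<le> |ln x|.\<close>
        have "2 / n \<le> 2 / \<bar>\<tau>\<bar>" using n \<tau> by (intro frac_le) auto
        also have "\<dots> \<le> 2 * \<bar>ln x\<bar>" using t \<tau> by (simp add: abs_mult divide_le_eq mult.commute)
        also have "\<dots> \<le> 2 * r" using r[OF t] by simp
        finally have m: "norm (zero_ordinate_main \<tau> x) \<le> 2 * r" using main by linarith
        have s: "norm (zero_ordinate_sum \<tau> x) \<le> k / ln g * r"
        proof (cases "x \<le> g")
          case True
          have "0 \<le> k / ln g * r" by (intro mult_nonneg_nonneg Cpos(2) r0)
          thus ?thesis using sum0[OF True] by (simp only: norm_zero)
        next
          case False
          have "ln g \<le> ln x" using False g1 x by simp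
          also have "\<dots> \<le> r" using r[OF t] by simp
          finally have "k / ln g * ln g \<le> k / ln g * r" using Cpos(2) by (rule mult_left_mono)
          thus ?thesis using sumk lng by simp
        qed
        have "C * r = (4 * K + 2 * h) * r + 2 * r + k / ln g * r + (k + 2) / ln 2 * r" 
          unfolding C_def by (simp only: distrib_right)
        moreover have "(4 * K + 2 * h) * r \<ge> 0" "(k + 2) / ln 2 * r \<ge> 0" using Cpos r0 by (intro mult_nonneg_nonneg; simp)+
        ultimately show ?thesis using tri m s by linarith
      qed
      moreover have "E \<le> C * (r + ln (x + 2))"
      proof -
        have "2 / n \<le> 2 / 1" using n by (intro frac_le) auto
        hence "E \<le> k + 2" using tri sumk main by linarith
        also have "\<dots> = (k + 2) / ln 2 * ln 2" by simp
        also have "\<dots> \<le> C * (r + ln (x + 2))"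
        proof (intro mult_mono)
          show "(k + 2) / ln 2 \<le> C" using Cpos by (simp add: C_def)
          have "ln 2 \<le> ln (x + 2)" using x by simp
          thus "ln 2 \<le> r + ln (x + 2)" using r0 by linarith
        qed (use Cpos in \<open>auto simp: C_def\<close>)
        finally show ?thesis .
      qed
      ultimately show ?thesis by blast
    next
      case False
      hence x2: "x \<ge> 2" by simp
      have lx: "ln x \<ge> 0" using x2 by simp
      \<comment> \<open>From x + 2 \<le> x^2 one gets ln (x + 2) \<le> 2 ln x, so that the boundary
        term is at most 2 \<open>r\<close> once |\<tau> ln x| \<ge> 1.\<close>
      have "x * 2 \<le> x * x" using x2 by (intro mult_left_mono) auto
      hence "x + 2 \<le> x * x" using x2 by linarith
      hence "ln (x + 2) \<le> ln (x * x)" using x2 by (subst ln_le_cancel_iff) auto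
      hence l2: "ln (x + 2) \<le> 2 * ln x" using x2 by (simp add: ln_mult)
      have "exp 1 \<le> (3 :: real)" by (rule exp_le)
      hence "exp 1 \<le> x + 2" using x2 by simp
      hence "ln (exp 1) \<le> ln (x + 2)" by (subst ln_le_cancel_iff) (use x2 in auto)
      hence l1: "ln (x + 2) \<ge> 1" by simp
      have "\<bar>\<tau>\<bar> * (ln (x + 2) * ln x) \<le> \<bar>\<tau>\<bar> * (2 * ln x * ln x)" using l2 lx by (intro mult_left_mono mult_right_mono) auto
      also have "\<dots> = 2 * r" by (simp add: r_def power2_eq_square)
      finally have "K * (\<bar>\<tau>\<bar> * (ln (x + 2) * ln x) + ln (x + 2)) \<le> K * (2 * r + ln (x + 2))" using K(1) by (intro mult_left_mono) auto
      moreover have "h * 1 \<le> h * ln (x + 2)" using l1 K(2) by (rule mult_left_mono)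
      ultimately have E: "E \<le> 2 * K * r + (K + h) * ln (x + 2)"
        using K(3)[of x \<tau>] x2 unfolding E_def by (simp add: algebra_simps)
      have "E \<le> C * r" if t: "\<bar>\<tau> * ln x\<bar> \<ge> 1"
      proof -
        have "ln (x + 2) \<le> 2 * r" using l2 r[OF t] by linarith
        hence "(K + h) * ln (x + 2) \<le> (K + h) * (2 * r)" using K by (intro mult_left_mono) auto
        hence "E \<le> (4 * K + 2 * h) * r" using E by (simp add: algebra_simps)
        also have "\<dots> \<le> C * r" using Cpos r0 by (intro mult_right_mono) (auto simp: C_def)
        finally show ?thesis .
      qed
      moreover have "E \<le> C * (r + ln (x + 2))"
      proof -
        have "2 * K * r \<le> C * r" using Cpos K r0 by (intro mult_right_mono) (auto simp: C_def)
        moreover have "(K + h) * ln (x + 2) \<le> C * ln (x + 2)" using Cpos K l1 by (intro mult_right_mono) (auto simp: C_def)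
        ultimately show ?thesis using E by (simp add: distrib_left)
      qed
      ultimately show ?thesis by blast
    qed
    thus "(\<bar>\<tau> * ln x\<bar> \<ge> 1 \<longrightarrow>
        norm (zero_ordinate_sum \<tau> x - zero_ordinate_main \<tau> x) \<le> C * (\<bar>\<tau>\<bar> * (ln x)\<^sup>2)) \<and>
     norm (zero_ordinate_sum \<tau> x - zero_ordinate_main \<tau> x) \<le> C * (\<bar>\<tau>\<bar> * (ln x)\<^sup>2 + ln (x + 2))"
      unfolding E_def r_def .
  qed
qed

end
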